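(* For all $n\ge 2$, Jones' $(n-1)$-subgroup $\overrightarrow{F}_{n-1}$ (the set of all reduced $(n-1)$-good diagrams in R. Thompson's group $F$) is isomorphic to $F_n$.
   Context: $F_n$ ($n\ge2$) is the group of all piecewise-linear increasing homeomorphisms of $[0,1]$ with all slopes powers of $n$ and all breaks of the derivative at $n$-adic fractions $\frac a{n^k}$; $F=F_2$. Products are composed from left to right. Diagrams: the cell $\pi$ is the plane directed graph whose top path is one edge and whose bottom path consists of two edges, with the same initial and terminal vertices (all edges are directed left to right). Diagrams over $\langle x\mid x=x^2\rangle$ are the plane graphs (up to isotopy) obtained from the single edge $\mathbf 1$ and from $\pi$ by addition $\Delta_1+\Delta_2$ (identify the terminal vertex of $\Delta_1$ with the initial vertex of $\Delta_2$), multiplication $\Delta_1\circ\Delta_2$ (identify the bottom path of $\Delta_1$ with the top path of $\Delta_2$ when they have the same length), and inversion (reflection in a horizontal line). A diagram $\Delta$ has an initial vertex $\iota(\Delta)$ and a terminal vertex $\tau(\Delta)$; the other vertices are called inner. A dipole is a subdiagram $\pi\circ\pi^{-1}$ or $\pi^{-1}\circ\pi$; it is eliminated by removing its two cells and identifying its top and bottom paths. A diagram is reduced if it has no dipoles; each diagram is equivalent via dipole moves to a unique reduced diagram. "Diagrams in $F$" are those whose top path and bottom path are single edges; reduced such diagrams, with product = reduced form of $\Delta_1\circ\Delta_2$, form a group identified with $F$ as follows. A reduced $\Delta$ is cut by its longest positive path from $\iota(\Delta)$ to $\tau(\Delta)$ as $\Delta=\Delta^+\circ\Delta^-$, where $\Delta^+$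 consists of cells $\pi$ and $\Delta^-$ of cells $\pi^{-1}$. Assign $[0,1]$ to the top edge of $\Delta^+$ and, for each cell, the left and right halves of the interval of its top edge to its left and right bottom edges; the bottom path of $\Delta^+$ gives a dyadic subdivision of $[0,1]$ (top subdivision). Doing the same with $(\Delta^-)^{-1}$ gives the bottom subdivision. $\Delta$ corresponds to the homeomorphism mapping each segment of the top subdivision linearly onto the corresponding segment of the bottom subdivision. Thompson graph $T(\Delta)$: its vertices are all vertices of $\Delta$ except $\tau(\Delta)$; its edges are, for every inner vertex $v$ of $\Delta$, the top-most incoming edge of $v$ in $\Delta$ (upper edge) and the bottom-most incoming edge of $v$ in $\Delta$ (lower edge), counted as two distinct edges if they coincide. The top (resp. bottom) path from $\iota(\Delta)$ to an inner vertex $v$ is the unique positive (left-to-right) path in $T(\Delta)$ from $\iota(\Delta)$ to $v$ composed entirely of upper (resp. lower) edges. For a positive integer $m$, $\Delta$ is $m$-good if for every inner vertex $v$ the lengths of the top path and of the bottom path from $\iota(\Delta)$ to $v$ are equal modulo $m$. $\overrightarrow{F}_m$ is the set of all reduced $m$-good diagrams in $F$ (it is a subgroup of $F$). *)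

theory Defs
  imports
    "HOL-Analysis.Analysis"
    "HOL-Algebra.Group"
    "Graph_Theory.Arc_Walk"
begin

section \<open>Diagrams over the semigroup presentation \<open>x = x\<^sup>2\<close>\<close>

text \<open>
  A plane graph obtained from copies of the cell \<open>\<pi>\<close> is recorded combinatorially: its
  edges, its cells (each given by its top path and its bottom path), and its own top and bottom
  path. Paths are lists of edges read from left to right. As the cells record which boundary path
  is the upper one and all edges point to the right, these data determine the plane embedding up
  to isotopy; plane isotopy of diagrams thus becomes isomorphism of these structures (relation
  \<open>isotopic\<close> below). An edge carries its end points and a label, since several edges may
  share both end points.
\<close>

datatype edge = Edge (source: nat) (label: nat) (target: nat)

type_synonym path = "edge list"

record diagram =
  edges :: "edge set"
  cells :: "(path \<times> path) set"
  top_path :: path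
  bottom_path :: path

definition path_vertices :: "path \<Rightarrow> nat set" where
  "path_vertices p = source ` set p \<union> target ` set p"

definition interior_vertices :: "path \<Rightarrow> nat set" where
  "interior_vertices p = target ` set (butlast p)"

definition vertices :: "diagram \<Rightarrow> nat set" where
  "vertices D = source ` edges D \<union> target ` edges D"

definition initial_vertex :: "diagram \<Rightarrow> nat" where
  "initial_vertex D = source (hd (top_path D))"

definition terminal_vertex :: "diagram \<Rightarrow> nat" where
  "terminal_vertex D = target (last (top_path D))"

definition inner_vertices :: "diagram \<Rightarrow> nat set" where
  "inner_vertices D = vertices D - {initial_vertex D, terminal_vertex D}"

definition edge_diagram :: "edge \<Rightarrow> diagram" where
  "edge_diagram e = \<lparr>edges = {e}, cells = {}, top_path = [e], bottom_path = [e]\<rparr>"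

definition cell_diagram :: "edge \<Rightarrow> edge \<Rightarrow> edge \<Rightarrow> diagram" where
  "cell_diagram e a b =
     \<lparr>edges = {e, a, b}, cells = {([e], [a, b])}, top_path = [e], bottom_path = [a, b]\<rparr>"

definition inverse_diagram :: "diagram \<Rightarrow> diagram" where
  "inverse_diagram D =
     \<lparr>edges = edges D, cells = {(q, p). (p, q) \<in> cells D},
      top_path = bottom_path D, bottom_path = top_path D\<rparr>"

text \<open>
  The identifications in sums and products are rendered by sharing: two diagrams may be added
  (multiplied) when the parts to be identified are literally equal and nothing else is shared.
  Every pair of diagrams (with matching lengths, for the product) can be brought into this
  position by renaming vertices and edges.
\<close>

definition addable :: "diagram \<Rightarrow> diagram \<Rightarrow> bool" where
  "addable D1 D2 \<longleftrightarrow>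
     terminal_vertex D1 = initial_vertex D2 \<and>
     vertices D1 \<inter> vertices D2 = {initial_vertex D2} \<and>
     edges D1 \<inter> edges D2 = {}"

definition add_diagram :: "diagram \<Rightarrow> diagram \<Rightarrow> diagram" where
  "add_diagram D1 D2 =
     \<lparr>edges = edges D1 \<union> edges D2, cells = cells D1 \<union> cells D2,
      top_path = top_path D1 @ top_path D2, bottom_path = bottom_path D1 @ bottom_path D2\<rparr>"

definition composable :: "diagram \<Rightarrow> diagram \<Rightarrow> bool" where
  "composable D1 D2 \<longleftrightarrow>
     bottom_path D1 = top_path D2 \<and>
     vertices D1 \<inter> vertices D2 = path_vertices (top_path D2) \<and>
     edges D1 \<inter> edges D2 = set (top_path D2)"

definition compose_diagram :: "diagram \<Rightarrow> diagram \<Rightarrow> diagram" where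
  "compose_diagram D1 D2 =
     \<lparr>edges = edges D1 \<union> edges D2, cells = cells D1 \<union> cells D2,
      top_path = top_path D1, bottom_path = bottom_path D2\<rparr>"

inductive is_diagram :: "diagram \<Rightarrow> bool" where
  unit: "is_diagram (edge_diagram (Edge u i v))" if "u \<noteq> v"
| cell: "is_diagram (cell_diagram (Edge u i v) (Edge u j w) (Edge w k v))"
    if "u \<noteq> v" "u \<noteq> w" "w \<noteq> v"
| add: "is_diagram (add_diagram D1 D2)" if "is_diagram D1" "is_diagram D2" "addable D1 D2"
| compose: "is_diagram (compose_diagram D1 D2)"
    if "is_diagram D1" "is_diagram D2" "composable D1 D2"
| inverse: "is_diagram (inverse_diagram D)" if "is_diagram D"

definition map_diagram :: "(edge \<Rightarrow> edge) \<Rightarrow> diagram \<Rightarrow> diagram" where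
  "map_diagram g D =
     \<lparr>edges = g ` edges D, cells = (\<lambda>(p, q). (map g p, map g q)) ` cells D,
      top_path = map g (top_path D), bottom_path = map g (bottom_path D)\<rparr>"

definition respects_ends :: "(nat \<Rightarrow> nat) \<Rightarrow> (edge \<Rightarrow> edge) \<Rightarrow> edge set \<Rightarrow> bool" where
  "respects_ends f g E \<longleftrightarrow>
     (\<forall>e\<in>E. source (g e) = f (source e) \<and> target (g e) = f (target e))"

definition isotopic :: "diagram \<Rightarrow> diagram \<Rightarrow> bool" where
  "isotopic D D' \<longleftrightarrow>
     (\<exists>f g. respects_ends f g (edges D) \<and> inj_on f (vertices D) \<and> inj_on g (edges D) \<and>
            D' = map_diagram g D)"

section \<open>Dipoles, reduced diagrams and the diagram group\<close>

text \<open>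
  Two cells form a dipole with top path \<open>p\<close> and bottom path \<open>r\<close> if \<open>q\<close> is both the bottom path
  of the first and the top path of the second. One of the paths \<open>p\<close>, \<open>q\<close> has length 1 and the
  other one has length 2, so this is a subdiagram \<open>\<pi> \<circ> \<pi>\<^sup>-\<^sup>1\<close> if \<open>p\<close> has length 1, and a
  subdiagram \<open>\<pi>\<^sup>-\<^sup>1 \<circ> \<pi>\<close> if \<open>p\<close> has length 2.
\<close>

definition dipole :: "diagram \<Rightarrow> path \<Rightarrow> path \<Rightarrow> path \<Rightarrow> bool" where
  "dipole D p q r \<longleftrightarrow> (p, q) \<in> cells D \<and> (q, r) \<in> cells D"

definition reduced :: "diagram \<Rightarrow> bool" where
  "reduced D \<longleftrightarrow> (\<nexists>p q r. dipole D p q r)"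

definition remove_dipole_cells :: "diagram \<Rightarrow> path \<Rightarrow> path \<Rightarrow> path \<Rightarrow> diagram" where
  "remove_dipole_cells D p q r =
     \<lparr>edges = edges D - set q, cells = cells D - {(p, q), (q, r)},
      top_path = top_path D, bottom_path = bottom_path D\<rparr>"

text \<open>
  After removing the two cells (hence also the path \<open>q\<close> between them), the maps \<open>f\<close> and \<open>g\<close>
  identify \<open>r\<close> with \<open>p\<close>, edge by edge and vertex by vertex, and identify nothing else.
\<close>

definition eliminates_dipole :: "diagram \<Rightarrow> diagram \<Rightarrow> bool" where
  "eliminates_dipole D D' \<longleftrightarrow>
     (\<exists>p q r f g. dipole D p q r \<and>
        respects_ends f g (edges D - set q) \<and>
        map g p = map g r \<and>
        inj_on f (vertices D - interior_vertices q - interior_vertices r) \<and>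
        inj_on g (edges D - set q - set r) \<and>
        D' = map_diagram g (remove_dipole_cells D p q r))"

definition dipole_equivalent :: "diagram \<Rightarrow> diagram \<Rightarrow> bool" where
  "dipole_equivalent =
     equivclp (\<lambda>D D'. is_diagram D \<and> is_diagram D' \<and> (isotopic D D' \<or> eliminates_dipole D D'))"

definition reduced_F_diagrams :: "diagram set" where
  "reduced_F_diagrams =
     {D. is_diagram D \<and> length (top_path D) = 1 \<and> length (bottom_path D) = 1 \<and> reduced D}"

definition isotopy :: "(diagram \<times> diagram) set" where
  "isotopy = {(D, D'). is_diagram D \<and> is_diagram D' \<and> isotopic D D'}"

definition F_mult :: "diagram set \<Rightarrow> diagram set \<Rightarrow> diagram set" where
  "F_mult X Y =
     (THE Z. Z \<in> reduced_F_diagrams // isotopy \<and>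
        (\<exists>D1\<in>X. \<exists>D2\<in>Y. \<exists>D\<in>Z. composable D1 D2 \<and> dipole_equivalent (compose_diagram D1 D2) D))"

definition thompson_F :: "diagram set monoid" where
  "thompson_F =
     \<lparr>carrier = reduced_F_diagrams // isotopy, mult = F_mult,
      one = isotopy `` {edge_diagram (Edge 0 0 1)}\<rparr>"

section \<open>Thompson graphs and Jones' subgroups\<close>

text \<open>
  Two incoming edges of a vertex \<open>v\<close> are neighbours in the top-to-bottom order at \<open>v\<close> exactly
  when they are the last edges of the top path and of the bottom path of a common cell.
\<close>

definition directly_above :: "diagram \<Rightarrow> (edge \<times> edge) set" where
  "directly_above D = {(last p, last q) | p q. (p, q) \<in> cells D}"

definition topmost_incoming :: "diagram \<Rightarrow> nat \<Rightarrow> edge \<Rightarrow> bool" where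
  "topmost_incoming D v e \<longleftrightarrow> e \<in> edges D \<and> target e = v \<and>
     (\<forall>e'\<in>edges D. target e' = v \<longrightarrow> (e, e') \<in> (directly_above D)\<^sup>*)"

definition bottommost_incoming :: "diagram \<Rightarrow> nat \<Rightarrow> edge \<Rightarrow> bool" where
  "bottommost_incoming D v e \<longleftrightarrow> e \<in> edges D \<and> target e = v \<and>
     (\<forall>e'\<in>edges D. target e' = v \<longrightarrow> (e', e) \<in> (directly_above D)\<^sup>*)"

text \<open>
  The tags keep an upper edge and a lower edge distinct even if they come from the same edge of
  the diagram.
\<close>

datatype thompson_edge = Upper (underlying: edge) | Lower (underlying: edge)

definition thompson_graph :: "diagram \<Rightarrow> (nat, thompson_edge) pre_digraph" where
  "thompson_graph D =
     \<lparr>verts = vertices D - {terminal_vertex D},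
      arcs = {Upper e | e v. v \<in> inner_vertices D \<and> topmost_incoming D v e} \<union>
             {Lower e | e v. v \<in> inner_vertices D \<and> bottommost_incoming D v e},
      tail = source \<circ> underlying, head = target \<circ> underlying\<rparr>"

definition thompson_top_path :: "diagram \<Rightarrow> nat \<Rightarrow> thompson_edge list" where
  "thompson_top_path D v =
     (THE p. pre_digraph.awalk (thompson_graph D) (initial_vertex D) p v \<and> set p \<subseteq> range Upper)"

definition thompson_bottom_path :: "diagram \<Rightarrow> nat \<Rightarrow> thompson_edge list" where
  "thompson_bottom_path D v =
     (THE p. pre_digraph.awalk (thompson_graph D) (initial_vertex D) p v \<and> set p \<subseteq> range Lower)"

definition good :: "nat \<Rightarrow> diagram \<Rightarrow> bool" where
  "good m D \<longleftrightarrow>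
     (\<forall>v\<in>inner_vertices D.
        length (thompson_top_path D v) mod m = length (thompson_bottom_path D v) mod m)"

definition jones_subgroup :: "nat \<Rightarrow> diagram set monoid" where
  "jones_subgroup m =
     thompson_F\<lparr>carrier := {D \<in> reduced_F_diagrams. good m D} // isotopy\<rparr>"

section \<open>The groups \<open>F\<^sub>n\<close> of piecewise linear homeomorphisms\<close>

definition n_adic :: "nat \<Rightarrow> real set" where
  "n_adic n = {of_int a / real n ^ k | (a :: int) (k :: nat). True}"

text \<open>
  The subdivision points include all breaks of the derivative, but the derivative need not jump
  at each of them.
\<close>

definition n_adic_piecewise_linear :: "nat \<Rightarrow> (real \<Rightarrow> real) \<Rightarrow> bool" where
  "n_adic_piecewise_linear n f \<longleftrightarrow>
     (\<exists>xs. xs \<noteq> [] \<and> sorted_wrt (<) xs \<and> hd xs = 0 \<and> last xs = 1 \<and> set xs \<subseteq> n_adic n \<and>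
        (\<forall>i. Suc i < length xs \<longrightarrow>
           (\<exists>(k :: int) c. \<forall>x\<in>{xs ! i..xs ! Suc i}. f x = real n powi k * x + c)))"

text \<open>
  Elements are functions on \<open>[0,1]\<close>, extended by \<open>undefined\<close> so that equality is equality on
  \<open>[0,1]\<close>; products are composed from left to right.
\<close>

definition F_group :: "nat \<Rightarrow> (real \<Rightarrow> real) monoid" where
  "F_group n =
     \<lparr>carrier = {f \<in> extensional {0..1}.
        (\<exists>g. homeomorphism {0..1} {0..1} f g) \<and> strict_mono_on {0..1} f \<and>
        n_adic_piecewise_linear n f},
      mult = (\<lambda>f g. compose {0..1} g f), one = restrict id {0..1}\<rparr>"

end

theory Submission
  imports Defs
begin

text \<open>
  A reduced diagram in \<open>F\<close> is a pair of binary trees glued along their leaves: the cells \<open>\<pi>\<close> form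
  one tree, the cells \<open>\<pi>\<^sup>-\<^sup>1\<close> the other one, and every inner vertex lies between two
  neighbouring leaves.
  Address a leaf by a binary word, 1 standing for a right turn. The top path to the vertex on the left
  of the \<open>i\<close>-th leaf consists of the left siblings that hang off the branch to this leaf, so its length
  is the number of ones in the address. Hence a diagram is \<open>m\<close>-good exactly if the \<open>i\<close>-th
  addresses in the two trees have equally many ones modulo \<open>m\<close>, for all \<open>i\<close>
  (\<open>good_pair_diagram\<close>).

  Put \<open>m = n - 1\<close> and read binary words as codes of \<open>n\<close>-ary expansions: \<open>1\<^sup>j0\<close> with \<open>j < m\<close> stands
  for the digit \<open>j\<close>, and \<open>1\<^sup>m\<close> for the digit \<open>m\<close>. Each word thus gets an interval in \<open>[0,1]\<close>; words
  that consist of complete codes get the standard \<open>n\<close>-adic intervals, and a word that ends after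
  \<open>s\<close> ones of an incomplete code (its phase) gets \<open>n - s\<close> of the \<open>n\<close> parts of such an interval.
  This turns tree pairs into piecewise linear maps. As \<open>n\<close> is 1 modulo \<open>n - 1\<close>, the left end of an interval is
  congruent to the number of ones in its word (\<open>left_end_residue\<close>), and its width is congruent to 1
  minus its phase.

  An element of \<open>F\<^sub>n\<close> moves \<open>n\<close>-adic fractions by multiples of \<open>n - 1\<close> in \<open>\<int>[1/n]\<close>
  (\<open>F_group_n_adic\<close>), and it maps a fine uniform subdivision onto standard intervals. So it yields a pair
  of trees, and this pair is good (\<open>diagram_of_F_group\<close>, \<open>good_of_F_group\<close>). Conversely, extend the
  two trees of a good pair in the same way at corresponding leaves, such that all leaves of the first
  tree have phase 0. Corresponding left ends are congruent, hence so are corresponding widths, and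
  therefore all leaves of the second tree have phase 0 as well. Both trees now subdivide
  \<open>[0,1]\<close> into standard \<open>n\<close>-adic intervals, and mapping one subdivision to the other
  is an element of \<open>F\<^sub>n\<close> (\<open>F_group_of_good_diagram\<close>).

  Developing maps connect diagrams with functions. Give every edge \<open>e\<close> a
  function \<open>L e\<close> on binary words, unaffected by trailing zeros, such that \<open>L e (0w) = L a w\<close> and \<open>L e (1w) = L b w\<close> whenever a cell has
  the boundary paths \<open>e\<close> and \<open>ab\<close>. The values on the bottom path determine \<open>L\<close> and can be prescribed
  (\<open>develops_exists\<close>, \<open>develops_unique\<close>), so a diagram in \<open>F\<close> transports functions from its
  bottom edge to its top edge. Transport is invariant under isotopy and under elimination of dipoles,
  and it turns products into compositions. A reduced diagram is determined up to isotopy by its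
  transport (\<open>reduced_transports_isotopic\<close>), and every diagram can be reduced (\<open>reduces_to\<close>). Therefore the
  product in \<open>F\<close> is well defined, and matching a good diagram with the \<open>f\<close> for which it transports
  \<open>left_end n 0\<close> to \<open>f \<circ> left_end n 0\<close> is an isomorphism onto \<open>F\<^sub>n\<close>.
\<close>

section \<open>Paths and cells\<close>

fun is_path :: "nat \<Rightarrow> path \<Rightarrow> nat \<Rightarrow> bool" where
  "is_path u [] v \<longleftrightarrow> u = v"
| "is_path u (e # p) v \<longleftrightarrow> source e = u \<and> is_path (target e) p v"

lemma is_path_append: "is_path u (p @ q) v \<longleftrightarrow> (\<exists>w. is_path u p w \<and> is_path w q v)"
  by (induction p arbitrary: u) auto

lemma is_path_last: "is_path u p v \<Longrightarrow> p \<noteq> [] \<Longrightarrow> target (last p) = v"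
  by (induction p arbitrary: u) auto

lemma is_path_hd: "is_path u p v \<Longrightarrow> p \<noteq> [] \<Longrightarrow> source (hd p) = u"
  by (cases p) auto

lemma path_vertices_path:
  "is_path u p v \<Longrightarrow> p \<noteq> [] \<Longrightarrow> path_vertices p = insert u (target ` set p)"
  unfolding path_vertices_def
proof (induction p arbitrary: u)
  case (Cons e p)
  then show ?case by (cases "p = []") auto
qed simp

lemma path_vertices_append: "path_vertices (p @ q) = path_vertices p \<union> path_vertices q"
  by (auto simp: path_vertices_def)

lemma path_vertices_Nil [simp]: "path_vertices [] = {}"
  by (auto simp: path_vertices_def)

text \<open>
  Boundary paths of diagrams never return to a vertex; this is what makes positions along a
  boundary path well defined.
\<close>
definition simple_path :: "nat \<Rightarrow> path \<Rightarrow> nat \<Rightarrow> bool" where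
  "simple_path u p v \<longleftrightarrow> p \<noteq> [] \<and> is_path u p v \<and> distinct (u # map target p)"

lemma simple_path_neq: "simple_path u p v \<Longrightarrow> u \<noteq> v"
  unfolding simple_path_def using is_path_last[of u p v] by (cases p rule: rev_cases) auto

lemma simple_path_append:
  assumes "is_path u p w" "is_path w q v" "distinct (u # map target p)" "distinct (w # map target q)"
    "insert u (target ` set p) \<inter> target ` set q = {}" "p @ q \<noteq> []"
  shows "simple_path u (p @ q) v"
  using assms by (auto simp: simple_path_def is_path_append)

definition triangle :: "edge \<Rightarrow> edge \<Rightarrow> edge \<Rightarrow> bool" where
  "triangle e a b \<longleftrightarrow> source a = source e \<and> target a = source b \<and> target b = target e"

definition cell_shape :: "path \<Rightarrow> path \<Rightarrow> bool" where
  "cell_shape p q \<longleftrightarrow>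
     (\<exists>e a b. triangle e a b \<and> (p = [e] \<and> q = [a, b] \<or> p = [a, b] \<and> q = [e]))"

lemma cell_shape_sym: "cell_shape p q \<Longrightarrow> cell_shape q p"
  unfolding cell_shape_def by blast

lemma cell_shape_nonempty: "cell_shape p q \<Longrightarrow> p \<noteq> [] \<and> q \<noteq> []"
  unfolding cell_shape_def by auto

lemma cell_shape_path: "cell_shape p q \<Longrightarrow> is_path u p v \<longleftrightarrow> is_path u q v"
  unfolding cell_shape_def triangle_def by auto

text \<open>
  Crossing a cell whose inner vertices are new keeps a boundary path simple: a new vertex is
  inserted, or an old one is skipped.
\<close>
lemma cell_shape_replace:
  assumes "simple_path u (l @ p @ r) v" "cell_shape p q"
    "interior_vertices q \<inter> path_vertices (l @ p @ r) = {}"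
  shows "simple_path u (l @ q @ r) v"
proof -
  obtain w w' where w: "is_path u l w" "is_path w p w'" "is_path w' r v"
    using assms(1) by (auto simp: simple_path_def is_path_append)
  have "is_path w q w'" using w(2) assms(2) cell_shape_path by blast
  then have "is_path u (l @ q @ r) v" using w by (auto simp: is_path_append)
  moreover have "path_vertices (l @ p @ r) = insert u (target ` set (l @ p @ r))"
    using assms(1) unfolding simple_path_def by (intro path_vertices_path) auto
  then have disj: "interior_vertices q \<inter> insert u (target ` set (l @ p @ r)) = {}"
    using assms(3) by simp
  have dist: "distinct (u # map target (l @ p @ r))" using assms(1) by (simp add: simple_path_def)
  from assms(2) obtain e a b where eab: "triangle e a b"
    "p = [e] \<and> q = [a, b] \<or> p = [a, b] \<and> q = [e]" unfolding cell_shape_def by blast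
  have "distinct (u # map target (l @ q @ r))"
    using eab(2)
  proof
    assume "p = [e] \<and> q = [a, b]"
    then show ?thesis using dist disj eab(1) by (simp add: interior_vertices_def triangle_def) blast
  next
    assume "p = [a, b] \<and> q = [e]"
    then show ?thesis using dist eab(1) by (simp add: triangle_def)
  qed
  ultimately show ?thesis using assms(2) by (auto simp: simple_path_def cell_shape_def)
qed

lemma path_vertices_replace:
  assumes "cell_shape p q"
  shows "path_vertices q \<subseteq> path_vertices p \<union> interior_vertices q"
  using assms unfolding cell_shape_def triangle_def
  by (auto simp: path_vertices_def interior_vertices_def)

section \<open>Diagrams built cell by cell\<close>

definition path_diagram :: "path \<Rightarrow> diagram" where
  "path_diagram p = \<lparr>edges = set p, cells = {}, top_path = p, bottom_path = p\<rparr>"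

definition attach_cell :: "diagram \<Rightarrow> path \<Rightarrow> path \<Rightarrow> path \<Rightarrow> path \<Rightarrow> diagram" where
  "attach_cell D l p q r =
     \<lparr>edges = edges D \<union> set q, cells = insert (p, q) (cells D),
      top_path = top_path D, bottom_path = l @ q @ r\<rparr>"

lemma attach_cell_simps [simp]:
  "edges (attach_cell D l p q r) = edges D \<union> set q"
  "cells (attach_cell D l p q r) = insert (p, q) (cells D)"
  "top_path (attach_cell D l p q r) = top_path D"
  "bottom_path (attach_cell D l p q r) = l @ q @ r"
  by (simp_all add: attach_cell_def)

lemma path_diagram_simps [simp]:
  "edges (path_diagram p) = set p" "cells (path_diagram p) = {}"
  "top_path (path_diagram p) = p" "bottom_path (path_diagram p) = p"
  by (simp_all add: path_diagram_def)

lemma vertices_path_diagram [simp]: "vertices (path_diagram p) = path_vertices p"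
  by (simp add: vertices_def path_vertices_def)

lemma vertices_attach_cell [simp]:
  "vertices (attach_cell D l p q r) = vertices D \<union> path_vertices q"
  by (auto simp: vertices_def path_vertices_def)

text \<open>
  Every diagram arises from a path by attaching one cell after another at the bottom. This linear
  description makes induction over diagrams possible, since only the bottom path changes in a step.
\<close>
inductive layered :: "diagram \<Rightarrow> bool" where
  base: "layered (path_diagram p)" if "simple_path u p v"
| attach: "layered (attach_cell D l p q r)"
    if "layered D" "bottom_path D = l @ p @ r" "cell_shape p q"
       "set q \<inter> edges D = {}" "interior_vertices q \<inter> vertices D = {}"

lemma path_vertices_subset: "set p \<subseteq> edges D \<Longrightarrow> path_vertices p \<subseteq> vertices D"
  by (auto simp: vertices_def path_vertices_def)

lemma layered_edges:
  "layered D \<Longrightarrow> set (top_path D) \<subseteq> edges D \<and> set (bottom_path D) \<subseteq> edges D \<and> finite (edges D)"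
  by (induction rule: layered.induct) auto

lemma layered_simple:
  "layered D \<Longrightarrow> simple_path (initial_vertex D) (top_path D) (terminal_vertex D) \<and>
     simple_path (initial_vertex D) (bottom_path D) (terminal_vertex D)"
proof (induction rule: layered.induct)
  case (base u p v)
  then have "initial_vertex (path_diagram p) = u" "terminal_vertex (path_diagram p) = v"
    by (auto simp: simple_path_def initial_vertex_def terminal_vertex_def is_path_hd is_path_last)
  with base show ?case by simp
next
  case (attach D l p r q)
  have eq: "initial_vertex (attach_cell D l p q r) = initial_vertex D"
    "terminal_vertex (attach_cell D l p q r) = terminal_vertex D"
    by (auto simp: initial_vertex_def terminal_vertex_def)
  have "path_vertices (l @ p @ r) \<subseteq> vertices D"
    using layered_edges[OF attach.hyps(1)] attach.hyps(2) by (metis path_vertices_subset)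
  then show ?case
    using attach cell_shape_replace[of "initial_vertex D" l p r "terminal_vertex D" q]
    unfolding eq by auto
qed

lemma simple_path_distinct: "simple_path u p v \<Longrightarrow> distinct p"
  by (auto simp: simple_path_def distinct_map)

lemma layered_distinct: "layered D \<Longrightarrow> distinct (top_path D) \<and> distinct (bottom_path D)"
  using layered_simple simple_path_distinct by blast

lemma layered_nonempty: "layered D \<Longrightarrow> top_path D \<noteq> [] \<and> bottom_path D \<noteq> []"
  using layered_simple simple_path_def by blast

lemma layered_cells:
  assumes "layered D"
  shows "(p, q) \<in> cells D \<Longrightarrow> set p \<subseteq> edges D \<and> set q \<subseteq> edges D \<and> cell_shape p q \<and>
           set p \<inter> set (bottom_path D) = {} \<and> set q \<inter> set (top_path D) = {}"
    and "finite (cells D)"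
  using assms
proof (induction arbitrary: p q rule: layered.induct)
  case (base u p v) { case 1 then show ?case by simp next case 2 then show ?case by simp }
next
  case (attach D l p' r q')
  note E = layered_edges[OF attach.hyps(1)]
  have dist: "distinct (l @ p' @ r)" using layered_distinct[OF attach.hyps(1)] attach.hyps(2) by metis
  have sub: "set (l @ p' @ r) \<subseteq> edges D" using E attach.hyps(2) by metis
  { case 1
    then consider "p = p'" "q = q'" | "(p, q) \<in> cells D" by auto
    then show ?case
    proof cases
      case 1
      then show ?thesis using dist sub attach.hyps E by auto
    next
      case 2
      then show ?thesis using attach.IH(1)[OF 2] attach.hyps sub by auto
    qed
  next
    case 2 then show ?case using attach.IH(2) by simp }
qed

text \<open>
  An edge disappears from the bottom path when a cell is attached below it and never comes back.
  So it is consumed by at most one cell, and, being new when it appears, produced by at most one.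
\<close>
lemma layered_cells_disjoint:
  assumes "layered D" "(p, q) \<in> cells D" "(p', q') \<in> cells D" "(p, q) \<noteq> (p', q')"
  shows "set p \<inter> set p' = {} \<and> set q \<inter> set q' = {}"
  using assms
proof (induction arbitrary: p q p' q' rule: layered.induct)
  case (attach D l p0 r q0)
  note C = layered_cells(1)[OF attach.hyps(1)]
  have *: "set x \<inter> set p0 = {} \<and> set y \<inter> set q0 = {}" if "(x, y) \<in> cells D" for x y
    using C[OF that] attach.hyps by auto
  have "(p, q) = (p0, q0) \<or> (p, q) \<in> cells D" "(p', q') = (p0, q0) \<or> (p', q') \<in> cells D"
    using attach.prems by auto
  then show ?case using attach.IH[of p q p' q'] *[of p q] *[of p' q'] attach.prems(3)
    by (elim disjE) (simp_all add: Int_commute)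
qed simp

text \<open>
  The cells of the second factor are attached one by one below the first factor. They stay
  attachable, since the factors share only the common boundary path.
\<close>
lemma layered_compose:
  assumes "layered D2" "layered D1" "composable D1 D2"
  shows "layered (compose_diagram D1 D2)"
  using assms
proof (induction rule: layered.induct)
  case (base u p v)
  have "compose_diagram D1 (path_diagram p) = D1"
    using base layered_edges[of D1] by (cases D1) (auto simp: compose_diagram_def composable_def)
  with base show ?case by simp
next
  case (attach D l p r q)
  let ?C = "compose_diagram D1 D"
  have top: "path_vertices (top_path D) \<subseteq> vertices D" "set (top_path D) \<subseteq> edges D"
    using layered_edges[OF attach.hyps(1)] path_vertices_subset by auto
  have comp: "composable D1 D"
    using attach.prems(2) top attach.hyps(4) by (auto simp: composable_def)
  have 1: "set q \<inter> edges D1 = {}"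
    using attach.prems(2) top attach.hyps(4) by (auto simp: composable_def)
  have 2: "interior_vertices q \<inter> vertices D1 = {}"
  proof -
    have "interior_vertices q \<subseteq> path_vertices q"
      by (auto simp: interior_vertices_def path_vertices_def dest: in_set_butlastD)
    moreover have "vertices D1 \<inter> path_vertices q \<subseteq> vertices D"
      using attach.prems(2) top(1) unfolding composable_def by auto
    ultimately show ?thesis using attach.hyps(5) by blast
  qed
  have v: "vertices ?C = vertices D1 \<union> vertices D"
    by (auto simp: vertices_def compose_diagram_def)
  have "layered (attach_cell ?C l p q r)"
    by (rule layered.attach) (use attach comp 1 2 in \<open>auto simp: v\<close>, auto simp: compose_diagram_def)
  moreover have "attach_cell ?C l p q r = compose_diagram D1 (attach_cell D l p q r)"
    by (auto simp: compose_diagram_def attach_cell_def)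
  ultimately show ?case by simp
qed

lemma vertices_add: "vertices (add_diagram D1 D2) = vertices D1 \<union> vertices D2"
  by (auto simp: vertices_def add_diagram_def)

lemma interior_subset: "interior_vertices q \<subseteq> path_vertices q"
  by (auto simp: interior_vertices_def path_vertices_def dest: in_set_butlastD)

lemma initial_in_vertices: "layered D \<Longrightarrow> initial_vertex D \<in> vertices D"
  and terminal_in_vertices: "layered D \<Longrightarrow> terminal_vertex D \<in> vertices D"
  using layered_edges[of D] layered_nonempty[of D] hd_in_set[of "top_path D"] last_in_set[of "top_path D"]
  unfolding initial_vertex_def terminal_vertex_def vertices_def by blast+

lemma layered_add_path:
  assumes "layered D" "simple_path u p v" "addable D (path_diagram p)"
  shows "layered (add_diagram D (path_diagram p))"
  using assms
proof (induction rule: layered.induct)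
  case (base u' p' v')
  have hd: "initial_vertex (path_diagram p) = u" "terminal_vertex (path_diagram p') = v'"
    using base by (auto simp: initial_vertex_def terminal_vertex_def simple_path_def is_path_hd is_path_last)
  have "simple_path u' (p' @ p) v"
  proof (rule simple_path_append)
    have vs: "path_vertices p = insert u (target ` set p)" "path_vertices p' = insert u' (target ` set p')"
      using base path_vertices_path by (auto simp: simple_path_def)
    show "insert u' (target ` set p') \<inter> target ` set p = {}"
    proof -
      have "insert u' (target ` set p') \<inter> insert u (target ` set p) = {u}"
        using base(3) hd unfolding addable_def vertices_path_diagram vs by simp
      moreover have "u \<notin> target ` set p" using base(2) by (simp add: simple_path_def)
      moreover have "A \<inter> B = {}" if "A \<inter> insert u B = {u}" "u \<notin> B" for A B :: "nat set"
        using that by auto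
      ultimately show ?thesis by metis
    qed
  next
    have "u = v'" using base(3) hd unfolding addable_def by metis
    then show "is_path u' p' v'" "is_path v' p v" "distinct (u' # map target p')"
      "distinct (v' # map target p)" "p' @ p \<noteq> []"
      using base(1,2) unfolding simple_path_def by simp_all
  qed
  then have "layered (path_diagram (p' @ p))" by (rule layered.base)
  moreover have "path_diagram (p' @ p) = add_diagram (path_diagram p') (path_diagram p)"
    by (auto simp: path_diagram_def add_diagram_def)
  ultimately show ?case by simp
next
  case (attach D l p' r q)
  let ?P = "path_diagram p"
  have eq: "terminal_vertex (attach_cell D l p' q r) = terminal_vertex D"
    by (auto simp: terminal_vertex_def)
  have add: "addable D ?P"
    using attach.prems terminal_in_vertices[OF attach.hyps(1)] eq by (auto simp: addable_def)
  have "layered (attach_cell (add_diagram D ?P) l p' q (r @ p))"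
  proof (rule layered.attach)
    show "bottom_path (add_diagram D ?P) = l @ p' @ r @ p"
      using attach by (simp add: add_diagram_def)
    show "set q \<inter> edges (add_diagram D ?P) = {}"
      using attach by (auto simp: add_diagram_def addable_def)
    show "interior_vertices q \<inter> vertices (add_diagram D ?P) = {}"
      using attach interior_subset[of q] terminal_in_vertices[OF attach.hyps(1)] eq
      by (auto simp: vertices_add addable_def)
  qed (use attach add in auto)
  moreover have "attach_cell (add_diagram D ?P) l p' q (r @ p) = add_diagram (attach_cell D l p' q r) ?P"
    by (auto simp: add_diagram_def attach_cell_def)
  ultimately show ?case by simp
qed

lemma layered_add:
  assumes "layered D2" "layered D1" "addable D1 D2"
  shows "layered (add_diagram D1 D2)"
  using assms
proof (induction rule: layered.induct)
  case (base u p v)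
  then show ?case using layered_add_path by blast
next
  case (attach D l p r q)
  have eq: "initial_vertex (attach_cell D l p q r) = initial_vertex D"
    by (auto simp: initial_vertex_def)
  have add: "addable D1 D"
    using attach.prems initial_in_vertices[OF attach.hyps(1)] eq by (auto simp: addable_def)
  have "layered (attach_cell (add_diagram D1 D) (bottom_path D1 @ l) p q r)"
  proof (rule layered.attach)
    show "bottom_path (add_diagram D1 D) = (bottom_path D1 @ l) @ p @ r"
      using attach by (simp add: add_diagram_def)
    show "set q \<inter> edges (add_diagram D1 D) = {}"
      using attach by (auto simp: add_diagram_def addable_def)
    show "interior_vertices q \<inter> vertices (add_diagram D1 D) = {}"
      using attach interior_subset[of q] initial_in_vertices[OF attach.hyps(1)] eq
      by (auto simp: vertices_add addable_def)
  qed (use attach add in auto)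
  moreover have "attach_cell (add_diagram D1 D) (bottom_path D1 @ l) p q r
      = add_diagram D1 (attach_cell D l p q r)"
    by (auto simp: add_diagram_def attach_cell_def)
  ultimately show ?case by simp
qed

lemma inverse_diagram_simps [simp]:
  "edges (inverse_diagram D) = edges D" "cells (inverse_diagram D) = {(q, p). (p, q) \<in> cells D}"
  "top_path (inverse_diagram D) = bottom_path D" "bottom_path (inverse_diagram D) = top_path D"
  by (simp_all add: inverse_diagram_def)

lemma vertices_inverse [simp]: "vertices (inverse_diagram D) = vertices D"
  by (auto simp: vertices_def inverse_diagram_def)

text \<open>
  Reading the construction backwards: the mirror image of the last cell comes first, attached to the
  former bottom path, and the rest is a product with it.
\<close>
lemma layered_inverse:
  assumes "layered D"
  shows "layered (inverse_diagram D)"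
  using assms
proof (induction rule: layered.induct)
  case (base u p v)
  have "inverse_diagram (path_diagram p) = path_diagram p"
    by (simp add: inverse_diagram_def path_diagram_def)
  then show ?case using layered.base[OF base] by metis
next
  case (attach D l p r q)
  note E = layered_edges[OF attach.hyps(1)]
  note S = layered_simple[OF attach.hyps(1), unfolded attach.hyps(2)]
  have pv: "path_vertices (l @ p @ r) \<subseteq> vertices D"
    using E attach.hyps(2) by (metis path_vertices_subset)
  let ?A = "attach_cell (path_diagram (l @ q @ r)) l q p r"
  have Sq: "simple_path (initial_vertex D) (l @ q @ r) (terminal_vertex D)"
    using cell_shape_replace[OF conjunct2[OF S] attach.hyps(3)] pv attach.hyps(5) by blast
  have A: "layered ?A"
  proof (rule layered.attach)
    show "layered (path_diagram (l @ q @ r))" using Sq by (rule layered.base)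
    show "cell_shape q p" using attach.hyps(3) by (rule cell_shape_sym)
    show "set p \<inter> edges (path_diagram (l @ q @ r)) = {}"
      using S simple_path_distinct[OF conjunct2[OF S]] E attach.hyps by auto
    show "interior_vertices p \<inter> vertices (path_diagram (l @ q @ r)) = {}"
    proof -
      have v: "path_vertices (l @ q @ r) = insert (initial_vertex D) (target ` set (l @ q @ r))"
        using Sq unfolding simple_path_def by (intro path_vertices_path) auto
      show ?thesis using attach.hyps(3) S unfolding vertices_path_diagram v cell_shape_def
        by (auto simp: interior_vertices_def simple_path_def triangle_def)
    qed
  qed simp
  have pq: "interior_vertices q \<inter> path_vertices (l @ p @ r) = {}" using pv attach.hyps(5) by blast
  have sub: "path_vertices q \<subseteq> path_vertices p \<union> interior_vertices q"
    using path_vertices_replace attach.hyps(3) by blast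
  have "composable ?A (inverse_diagram D)"
    unfolding composable_def
  proof (intro conjI)
    show "bottom_path ?A = top_path (inverse_diagram D)"
      using attach.hyps(2) by (simp add: inverse_diagram_def)
    show "vertices ?A \<inter> vertices (inverse_diagram D) = path_vertices (top_path (inverse_diagram D))"
      using pv sub attach.hyps(2,5)
      by (auto simp: path_vertices_append)
    show "edges ?A \<inter> edges (inverse_diagram D) = set (top_path (inverse_diagram D))"
      using E attach.hyps(2,4) by (auto simp: inverse_diagram_def)
  qed
  then have "layered (compose_diagram ?A (inverse_diagram D))"
    using layered_compose[OF attach.IH A] by blast
  moreover have "compose_diagram ?A (inverse_diagram D) = inverse_diagram (attach_cell D l p q r)"
    using E unfolding attach.hyps(2)
    by (auto simp: compose_diagram_def inverse_diagram_def attach_cell_def)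
  ultimately show ?case by simp
qed

lemma diagram_imp_layered: "is_diagram D \<Longrightarrow> layered D"
proof (induction rule: is_diagram.induct)
  case (unit u v i)
  have "edge_diagram (Edge u i v) = path_diagram [Edge u i v]"
    by (simp add: edge_diagram_def path_diagram_def)
  moreover have "simple_path u [Edge u i v] v" using unit by (simp add: simple_path_def)
  ultimately show ?case using layered.base by metis
next
  case (cell u v w i j k)
  let ?e = "Edge u i v" and ?a = "Edge u j w" and ?b = "Edge w k v"
  have "simple_path u [?e] v" using cell by (simp add: simple_path_def)
  then have "layered (path_diagram [?e])" by (rule layered.base)
  then have "layered (attach_cell (path_diagram [?e]) [] [?e] [?a, ?b] [])"
    by (rule layered.attach)
      (use cell in \<open>auto simp: cell_shape_def triangle_def interior_vertices_def path_vertices_def\<close>)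
  moreover have "cell_diagram ?e ?a ?b = attach_cell (path_diagram [?e]) [] [?e] [?a, ?b] []"
    by (auto simp: cell_diagram_def attach_cell_def path_diagram_def)
  ultimately show ?case by simp
next
  case (add D1 D2)
  then show ?case using layered_add by blast
next
  case (compose D1 D2)
  then show ?case using layered_compose by blast
next
  case (inverse D)
  then show ?case by (simp add: layered_inverse)
qed

section \<open>Attaching a cell as a product\<close>

text \<open>
  A diagram with edges added on its left and on its right. Whiskered single cells are the atomic
  diagrams by which a diagram is multiplied when a cell is attached.
\<close>
definition whisker :: "path \<Rightarrow> diagram \<Rightarrow> path \<Rightarrow> diagram" where
  "whisker l D r = \<lparr>edges = set l \<union> edges D \<union> set r, cells = cells D,
     top_path = l @ top_path D @ r, bottom_path = l @ bottom_path D @ r\<rparr>"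

lemma whisker_Nil [simp]: "whisker [] D [] = D"
  by (simp add: whisker_def)

lemma vertices_whisker:
  "vertices (whisker l D r) = path_vertices l \<union> vertices D \<union> path_vertices r"
  by (auto simp: vertices_def path_vertices_def whisker_def)

lemma vertices_edge_diagram: "vertices (edge_diagram e) = {source e, target e}"
  "initial_vertex (edge_diagram e) = source e" "terminal_vertex (edge_diagram e) = target e"
  by (auto simp: vertices_def edge_diagram_def initial_vertex_def terminal_vertex_def)

lemma is_diagram_edge: "source e \<noteq> target e \<Longrightarrow> is_diagram (edge_diagram e)"
  by (cases e) (simp add: is_diagram.unit)

lemma is_diagram_whisker_left:
  assumes "is_diagram D" "is_path u l (initial_vertex D)" "distinct (u # map target l)"
    "insert u (target ` set l) \<inter> vertices D \<subseteq> {initial_vertex D}" "set l \<inter> edges D = {}"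
  shows "is_diagram (whisker l D [])"
  using assms
proof (induction l arbitrary: u)
  case Nil
  then show ?case by simp
next
  case (Cons e l)
  let ?W = "whisker l D []"
  have W: "is_diagram ?W"
    by (rule Cons.IH[of "target e"]) (use Cons.prems in auto)
  have init: "initial_vertex ?W = target e"
    using Cons.prems(2) layered_nonempty[OF diagram_imp_layered[OF assms(1)]]
    by (cases l) (auto simp: initial_vertex_def whisker_def)
  have pl: "is_path (target e) l (initial_vertex D)" using Cons.prems(2) by simp
  have pv: "path_vertices l \<subseteq> insert (target e) (target ` set l)"
    using path_vertices_path[OF pl] by (cases "l = []") auto
  have last: "initial_vertex D \<in> insert (target e) (target ` set l)"
    using is_path_last[OF pl] pl last_in_set[of l] by (cases "l = []") (simp, metis image_eqI insertI2)
  have "source e \<notin> vertices D" "source e \<notin> path_vertices l" "source e \<noteq> target e"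
    using Cons.prems last pv by auto
  moreover have "target e \<in> vertices ?W"
    using initial_in_vertices[OF diagram_imp_layered[OF W]] init by simp
  moreover have "e \<notin> edges ?W"
    using Cons.prems by (auto simp: whisker_def)
  ultimately have "is_diagram (add_diagram (edge_diagram e) ?W)"
    using is_diagram.add[OF is_diagram_edge W] init
    by (simp add: addable_def vertices_edge_diagram vertices_whisker)
      (simp add: edge_diagram_def)
  moreover have "add_diagram (edge_diagram e) ?W = whisker (e # l) D []"
    by (simp add: add_diagram_def edge_diagram_def whisker_def)
  ultimately show ?case by simp
qed

lemma is_diagram_whisker_right:
  assumes "is_diagram D" "is_path (terminal_vertex D) r v" "distinct (map target r)"
    "target ` set r \<inter> vertices D = {}" "set r \<inter> edges D = {}"
  shows "is_diagram (whisker [] D r)"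
  using assms
proof (induction r arbitrary: v rule: rev_induct)
  case Nil
  then show ?case by simp
next
  case (snoc e r)
  let ?W = "whisker [] D r"
  have path: "is_path (terminal_vertex D) r (source e)"
    using snoc.prems(2) by (auto simp: is_path_append)
  have W: "is_diagram ?W"
    by (rule snoc.IH[OF _ path]) (use snoc.prems in auto)
  note DS = diagram_imp_layered[OF assms(1)]
  have trm: "terminal_vertex ?W = source e"
    using path is_path_last[OF path] layered_nonempty[OF DS]
    by (cases "r = []") (auto simp: terminal_vertex_def whisker_def)
  have pv: "path_vertices r \<subseteq> insert (terminal_vertex D) (target ` set r)"
    using path_vertices_path[OF path] by (cases "r = []") auto
  have t: "target e \<notin> vertices D" "target e \<notin> target ` set r" "terminal_vertex D \<in> vertices D"
    using snoc.prems(3,4) terminal_in_vertices[OF DS] by auto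
  have "source e \<in> insert (terminal_vertex D) (target ` set r)"
    using is_path_last[OF path] path last_in_set[of r]
    by (cases "r = []") (simp, metis image_eqI insertI2)
  then have "source e = terminal_vertex D \<or> source e \<in> target ` set r" by (rule insertE) simp_all
  then have "source e \<noteq> target e"
  proof
    assume "source e = terminal_vertex D" then show ?thesis using t(1,3) by metis
  next
    assume *: "source e \<in> target ` set r"
    show ?thesis by (rule notI) (use * t(2) in simp)
  qed
  moreover have "target e \<notin> path_vertices r"
  proof
    assume "target e \<in> path_vertices r"
    then have "target e \<in> insert (terminal_vertex D) (target ` set r)" by (rule subsetD[OF pv])
    then show False
    proof (rule insertE)
      assume "target e = terminal_vertex D" then show False using t(1,3) by simp
    qed (use t(2) in simp)
  qed
  moreover note t(1)
  moreover have "source e \<in> vertices ?W"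
    using terminal_in_vertices[OF diagram_imp_layered[OF W]] trm by simp
  moreover have "e \<notin> edges ?W"
    using snoc.prems by (auto simp: whisker_def)
  ultimately have "is_diagram (add_diagram ?W (edge_diagram e))"
    using is_diagram.add[OF W is_diagram_edge] trm
    by (simp add: addable_def vertices_edge_diagram vertices_whisker)
      (simp add: edge_diagram_def)
  moreover have "add_diagram ?W (edge_diagram e) = whisker [] D (r @ [e])"
    by (auto simp add: add_diagram_def edge_diagram_def whisker_def)
  ultimately show ?case by simp
qed

lemma is_diagram_path:
  assumes "simple_path u p v" shows "is_diagram (path_diagram p)"
proof -
  obtain e r where p: "p = e # r" using assms by (cases p) (auto simp: simple_path_def)
  have ne: "source e \<noteq> target e" using assms p by (auto simp: simple_path_def)
  have "is_diagram (whisker [] (edge_diagram e) r)"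
  proof (rule is_diagram_whisker_right)
    show "is_diagram (edge_diagram e)" using ne by (rule is_diagram_edge)
    show "is_path (terminal_vertex (edge_diagram e)) r v"
      using assms p by (simp add: simple_path_def vertices_edge_diagram)
    show "set r \<inter> edges (edge_diagram e) = {}"
      using simple_path_distinct[OF assms] p by (simp add: edge_diagram_def)
    show "target ` set r \<inter> vertices (edge_diagram e) = {}"
      using assms p by (auto simp: vertices_edge_diagram simple_path_def)
  qed (use assms p in \<open>simp add: simple_path_def\<close>)
  moreover have "whisker [] (edge_diagram e) r = path_diagram p"
    by (simp add: whisker_def edge_diagram_def path_diagram_def p)
  ultimately show ?thesis by simp
qed

definition single_cell :: "path \<Rightarrow> path \<Rightarrow> diagram" where
  "single_cell p q = \<lparr>edges = set p \<union> set q, cells = {(p, q)}, top_path = p, bottom_path = q\<rparr>"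

lemma is_diagram_single_cell:
  assumes "cell_shape p q" "simple_path u p v" "simple_path u q v"
  shows "is_diagram (single_cell p q)"
proof -
  from assms(1) obtain e a b where t: "triangle e a b"
    "p = [e] \<and> q = [a, b] \<or> p = [a, b] \<and> q = [e]" unfolding cell_shape_def by blast
  have "is_diagram (cell_diagram (Edge (source e) (label e) (target e))
      (Edge (source e) (label a) (target a)) (Edge (target a) (label b) (target e)))"
    by (rule is_diagram.cell) (use t assms in \<open>auto simp: triangle_def simple_path_def\<close>)
  then have cell: "is_diagram (cell_diagram e a b)"
    using t(1) by (cases e, cases a, cases b) (simp add: triangle_def)
  show ?thesis using t(2)
  proof
    assume "p = [e] \<and> q = [a, b]"
    then have "single_cell p q = cell_diagram e a b"
      by (auto simp: single_cell_def cell_diagram_def)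
    then show ?thesis using cell by simp
  next
    assume "p = [a, b] \<and> q = [e]"
    then have "single_cell p q = inverse_diagram (cell_diagram e a b)"
      by (auto simp: single_cell_def cell_diagram_def inverse_diagram_def)
    then show ?thesis using is_diagram.inverse[OF cell] by simp
  qed
qed

lemma vertices_single_cell: "vertices (single_cell p q) = path_vertices p \<union> path_vertices q"
  by (auto simp: vertices_def path_vertices_def single_cell_def)

text \<open>
  Attaching a cell below \<open>p\<close> is multiplication with the sum of the path on the left, the cell,
  and the path on the right.
\<close>
lemma is_diagram_attach:
  assumes "is_diagram D" "bottom_path D = l @ p @ r" "cell_shape p q"
    "set q \<inter> edges D = {}" "interior_vertices q \<inter> vertices D = {}"
  shows "is_diagram (attach_cell D l p q r)"
proof -
  note S = diagram_imp_layered[OF assms(1)]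
  define u v where "u = initial_vertex D" and "v = terminal_vertex D"
  have sp: "simple_path u (l @ p @ r) v"
    using layered_simple[OF S] assms(2) by (simp add: u_def v_def)
  have ne: "p \<noteq> []" "q \<noteq> []" using assms(3) cell_shape_nonempty by auto
  have pvD: "path_vertices (l @ p @ r) \<subseteq> vertices D" and subD: "set (l @ p @ r) \<subseteq> edges D"
    using layered_edges[OF S] assms(2) path_vertices_subset by metis+
  obtain w w' where w: "is_path u l w" "is_path w p w'" "is_path w' r v"
    using sp by (auto simp: simple_path_def is_path_append)
  have dist: "distinct (u # map target (l @ p @ r))" using sp by (simp add: simple_path_def)
  have pvp: "path_vertices p = insert w (target ` set p)"
    using w(2) ne path_vertices_path by blast
  have w_in: "w \<in> insert u (target ` set l)" using w(1) is_path_last[OF w(1)] by (cases "l = []") auto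
  have pvl: "insert u (target ` set l) \<subseteq> path_vertices (l @ p @ r)" "target ` set r \<subseteq> path_vertices (l @ p @ r)"
    using path_vertices_path[of u "l @ p @ r" v] sp by (auto simp: simple_path_def)
  have spp: "simple_path w p w'"
    using ne w dist w_in by (auto simp: simple_path_def)
  have qp: "path_vertices q \<subseteq> path_vertices p \<union> interior_vertices q"
    using assms(3) path_vertices_replace by blast
  have "simple_path w ([] @ q @ []) w'"
    by (rule cell_shape_replace) (use spp assms pvD in \<open>auto simp: path_vertices_append\<close>)
  then have C: "is_diagram (single_cell p q)"
    using is_diagram_single_cell[OF assms(3) spp] by simp
  have vC: "vertices (single_cell p q) \<subseteq> insert w (target ` set p) \<union> interior_vertices q"
    using qp pvp by (auto simp: vertices_single_cell)
  have iC: "initial_vertex (single_cell p q) = w" "terminal_vertex (single_cell p q) = w'"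
    using is_path_hd[OF w(2)] is_path_last[OF w(2)] ne
    by (auto simp: initial_vertex_def terminal_vertex_def single_cell_def)
  have iq: "interior_vertices q \<inter> path_vertices (l @ p @ r) = {}" using assms(5) pvD by blast
  have eC: "edges (single_cell p q) = set p \<union> set q" by (simp add: single_cell_def)
  note dl = simple_path_distinct[OF sp]
  have L: "is_diagram (whisker l (single_cell p q) [])"
  proof (rule is_diagram_whisker_left[OF C, of u])
    show "insert u (target ` set l) \<inter> vertices (single_cell p q) \<subseteq> {initial_vertex (single_cell p q)}"
    proof -
      have "insert u (target ` set l) \<inter> target ` set p = {}" using dist by auto
      moreover have "insert u (target ` set l) \<inter> interior_vertices q = {}" using pvl iq by blast
      ultimately have "insert u (target ` set l) \<inter> (insert w (target ` set p) \<union> interior_vertices q) \<subseteq> {w}"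
        by auto
      then show ?thesis unfolding iC using vC by (meson Int_mono order_refl order_trans)
    qed
    show "set l \<inter> edges (single_cell p q) = {}" using dl subD assms(4) unfolding eC by auto
  qed (use w iC dist in auto)
  have tL: "terminal_vertex (whisker l (single_cell p q) []) = w'"
    using iC ne by (auto simp: whisker_def terminal_vertex_def single_cell_def)
  have R: "is_diagram (whisker [] (whisker l (single_cell p q) []) r)"
  proof (rule is_diagram_whisker_right[OF L])
    have 1: "target ` set r \<inter> insert u (target ` set l) = {}" "target ` set r \<inter> target ` set p = {}"
      using dist by auto
    have 2: "target ` set r \<inter> interior_vertices q = {}" using pvl iq by blast
    have 3: "path_vertices l \<subseteq> insert u (target ` set l)"
      using path_vertices_path[OF w(1)] by (cases "l = []") auto
    show "target ` set r \<inter> vertices (whisker l (single_cell p q) []) = {}"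
      unfolding vertices_whisker path_vertices_Nil
    proof (rule Int_emptyI)
      fix x assume x: "x \<in> target ` set r" "x \<in> path_vertices l \<union> vertices (single_cell p q) \<union> {}"
      then have "x \<in> insert u (target ` set l) \<or> x = w \<or> x \<in> target ` set p \<or> x \<in> interior_vertices q"
        using 3 vC by blast
      then show False using 1 2 x(1) w_in by (metis disjoint_iff)
    qed
    show "set r \<inter> edges (whisker l (single_cell p q) []) = {}"
      using dl subD assms(4) by (auto simp: whisker_def eC)
    show "is_path (terminal_vertex (whisker l (single_cell p q) [])) r v" using tL w by simp
  qed (use dist in auto)
  let ?A = "whisker [] (whisker l (single_cell p q) []) r"
  have vA: "vertices ?A = path_vertices (l @ p @ r) \<union> path_vertices q"
    by (auto simp: vertices_whisker vertices_single_cell path_vertices_append)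
  have "composable D ?A"
    unfolding composable_def
  proof (intro conjI)
    show b: "bottom_path D = top_path ?A" using assms(2) by (simp add: whisker_def single_cell_def)
    have t: "top_path ?A = l @ p @ r" by (simp add: whisker_def single_cell_def)
    show "vertices D \<inter> vertices ?A = path_vertices (top_path ?A)"
      unfolding vA t using qp pvD assms(5) by (auto simp: path_vertices_append)
    show "edges D \<inter> edges ?A = set (top_path ?A)"
      unfolding t using subD assms(4) by (auto simp: whisker_def eC)
  qed
  then have "is_diagram (compose_diagram D ?A)"
    using is_diagram.compose[OF assms(1) R] by blast
  moreover have "compose_diagram D ?A = attach_cell D l p q r"
    using subD by (auto simp: compose_diagram_def whisker_def single_cell_def attach_cell_def)
  ultimately show ?thesis by simp
qed

lemma is_diagram_iff_layered: "is_diagram D \<longleftrightarrow> layered D"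
proof
  show "layered D \<Longrightarrow> is_diagram D"
    by (induction rule: layered.induct) (auto intro: is_diagram_path is_diagram_attach)
qed (rule diagram_imp_layered)

section \<open>Isotopy\<close>

lemma map_diagram_simps [simp]:
  "edges (map_diagram g D) = g ` edges D"
  "cells (map_diagram g D) = (\<lambda>(p, q). (map g p, map g q)) ` cells D"
  "top_path (map_diagram g D) = map g (top_path D)"
  "bottom_path (map_diagram g D) = map g (bottom_path D)"
  by (simp_all add: map_diagram_def)

lemma respects_ends_subset: "respects_ends f g E \<Longrightarrow> E' \<subseteq> E \<Longrightarrow> respects_ends f g E'"
  by (auto simp: respects_ends_def)

lemma interior_vertices_map:
  "respects_ends f g (set p) \<Longrightarrow> interior_vertices (map g p) = f ` interior_vertices p"
  unfolding respects_ends_def interior_vertices_def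
  by (auto simp: map_butlast[symmetric] image_image dest: in_set_butlastD intro!: image_cong)

lemma vertices_map:
  "respects_ends f g (edges D) \<Longrightarrow> vertices (map_diagram g D) = f ` vertices D"
  by (auto simp: respects_ends_def vertices_def image_Un image_image)

lemma is_path_map:
  "respects_ends f g (set p) \<Longrightarrow> is_path u p v \<Longrightarrow> is_path (f u) (map g p) (f v)"
  by (induction p arbitrary: u) (auto simp: respects_ends_def)

lemma simple_path_map:
  assumes "respects_ends f g (set p)" "inj_on f (path_vertices p)" "simple_path u p v"
  shows "simple_path (f u) (map g p) (f v)"
proof -
  have "map target (map g p) = map f (map target p)"
    using assms(1) by (auto simp: respects_ends_def)
  moreover have "path_vertices p = set (u # map target p)"
    using assms(3) path_vertices_path[of u p v] by (simp add: simple_path_def)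
  ultimately have "distinct (f u # map target (map g p))"
    using assms(2,3) distinct_map[of f "u # map target p"]
    by (metis list.simps(9) simple_path_def)
  then show ?thesis using assms is_path_map by (auto simp: simple_path_def)
qed

lemma cell_shape_map:
  "respects_ends f g (set p \<union> set q) \<Longrightarrow> cell_shape p q \<Longrightarrow> cell_shape (map g p) (map g q)"
  unfolding cell_shape_def
  by (elim exE conjE disjE) (force simp: respects_ends_def triangle_def)+

lemma map_attach_cell: "map_diagram g (attach_cell D l p q r) =
  attach_cell (map_diagram g D) (map g l) (map g p) (map g q) (map g r)"
  by (auto simp: map_diagram_def attach_cell_def)

lemma map_path_diagram: "map_diagram g (path_diagram p) = path_diagram (map g p)"
  by (simp add: map_diagram_def path_diagram_def)

text \<open>
  Renaming vertices and edges injectively renames all steps of the construction.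
\<close>
lemma layered_map:
  assumes "layered D" "respects_ends f g (edges D)" "inj_on f (vertices D)" "inj_on g (edges D)"
  shows "layered (map_diagram g D)"
  using assms
proof (induction rule: layered.induct)
  case (base u p v)
  then show ?case unfolding map_path_diagram
    by (intro layered.base[of "f u" _ "f v"] simple_path_map) auto
next
  case (attach D l p r q)
  have sub: "set p \<subseteq> edges D"
    using layered_edges[OF attach.hyps(1)] attach.hyps(2) by auto
  have resp: "respects_ends f g (edges D)" "respects_ends f g (set q)" "respects_ends f g (set p \<union> set q)"
    using attach.prems(1) sub by (auto simp: respects_ends_def)
  show ?case unfolding map_attach_cell
  proof (rule layered.attach)
    show "layered (map_diagram g D)"
      by (rule attach.IH) (use attach.prems resp in \<open>auto intro: inj_on_subset\<close>)
    show "cell_shape (map g p) (map g q)" using cell_shape_map resp(3) attach.hyps(3) by blast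
    show "set (map g q) \<inter> edges (map_diagram g D) = {}"
      using attach.prems(3) attach.hyps(4) by (auto simp: inj_on_def)
    have "interior_vertices q \<subseteq> path_vertices q" by (rule interior_subset)
    then show "interior_vertices (map g q) \<inter> vertices (map_diagram g D) = {}"
      unfolding interior_vertices_map[OF resp(2)] vertices_map[OF resp(1)]
      using attach.prems(2) attach.hyps(5)
      by (subst inj_on_image_Int[symmetric, of f "vertices (attach_cell D l p q r)"]) auto
  qed (use attach.hyps(2) in simp)
qed

lemma isotopic_layered: "isotopic D D' \<Longrightarrow> layered D \<Longrightarrow> layered D'"
  unfolding isotopic_def using layered_map by blast

lemma isotopic_refl: "isotopic D D"
proof -
  have "D = map_diagram id D" by (cases D) (auto simp: map_diagram_def)
  then show ?thesis unfolding isotopic_def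
    by (intro exI[of _ id]) (auto simp: respects_ends_def)
qed

lemma isotopic_trans:
  assumes "isotopic D1 D2" "isotopic D2 D3" shows "isotopic D1 D3"
proof -
  obtain f g where 1: "respects_ends f g (edges D1)" "inj_on f (vertices D1)" "inj_on g (edges D1)"
    "D2 = map_diagram g D1" using assms(1) unfolding isotopic_def by blast
  obtain f' g' where 2: "respects_ends f' g' (edges D2)" "inj_on f' (vertices D2)" "inj_on g' (edges D2)"
    "D3 = map_diagram g' D2" using assms(2) unfolding isotopic_def by blast
  have v: "vertices D2 = f ` vertices D1" using vertices_map[OF 1(1)] 1(4) by simp
  have "respects_ends (f' \<circ> f) (g' \<circ> g) (edges D1)"
    using 1(1,4) 2(1) by (auto simp: respects_ends_def)
  moreover have "inj_on (f' \<circ> f) (vertices D1)" using 1(2) 2(2) v by (simp add: comp_inj_on)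
  moreover have "inj_on (g' \<circ> g) (edges D1)" using 1(3,4) 2(3) by (simp add: comp_inj_on)
  moreover have "D3 = map_diagram (g' \<circ> g) D1"
    using 1(4) 2(4) by (auto simp: map_diagram_def image_image case_prod_beta)
  ultimately show ?thesis unfolding isotopic_def by blast
qed

lemma map_diagram_id_on:
  assumes "layered D" "\<And>x. x \<in> edges D \<Longrightarrow> g x = x"
  shows "map_diagram g D = D"
proof -
  note E = layered_edges[OF assms(1)] and C = layered_cells(1)[OF assms(1)]
  have path: "map g p = p" if "set p \<subseteq> edges D" for p
    using that assms(2) by (intro map_idI) auto
  have "(\<lambda>(p, q). (map g p, map g q)) ` cells D = id ` cells D"
  proof (rule image_cong)
    fix c assume "c \<in> cells D"
    then show "(\<lambda>(p, q). (map g p, map g q)) c = id c"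
      using C[of "fst c" "snd c"] path[of "fst c"] path[of "snd c"] by (simp add: case_prod_beta)
  qed simp
  then show ?thesis using E assms(2) path by (cases D) (auto simp: map_diagram_def)
qed

lemma isotopic_sym:
  assumes "isotopic D D'" "layered D" shows "isotopic D' D"
proof -
  obtain f g where 1: "respects_ends f g (edges D)" "inj_on f (vertices D)" "inj_on g (edges D)"
    "D' = map_diagram g D" using assms(1) unfolding isotopic_def by blast
  define f' g' where "f' = inv_into (vertices D) f" and "g' = inv_into (edges D) g"
  have "map_diagram g' D' = map_diagram (g' \<circ> g) D"
    using 1(4) by (auto simp: map_diagram_def image_image case_prod_beta)
  also have "\<dots> = D" by (rule map_diagram_id_on[OF assms(2)]) (simp add: g'_def 1(3))
  finally have "D = map_diagram g' D'" by simp
  moreover have "respects_ends f' g' (edges D')"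
  proof -
    have "source x \<in> vertices D \<and> target x \<in> vertices D" if "x \<in> edges D" for x
      using that by (auto simp: vertices_def)
    then show ?thesis using 1 unfolding respects_ends_def f'_def g'_def by auto
  qed
  moreover have "inj_on f' (vertices D')"
    unfolding 1(4) vertices_map[OF 1(1)] f'_def by (rule inj_on_inv_into) simp
  moreover have "inj_on g' (edges D')" unfolding 1(4) g'_def by (auto intro: inj_on_inv_into)
  ultimately show ?thesis unfolding isotopic_def by blast
qed

lemma equiv_isotopy: "equiv {D. is_diagram D} isotopy"
  unfolding isotopy_def
proof (rule equivI)
  show "{(D, D'). is_diagram D \<and> is_diagram D' \<and> isotopic D D'} \<subseteq> {D. is_diagram D} \<times> {D. is_diagram D}" by auto
  show "refl_on {D. is_diagram D} {(D, D'). is_diagram D \<and> is_diagram D' \<and> isotopic D D'}"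
    by (auto simp: refl_on_def isotopic_refl)
  show "sym {(D, D'). is_diagram D \<and> is_diagram D' \<and> isotopic D D'}"
    by (auto simp: sym_def diagram_imp_layered intro: isotopic_sym)
  show "trans {(D, D'). is_diagram D \<and> is_diagram D' \<and> isotopic D D'}"
    by (auto simp: trans_def intro: isotopic_trans)
qed

section \<open>Eliminating dipoles\<close>

lemma append3_disjoint:
  assumes "l0 @ q0 @ r0 = l @ q @ r" "set q0 \<inter> set q = {}" "q0 \<noteq> []" "q \<noteq> []"
  shows "(\<exists>m. r0 = m @ q @ r \<and> l = l0 @ q0 @ m) \<or> (\<exists>m. l0 = l @ q @ m \<and> r = m @ q0 @ r0)"
proof -
  from assms(1) obtain us where "l0 = l @ us \<and> us @ q0 @ r0 = q @ r \<or> l0 @ us = l \<and> q0 @ r0 = us @ q @ r"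
    using iffD1[OF append_eq_append_conv2 assms(1)] by (elim exE) (rule that)
  then show ?thesis
  proof
    assume 1: "l0 = l @ us \<and> us @ q0 @ r0 = q @ r"
    then obtain vs where "us = q @ vs \<and> vs @ q0 @ r0 = r \<or> us @ vs = q \<and> q0 @ r0 = vs @ r"
      using iffD1[OF append_eq_append_conv2 conjunct2[OF 1]] by (elim exE) (rule that)
    then show ?thesis
    proof
      assume "us = q @ vs \<and> vs @ q0 @ r0 = r" then show ?thesis using 1 by auto
    next
      assume 2: "us @ vs = q \<and> q0 @ r0 = vs @ r"
      have "vs = []"
      proof (rule ccontr)
        assume "vs \<noteq> []"
        then have "hd vs = hd q0" using 2 assms(3) by (metis hd_append2)
        moreover have "hd vs \<in> set q" using 2 \<open>vs \<noteq> []\<close> by auto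
        ultimately show False using assms(2,3) by (metis disjoint_iff hd_in_set)
      qed
      then show ?thesis using 1 2 by auto
    qed
  next
    assume 1: "l0 @ us = l \<and> q0 @ r0 = us @ q @ r"
    then obtain vs where "q0 = us @ vs \<and> vs @ r0 = q @ r \<or> q0 @ vs = us \<and> r0 = vs @ q @ r"
      using iffD1[OF append_eq_append_conv2 conjunct2[OF 1]] by (elim exE) (rule that)
    then show ?thesis
    proof
      assume 2: "q0 = us @ vs \<and> vs @ r0 = q @ r"
      have "vs = []"
      proof (rule ccontr)
        assume "vs \<noteq> []"
        then have "hd vs = hd q" using 2 assms(4) by (metis hd_append2)
        moreover have "hd vs \<in> set q0" using 2 \<open>vs \<noteq> []\<close> by auto
        ultimately show False using assms(2,4) by (metis disjoint_iff hd_in_set)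
      qed
      then show ?thesis using 1 2 by auto
    next
      assume "q0 @ vs = us \<and> r0 = vs @ q @ r" then show ?thesis using 1 by auto
    qed
  qed
qed

lemma distinct_append3_unique:
  assumes "l0 @ q @ r0 = l @ q @ r" "distinct (l @ q @ r)" "q \<noteq> []"
  shows "l0 = l \<and> r0 = r"
proof -
  obtain x q' where q: "q = x # q'" using assms(3) by (cases q) auto
  have "x \<notin> set l" "x \<notin> set (q' @ r)" using assms(2) q by auto
  moreover have "l @ x # (q' @ r) = l0 @ x # (q' @ r0)" using assms(1) q by simp
  ultimately have "l = l0 \<and> q' @ r = q' @ r0" using append_Cons_eq_iff by metis
  then show ?thesis by simp
qed

text \<open>
  A cell whose lower boundary still lies on the bottom path can be attached last: the cells
  attached after it do not touch this path, so they do not depend on it.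
\<close>
lemma layered_detach_cell:
  assumes "layered E" "(p, q) \<in> cells E" "bottom_path E = l @ q @ r"
  shows "\<exists>E'. layered E' \<and> bottom_path E' = l @ p @ r \<and> set q \<inter> edges E' = {} \<and>
           interior_vertices q \<inter> vertices E' = {} \<and> E = attach_cell E' l p q r"
  using assms
proof (induction arbitrary: l r rule: layered.induct)
  case (base u p' v)
  then show ?case by simp
next
  case (attach E0 l0 p0 r0 q0)
  let ?E = "attach_cell E0 l0 p0 q0 r0"
  have SE: "layered ?E" using attach.hyps by (intro layered.attach) auto
  have bot: "l0 @ q0 @ r0 = l @ q @ r" using attach.prems by simp
  have dist: "distinct (l @ q @ r)" using layered_distinct[OF SE] unfolding attach.prems(2) by blast
  have ne: "q \<noteq> []" "q0 \<noteq> []"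
    using layered_cells(1)[OF SE attach.prems(1)] attach.hyps(3) cell_shape_nonempty by auto
  show ?case
  proof (cases "(p, q) = (p0, q0)")
    case True
    then have "l0 = l \<and> r0 = r" using distinct_append3_unique[OF _ dist ne(1)] bot by auto
    then show ?thesis using True attach.hyps by (intro exI[of _ E0]) auto
  next
    case False
    then have pq: "(p, q) \<in> cells E0" using attach.prems by auto
    have disj: "set q0 \<inter> set q = {}"
      using layered_cells_disjoint[OF SE attach.prems(1), of p0 q0] False by auto
    have iq: "interior_vertices q \<subseteq> vertices E0"
      using interior_subset[of q] path_vertices_subset[of q E0] layered_cells(1)[OF attach.hyps(1) pq] by auto
    have pv0: "path_vertices q0 \<subseteq> path_vertices p0 \<union> interior_vertices q0"
      using path_vertices_replace attach.hyps(3) by blast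
    from append3_disjoint[OF bot disj ne(2,1)]
    consider m where "r0 = m @ q @ r" "l = l0 @ q0 @ m" | m where "l0 = l @ q @ m" "r = m @ q0 @ r0"
      by blast
    then show ?thesis
    proof cases
      case 1
      have "bottom_path E0 = (l0 @ p0 @ m) @ q @ r" using attach.hyps(2) 1 by simp
      from attach.IH[OF pq this] obtain E1 where E1: "layered E1"
        "bottom_path E1 = (l0 @ p0 @ m) @ p @ r" "set q \<inter> edges E1 = {}"
        "interior_vertices q \<inter> vertices E1 = {}" "E0 = attach_cell E1 (l0 @ p0 @ m) p q r" by blast
      have p0: "path_vertices p0 \<subseteq> vertices E1"
        using layered_edges[OF E1(1)] E1(2) path_vertices_subset[of p0 E1] by auto
      let ?E' = "attach_cell E1 l0 p0 q0 (m @ p @ r)"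
      have "layered ?E'"
        by (rule layered.attach) (use E1 attach.hyps in auto)
      moreover have "interior_vertices q \<inter> vertices ?E' = {}"
        using E1(4) p0 pv0 iq attach.hyps(5) by auto blast
      moreover have "?E = attach_cell ?E' l p q r"
        using E1(5) 1 by (auto simp: attach_cell_def)
      ultimately show ?thesis using E1 1 disj by (intro exI[of _ ?E']) auto
    next
      case 2
      have "bottom_path E0 = l @ q @ (m @ p0 @ r0)" using attach.hyps(2) 2 by simp
      from attach.IH[OF pq this] obtain E1 where E1: "layered E1"
        "bottom_path E1 = l @ p @ (m @ p0 @ r0)" "set q \<inter> edges E1 = {}"
        "interior_vertices q \<inter> vertices E1 = {}" "E0 = attach_cell E1 l p q (m @ p0 @ r0)" by blast
      have p0: "path_vertices p0 \<subseteq> vertices E1"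
        using layered_edges[OF E1(1)] E1(2) path_vertices_subset[of p0 E1] by auto
      let ?E' = "attach_cell E1 (l @ p @ m) p0 q0 r0"
      have "layered ?E'"
        by (rule layered.attach) (use E1 attach.hyps in auto)
      moreover have "interior_vertices q \<inter> vertices ?E' = {}"
        using E1(4) p0 pv0 iq attach.hyps(5) by auto blast
      moreover have "?E = attach_cell ?E' l p q r"
        using E1(5) 2 by (auto simp: attach_cell_def)
      ultimately show ?thesis using E1 2 disj by (intro exI[of _ ?E']) auto
    qed
  qed
qed

lemma not_subset_if_disjoint: "set q \<inter> A = {} \<Longrightarrow> q \<noteq> [] \<Longrightarrow> \<not> set q \<subseteq> A"
  by (cases q) auto

lemma interior_at_most_one:
  "cell_shape p q \<Longrightarrow> interior_vertices q = {} \<or> (\<exists>w. interior_vertices q = {w})"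
  by (auto simp: cell_shape_def interior_vertices_def)

text \<open>
  Eliminating a dipole commutes with attaching a cell. The new cell gets a fresh name in the smaller
  diagram, because its old name may now denote something else.
\<close>
lemma eliminate_attach:
  assumes E: "layered E" and E': "layered E'" and elim: "eliminates_dipole E E'"
    and bot: "bottom_path E = l @ p @ r" and shape: "cell_shape p q"
    and fresh: "set q \<inter> edges E = {}" "interior_vertices q \<inter> vertices E = {}"
  shows "\<exists>D'. layered D' \<and> eliminates_dipole (attach_cell E l p q r) D'"
proof -
  obtain p0 q0 r0 f g where dip: "dipole E p0 q0 r0"
    and resp: "respects_ends f g (edges E - set q0)" and ident: "map g p0 = map g r0"
    and injf: "inj_on f (vertices E - interior_vertices q0 - interior_vertices r0)"
    and injg: "inj_on g (edges E - set q0 - set r0)"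
    and E'_eq: "E' = map_diagram g (remove_dipole_cells E p0 q0 r0)"
    using elim unfolding eliminates_dipole_def by blast
  have c: "(p0, q0) \<in> cells E" "(q0, r0) \<in> cells E" using dip by (auto simp: dipole_def)
  note C = layered_cells(1)[OF E]
  have q0_bot: "set q0 \<inter> set (l @ p @ r) = {}" using C[OF c(2)] bot by auto
  have neq: "(p0, q0) \<noteq> (q0, r0)" using C[OF c(1)] by (auto simp: cell_shape_def)
  have p0q0: "set p0 \<inter> set q0 = {}" using layered_cells_disjoint[OF E c neq] by simp
  have sub: "set (l @ p @ r) \<subseteq> edges E" using layered_edges[OF E] bot by simp
  obtain N where N: "\<And>v. v \<in> vertices E' \<Longrightarrow> v < N"
  proof -
    have "finite (vertices E')" using layered_edges[OF E'] by (simp add: vertices_def)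
    then show ?thesis using that finite_nat_set_iff_bounded by auto
  qed
  obtain K where K: "\<And>x. x \<in> edges E' \<Longrightarrow> label x < K"
  proof -
    have "finite (label ` edges E')" using layered_edges[OF E'] by simp
    then show ?thesis using that finite_nat_set_iff_bounded by auto
  qed
  \<comment> \<open>One fresh vertex \<open>N\<close> is enough, as a cell has at most one new inner vertex; new edges are
    recognised by the label \<open>K\<close>.\<close>
  define f' where "f' = (\<lambda>v. if v \<in> vertices E then f v else N)"
  define g' where "g' = (\<lambda>x. if x \<in> edges E then g x else Edge (f' (source x)) K (f' (target x)))"
  have edges': "edges E' = g ` (edges E - set q0)"
    by (simp add: E'_eq remove_dipole_cells_def)
  have bot': "bottom_path E' = map g l @ map g p @ map g r"
    by (simp add: E'_eq remove_dipole_cells_def bot)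
  have g'_old: "g' x = g x" if "x \<in> edges E" for x using that by (simp add: g'_def)
  have map_old: "map g' x = map g x" if "set x \<subseteq> edges E" for x
    using that g'_old by auto
  have endE: "source x \<in> vertices E" "target x \<in> vertices E" if "x \<in> edges E" for x
    using that by (auto simp: vertices_def)
  have resp_old: "source (g' x) = f' (source x) \<and> target (g' x) = f' (target x)"
    if "x \<in> edges E - set q0" for x
    using that resp endE by (auto simp: g'_def f'_def respects_ends_def)
  have resp_new: "source (g' x) = f' (source x) \<and> target (g' x) = f' (target x)"
    if "x \<in> set q" for x
    using that fresh(1) by (auto simp: g'_def)
  have resp': "respects_ends f' g' (edges (attach_cell E l p q r) - set q0)"
    using resp_old resp_new unfolding respects_ends_def by auto
  have fresh0: "set q \<inter> set q0 = {}" "set q \<inter> set r0 = {}" using fresh(1) C[OF c(1)] C[OF c(2)] by auto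
  \<comment> \<open>A vertex outside the middle of the dipole is still an end of a surviving edge: the outer ends of
    the removed path \<open>q0\<close> also lie on \<open>p0\<close>.\<close>
  have below: "f' v < N" if v: "v \<in> vertices E - interior_vertices q0" for v
  proof -
    obtain x where x: "x \<in> edges E" "v = source x \<or> v = target x"
      using v by (auto simp: vertices_def)
    obtain y where y: "y \<in> edges E - set q0" "v = source y \<or> v = target y"
    proof (cases "x \<in> set q0")
      case True
      then have "v \<in> path_vertices q0" using x by (auto simp: path_vertices_def)
      then have "v \<in> path_vertices p0"
        using path_vertices_replace C[OF c(1)] v by blast
      then show ?thesis using that p0q0 C[OF c(1)] by (auto simp: path_vertices_def)
    next
      case False
      then show ?thesis using that x by blast
    qed
    then have "f' v \<in> vertices E'"
    proof -
      have "g' y \<in> edges E'" using y(1) g'_old[of y] edges' by auto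
      then have "source (g' y) \<in> vertices E'" "target (g' y) \<in> vertices E'"
        by (auto simp: vertices_def)
      then show ?thesis using resp_old[OF y(1)] y(2) by metis
    qed
    then show ?thesis by (rule N)
  qed
  have resp_pq: "respects_ends f' g' (set p \<union> set q)"
  proof -
    have "x \<in> edges E - set q0" if "x \<in> set p" for x using that sub q0_bot by auto
    then show ?thesis using resp_old resp_new unfolding respects_ends_def by blast
  qed
  let ?D' = "attach_cell E' (map g l) (map g p) (map g' q) (map g r)"
  have D': "layered ?D'"
  proof (rule layered.attach[OF E' bot'])
    show "cell_shape (map g p) (map g' q)"
    proof -
      have "map g' p = map g p" using sub by (intro map_old) simp
      then show ?thesis using cell_shape_map[OF resp_pq shape] by metis
    qed
    show "set (map g' q) \<inter> edges E' = {}"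
    proof (rule Int_emptyI)
      fix y assume "y \<in> set (map g' q)" "y \<in> edges E'"
      then have "label y = K" using fresh(1) by (auto simp: g'_def)
      then show False using K[OF \<open>y \<in> edges E'\<close>] by simp
    qed
    have "respects_ends f' g' (set q)" using resp_pq respects_ends_subset by blast
    then have "interior_vertices (map g' q) \<subseteq> {N}"
      using fresh(2) by (auto simp: interior_vertices_map f'_def)
    then show "interior_vertices (map g' q) \<inter> vertices E' = {}" using N by auto
  qed
  have int_q: "v = w" if "v \<in> interior_vertices q" "w \<in> interior_vertices q" for v w
    using interior_at_most_one[OF shape] that by auto
  have pvq: "path_vertices q \<subseteq> vertices E \<union> interior_vertices q"
    using path_vertices_replace[OF shape] path_vertices_subset[of p E] sub by auto
  have injf': "inj_on f' (vertices (attach_cell E l p q r) - interior_vertices q0 - interior_vertices r0)"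
  proof (rule inj_onI)
    fix v w
    assume v: "v \<in> vertices (attach_cell E l p q r) - interior_vertices q0 - interior_vertices r0"
      and w: "w \<in> vertices (attach_cell E l p q r) - interior_vertices q0 - interior_vertices r0"
      and eq: "f' v = f' w"
    have v': "v \<in> vertices E - interior_vertices q0 - interior_vertices r0 \<or> v \<in> interior_vertices q \<and> v \<notin> vertices E"
      using v pvq fresh(2) by auto
    have w': "w \<in> vertices E - interior_vertices q0 - interior_vertices r0 \<or> w \<in> interior_vertices q \<and> w \<notin> vertices E"
      using w pvq fresh(2) by auto
    show "v = w"
    proof (cases "v \<in> vertices E")
      case True
      then have "f' v < N" using v' below by auto
      then have "w \<in> vertices E" using eq by (auto simp: f'_def split: if_splits)
      then show ?thesis using True v' w' injf eq by (auto simp: inj_on_def f'_def)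
    next
      case False
      then have "w \<notin> vertices E" using eq below[of w] w' by (auto simp: f'_def split: if_splits)
      then show ?thesis using False v' w' int_q by auto
    qed
  qed
  \<comment> \<open>If the new path has two edges, they differ in their source: one starts at an old
    vertex, the other one at \<open>N\<close>.\<close>
  have q_cases: "x = y" if xy: "x \<in> set q" "y \<in> set q" and "g' x = g' y" for x y
  proof (rule ccontr)
    assume "x \<noteq> y"
    then obtain e a b where q: "p = [e]" "q = [a, b]" "triangle e a b"
      using shape xy by (auto simp: cell_shape_def)
    have "f' (source a) < N"
    proof -
      have "e \<in> edges E - set q0" using sub q0_bot q by auto
      then have "source (g e) = f' (source e)" "g e \<in> edges E'"
        using resp_old[of e] g'_old[of e] edges' by auto
      then have "f' (source e) \<in> vertices E'" unfolding vertices_def by (metis UnI1 image_eqI)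
      then show ?thesis using N q(3) by (auto simp: triangle_def)
    qed
    moreover have "f' (source b) = N"
      using fresh(2) q by (auto simp: f'_def interior_vertices_def triangle_def)
    ultimately have "g' a \<noteq> g' b" using resp_new[of a] resp_new[of b] q(2) by auto
    then show False using xy \<open>x \<noteq> y\<close> \<open>g' x = g' y\<close> q(2) by auto
  qed
  have injg': "inj_on g' (edges (attach_cell E l p q r) - set q0 - set r0)"
  proof (rule inj_onI)
    fix x y
    assume x: "x \<in> edges (attach_cell E l p q r) - set q0 - set r0"
      and y: "y \<in> edges (attach_cell E l p q r) - set q0 - set r0" and eq: "g' x = g' y"
    have lab: "label (g' z) < K" if "z \<in> edges E" "z \<notin> set q0" for z
      using that K[of "g z"] edges' g'_old[of z] by auto
    have lab': "label (g' z) = K" if "z \<notin> edges E" for z using that by (simp add: g'_def)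
    show "x = y"
    proof (cases "x \<in> edges E")
      case True
      then have "y \<in> edges E" using lab[of x] lab'[of y] x eq by (metis Diff_iff less_irrefl)
      then show ?thesis using True x y eq injg g'_old by (auto simp: inj_on_def)
    next
      case False
      then have "y \<notin> edges E" using lab[of y] lab'[of x] y eq by (metis Diff_iff less_irrefl)
      then show ?thesis using False x y eq q_cases by auto
    qed
  qed
  have cells_old: "(\<lambda>(x, y). (map g' x, map g' y)) ` (cells E - {(p0, q0), (q0, r0)})
      = (\<lambda>(x, y). (map g x, map g y)) ` (cells E - {(p0, q0), (q0, r0)})"
  proof (rule image_cong[OF refl])
    fix c assume "c \<in> cells E - {(p0, q0), (q0, r0)}"
    then show "(\<lambda>(x, y). (map g' x, map g' y)) c = (\<lambda>(x, y). (map g x, map g y)) c"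
      using C[of "fst c" "snd c"] map_old[of "fst c"] map_old[of "snd c"] by (auto simp: case_prod_beta)
  qed
  have pq_new: "(p, q) \<noteq> (p0, q0)" "(p, q) \<noteq> (q0, r0)"
    using not_subset_if_disjoint[OF fresh(1)] C[OF c(1)] C[OF c(2)] cell_shape_nonempty[OF shape] by auto
  have ins: "insert (p, q) (cells E) - {(p0, q0), (q0, r0)} = insert (p, q) (cells E - {(p0, q0), (q0, r0)})"
    using pq_new by auto
  have mp: "map g' p = map g p" and ml: "map g' l = map g l" and mr: "map g' r = map g r"
    and mt: "map g' (top_path E) = map g (top_path E)"
    using sub layered_edges[OF E] by (intro map_old; simp)+
  have "?D' = map_diagram g' (remove_dipole_cells (attach_cell E l p q r) p0 q0 r0)"
  proof (rule diagram.equality)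
    have 1: "edges E \<union> set q - set q0 = (edges E - set q0) \<union> set q" using fresh0 by auto
    have 2: "g' ` (edges E - set q0) = g ` (edges E - set q0)"
      by (rule image_cong) (simp_all add: g'_old)
    show "edges ?D' = edges (map_diagram g' (remove_dipole_cells (attach_cell E l p q r) p0 q0 r0))"
      by (simp add: edges' remove_dipole_cells_def 1 image_Un 2)
    show "cells ?D' = cells (map_diagram g' (remove_dipole_cells (attach_cell E l p q r) p0 q0 r0))"
      by (simp add: remove_dipole_cells_def ins cells_old mp E'_eq)
    show "top_path ?D' = top_path (map_diagram g' (remove_dipole_cells (attach_cell E l p q r) p0 q0 r0))"
      by (simp add: remove_dipole_cells_def mt E'_eq)
    show "bottom_path ?D' = bottom_path (map_diagram g' (remove_dipole_cells (attach_cell E l p q r) p0 q0 r0))"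
      by (simp add: remove_dipole_cells_def ml mr)
  qed simp
  moreover have "dipole (attach_cell E l p q r) p0 q0 r0" using dip by (simp add: dipole_def)
  moreover have "map g' p0 = map g' r0"
    using ident map_old[of p0] map_old[of r0] C[OF c(1)] C[OF c(2)] by metis
  ultimately have "eliminates_dipole (attach_cell E l p q r) ?D'"
    unfolding eliminates_dipole_def using resp' injf' injg' by blast
  then show ?thesis using D' by blast
qed

text \<open>
  If the last two cells form a dipole, eliminating it leads back to the diagram before these two
  cells: the new bottom path \<open>s\<close> is folded onto \<open>p\<close>.
\<close>
lemma eliminate_new_dipole:
  assumes E: "layered E" and bot: "bottom_path E = l @ p @ r"
    and pq: "cell_shape p q" "set q \<inter> edges E = {}" "interior_vertices q \<inter> vertices E = {}"
    and qs: "cell_shape q s" "set s \<inter> (edges E \<union> set q) = {}"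
      "interior_vertices s \<inter> (vertices E \<union> path_vertices q) = {}"
  shows "eliminates_dipole (attach_cell (attach_cell E l p q r) l q s r) E"
proof -
  let ?D = "attach_cell (attach_cell E l p q r) l q s r"
  have sub: "set (l @ p @ r) \<subseteq> edges E" using layered_edges[OF E] bot by simp
  have dist: "distinct (l @ p @ r)" using layered_distinct[OF E] bot by simp
  have pE: "path_vertices p \<subseteq> vertices E" using path_vertices_subset[of p E] sub by auto
  have "\<exists>f g. respects_ends f g (set s) \<and> map g s = p \<and> (\<forall>x. x \<notin> set s \<longrightarrow> g x = x) \<and>
    (\<forall>v. v \<notin> interior_vertices s \<longrightarrow> f v = v)"
  proof -
    from pq(1) qs(1) consider e a b e' where "p = [e]" "q = [a, b]" "s = [e']" "triangle e a b" "triangle e' a b"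
      | a b e a' b' where "p = [a, b]" "q = [e]" "s = [a', b']" "triangle e a b" "triangle e a' b'"
      by (auto simp: cell_shape_def)
    then show ?thesis
    proof cases
      case 1
      then show ?thesis
        by (intro exI[of _ id] exI[of _ "id(e' := e)"]) (auto simp: respects_ends_def triangle_def)
    next
      case 2
      have "a' \<noteq> b'"
        using 2 qs(3) by (auto simp: triangle_def interior_vertices_def path_vertices_def)
      moreover have "target a' \<noteq> source e" "target a' \<noteq> target e"
        using 2 qs(3) by (auto simp: interior_vertices_def path_vertices_def)
      ultimately show ?thesis using 2
        by (intro exI[of _ "id(target a' := target a)"] exI[of _ "id(a' := a, b' := b)"])
          (auto simp: respects_ends_def triangle_def interior_vertices_def)
    qed
  qed
  then obtain f g where fg: "respects_ends f g (set s)" "map g s = p" "\<And>x. x \<notin> set s \<Longrightarrow> g x = x"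
    "\<And>v. v \<notin> interior_vertices s \<Longrightarrow> f v = v" by blast
  have gE: "g x = x" if "x \<in> edges E" for x using that qs(2) fg(3) by auto
  have fE: "f v = v" if "v \<in> vertices E" for v using that qs(3) fg(4) by auto
  have mapE: "map g x = x" if "set x \<subseteq> edges E" for x using that gE by (intro map_idI) auto
  have edgesD: "edges ?D - set q = edges E \<union> set s" using pq(2) qs(2) by auto
  have pqE: "(p, q) \<notin> cells E" "(q, s) \<notin> cells E"
    using layered_cells(1)[OF E] not_subset_if_disjoint[OF pq(2)] cell_shape_nonempty[OF pq(1)] by blast+
  have cellsD: "cells ?D - {(p, q), (q, s)} = cells E" using pqE by auto
  have rem: "remove_dipole_cells ?D p q s
      = \<lparr>edges = edges E \<union> set s, cells = cells E, top_path = top_path E, bottom_path = l @ s @ r\<rparr>"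
    unfolding remove_dipole_cells_def edgesD cellsD by simp
  have "g ` set s = set p" using fg(2) by (metis set_map)
  then have "edges E = g ` edges E \<union> g ` set s"
    using gE sub by auto
  moreover have "(\<lambda>(x, y). (map g x, map g y)) ` cells E = cells E"
    using map_diagram_id_on[OF E gE] by (metis map_diagram_simps(2))
  ultimately have "E = map_diagram g (remove_dipole_cells ?D p q s)"
    unfolding rem using bot fg(2) mapE[of l] mapE[of r] mapE[of "top_path E"] sub layered_edges[OF E]
    by (cases E) (auto simp: map_diagram_def)
  moreover have "dipole ?D p q s" by (simp add: dipole_def)
  moreover have "respects_ends f g (edges ?D - set q)"
    unfolding edgesD using fg(1) gE fE unfolding respects_ends_def vertices_def by auto
  moreover have "map g p = map g s" using fg(2) mapE[of p] sub by simp
  moreover have "inj_on f (vertices ?D - interior_vertices q - interior_vertices s)"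
    using fg(4) by (auto simp: inj_on_def)
  moreover have "inj_on g (edges ?D - set q - set s)" using fg(3) by (auto simp: inj_on_def)
  ultimately show ?thesis unfolding eliminates_dipole_def by blast
qed

text \<open>
  If the last cell is the lower half of a dipole, its upper half can be attached immediately before
  it, and the previous lemma applies. Otherwise the dipole is already there without the last cell.
\<close>
lemma not_reduced_eliminates:
  assumes "layered D" "\<not> reduced D"
  shows "\<exists>D'. layered D' \<and> eliminates_dipole D D'"
  using assms
proof (induction rule: layered.induct)
  case (base u p v)
  then show ?case by (simp add: reduced_def dipole_def)
next
  case (attach E l p r q)
  show ?case
  proof (cases "reduced E")
    case False
    then show ?thesis using attach eliminate_attach by blast
  next
    case True
    obtain p1 q1 r1 where c: "(p1, q1) \<in> insert (p, q) (cells E)" "(q1, r1) \<in> insert (p, q) (cells E)"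
      using attach.prems by (auto simp: reduced_def dipole_def)
    note C = layered_cells(1)[OF attach.hyps(1)]
    have ne: "p \<noteq> []" "q \<noteq> []" using cell_shape_nonempty attach.hyps(3) by auto
    have "\<not> ((p1, q1) \<in> cells E \<and> (q1, r1) \<in> cells E)"
      using True by (auto simp: reduced_def dipole_def)
    moreover have "(p1, q1) \<noteq> (p, q)"
    proof
      assume *: "(p1, q1) = (p, q)"
      have "p \<noteq> q" using attach.hyps(3) by (auto simp: cell_shape_def)
      then have "(q, r1) \<in> cells E" using c(2) * by auto
      then have "set q \<subseteq> edges E" using C[of q r1] by simp
      then have "set q \<inter> edges E = set q" by (rule Int_absorb2)
      then show False using ne attach.hyps(4) by simp
    qed
    ultimately have "(p1, q1) \<in> cells E" "(q1, r1) = (p, q)" using c by blast+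
    then have 1: "(p1, p) \<in> cells E" by simp
    from layered_detach_cell[OF attach.hyps(1) 1 attach.hyps(2)] obtain E' where E': "layered E'"
      "bottom_path E' = l @ p1 @ r" "set p \<inter> edges E' = {}"
      "interior_vertices p \<inter> vertices E' = {}" "E = attach_cell E' l p1 p r" by blast
    have "eliminates_dipole (attach_cell (attach_cell E' l p1 p r) l p q r) E'"
    proof (rule eliminate_new_dipole[OF E'(1,2) _ E'(3,4) attach.hyps(3)])
      show "cell_shape p1 p" using C[OF 1] by simp
      show "set q \<inter> (edges E' \<union> set p) = {}" using attach.hyps(4) by (simp add: E'(5))
      show "interior_vertices q \<inter> (vertices E' \<union> path_vertices p) = {}"
        using attach.hyps(5) by (simp add: E'(5))
    qed
    then show ?thesis using E' by blast
  qed
qed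

lemma eliminates_dipole_card:
  assumes "layered D" "eliminates_dipole D D'"
  shows "card (cells D') < card (cells D)"
proof -
  obtain p q r g where *: "dipole D p q r" "D' = map_diagram g (remove_dipole_cells D p q r)"
    using assms(2) unfolding eliminates_dipole_def by blast
  have fin: "finite (cells D)" using layered_cells(2)[OF assms(1)] .
  have "card (cells D') \<le> card (cells D - {(p, q), (q, r)})"
    unfolding *(2) using fin by (auto simp: remove_dipole_cells_def intro: card_image_le)
  also have "\<dots> < card (cells D)"
    using *(1) fin by (intro psubset_card_mono) (auto simp: dipole_def)
  finally show ?thesis .
qed

lemma eliminates_dipole_length:
  "eliminates_dipole D D' \<Longrightarrow> length (top_path D') = length (top_path D) \<and>
     length (bottom_path D') = length (bottom_path D)"
  unfolding eliminates_dipole_def remove_dipole_cells_def by auto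

lemma dipole_equivalent_refl: "dipole_equivalent D D"
  by (simp add: dipole_equivalent_def)

lemma reduces_to:
  assumes "is_diagram D"
  shows "\<exists>D'. is_diagram D' \<and> reduced D' \<and> dipole_equivalent D D' \<and>
    length (top_path D') = length (top_path D) \<and> length (bottom_path D') = length (bottom_path D)"
  using assms
proof (induction "card (cells D)" arbitrary: D rule: less_induct)
  case less
  show ?case
  proof (cases "reduced D")
    case True
    then show ?thesis using less.prems dipole_equivalent_refl by blast
  next
    case False
    then obtain E where E: "is_diagram E" "eliminates_dipole D E"
      using not_reduced_eliminates less.prems is_diagram_iff_layered by blast
    then obtain D' where D': "is_diagram D'" "reduced D'" "dipole_equivalent E D'"
      "length (top_path D') = length (top_path E)" "length (bottom_path D') = length (bottom_path E)"
      using less.hyps[of E] eliminates_dipole_card less.prems is_diagram_iff_layered by blast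
    have "dipole_equivalent D E"
      unfolding dipole_equivalent_def by (rule r_into_equivclp) (use E less.prems in blast)
    then have "dipole_equivalent D D'"
      using D'(3) unfolding dipole_equivalent_def by (rule equivclp_trans)
    then show ?thesis using D' eliminates_dipole_length[OF E(2)] by auto
  qed
qed

section \<open>Developing maps\<close>

lemma layered_cell_distinct: "layered D \<Longrightarrow> (p, q) \<in> cells D \<Longrightarrow> distinct p \<and> distinct q"
proof (induction rule: layered.induct)
  case (attach D l p' r q')
  have "distinct (l @ p' @ r)" using layered_distinct[OF attach.hyps(1)] attach.hyps(2) by metis
  moreover have "distinct (l @ q' @ r)" using layered_distinct[OF layered.attach[OF attach.hyps]] by simp
  ultimately show ?case using attach by auto
qed simp

text \<open>
  Functions on finite words stand for functions on infinite words that end in zeros only: the words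
  \<open>w\<close> and \<open>w0\<close> are initial parts of the same infinite word. In this sense a function is the same
  as the pair of its restrictions to words starting with 0 and with 1.
\<close>
definition zero_tail_invariant :: "(bool list \<Rightarrow> 'v) \<Rightarrow> bool" where
  "zero_tail_invariant c \<longleftrightarrow> (\<forall>w. c (w @ [False]) = c w)"

definition splits_into :: "(bool list \<Rightarrow> 'v) \<Rightarrow> (bool list \<Rightarrow> 'v) \<Rightarrow> (bool list \<Rightarrow> 'v) \<Rightarrow> bool" where
  "splits_into c a b \<longleftrightarrow> (\<forall>w. c (False # w) = a w \<and> c (True # w) = b w)"

definition develops :: "diagram \<Rightarrow> (edge \<Rightarrow> bool list \<Rightarrow> 'v) \<Rightarrow> bool" where
  "develops D L \<longleftrightarrow> (\<forall>x\<in>edges D. zero_tail_invariant (L x)) \<and>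
     (\<forall>e a b. ([e], [a, b]) \<in> cells D \<or> ([a, b], [e]) \<in> cells D \<longrightarrow> splits_into (L e) (L a) (L b))"

text \<open>
  The value at the empty word is the value at \<open>0\<close>, as zero tail invariance requires.
\<close>
definition join :: "(bool list \<Rightarrow> 'v) \<Rightarrow> (bool list \<Rightarrow> 'v) \<Rightarrow> bool list \<Rightarrow> 'v" where
  "join a b w = (case w of [] \<Rightarrow> a [] | x # w' \<Rightarrow> if x then b w' else a w')"

lemma splits_into_join: "splits_into (join a b) a b"
  by (simp add: splits_into_def join_def)

lemma zero_tail_join:
  "zero_tail_invariant a \<Longrightarrow> zero_tail_invariant b \<Longrightarrow> zero_tail_invariant (join a b)"
  unfolding zero_tail_invariant_def
proof
  fix w assume "\<forall>w. a (w @ [False]) = a w" "\<forall>w. b (w @ [False]) = b w"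
  then show "join a b (w @ [False]) = join a b w" by (cases w) (auto simp: join_def)
qed

lemma splits_into_parts: "splits_into c (\<lambda>w. c (False # w)) (\<lambda>w. c (True # w))"
  by (simp add: splits_into_def)

lemma zero_tail_parts:
  "zero_tail_invariant c \<Longrightarrow> zero_tail_invariant (\<lambda>w. c (x # w))"
  unfolding zero_tail_invariant_def by (metis append_Cons)

lemma splits_into_unique1:
  "splits_into c a b \<Longrightarrow> splits_into c a' b' \<Longrightarrow> a = a' \<and> b = b'"
  unfolding splits_into_def by (metis ext)

lemma splits_into_unique2:
  assumes "splits_into c a b" "splits_into c' a b" "zero_tail_invariant c" "zero_tail_invariant c'"
  shows "c = c'"
proof
  fix w
  have nil: "d [] = a []" if "splits_into d a b" "zero_tail_invariant d" for d
    using that unfolding splits_into_def zero_tail_invariant_def by (metis append_Nil)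
  show "c w = c' w"
  proof (cases w)
    case Nil then show ?thesis using nil assms by metis
  next
    case (Cons x v) then show ?thesis using assms unfolding splits_into_def by (cases x) auto
  qed
qed

lemma develops_cong:
  assumes "layered D" "\<And>x. x \<in> edges D \<Longrightarrow> L x = L' x" "develops D L'"
  shows "develops D L"
proof -
  note C = layered_cells(1)[OF assms(1)]
  show ?thesis unfolding develops_def
  proof (intro conjI ballI allI impI)
    fix x assume "x \<in> edges D"
    then show "zero_tail_invariant (L x)" using assms unfolding develops_def by simp
  next
    fix e a b assume *: "([e], [a, b]) \<in> cells D \<or> ([a, b], [e]) \<in> cells D"
    then have "e \<in> edges D" "a \<in> edges D" "b \<in> edges D" using C by fastforce+
    then show "splits_into (L e) (L a) (L b)" using * assms unfolding develops_def by metis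
  qed
qed

lemma develops_attach:
  "develops (attach_cell D l p q r) L \<longleftrightarrow> develops D L \<and> (\<forall>x\<in>set q. zero_tail_invariant (L x)) \<and>
    (\<forall>e a b. p = [e] \<and> q = [a, b] \<or> p = [a, b] \<and> q = [e] \<longrightarrow> splits_into (L e) (L a) (L b))"
  unfolding develops_def by auto

text \<open>
  By induction from the bottom: the values on the lower boundary of the last cell determine the
  values on its upper boundary, by splitting or by joining.
\<close>
lemma develops_exists:
  assumes "layered D" "\<And>x. x \<in> set (bottom_path D) \<Longrightarrow> zero_tail_invariant (c x)"
  shows "\<exists>L. develops D L \<and> (\<forall>x\<in>set (bottom_path D). L x = c x)"
  using assms
proof (induction arbitrary: c rule: layered.induct)
  case (base u p v)
  then show ?case by (intro exI[of _ c]) (auto simp: develops_def)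
next
  case (attach D l p r q)
  note E = layered_edges[OF attach.hyps(1)] and C = layered_cells(1)[OF attach.hyps(1)]
  have dist: "distinct (l @ p @ r)" using layered_distinct[OF attach.hyps(1)] attach.hyps(2) by metis
  have sub: "set (l @ p @ r) \<subseteq> edges D" using E attach.hyps(2) by metis
  have zc: "zero_tail_invariant (c x)" if "x \<in> set l \<union> set q \<union> set r" for x
    using attach.prems[of x] that by auto
  \<comment> \<open>The prescribed values below the last cell force the values on its upper boundary.\<close>
  have "\<exists>c0. (\<forall>x. x \<notin> set p \<longrightarrow> c0 x = c x) \<and> (\<forall>x\<in>set p. zero_tail_invariant (c0 x)) \<and>
     (\<forall>L. (\<forall>x\<in>set p. L x = c0 x) \<and> (\<forall>x\<in>set q. L x = c x) \<longrightarrow>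
       (\<forall>e a b. p = [e] \<and> q = [a, b] \<or> p = [a, b] \<and> q = [e] \<longrightarrow> splits_into (L e) (L a) (L b)))"
  proof -
    from attach.hyps(3) consider e a b where "p = [e]" "q = [a, b]" | e a b where "p = [a, b]" "q = [e]"
      by (auto simp: cell_shape_def)
    then show ?thesis
    proof cases
      case 1
      then show ?thesis using zc
        by (intro exI[of _ "c(e := join (c a) (c b))"]) (auto intro: zero_tail_join splits_into_join)
    next
      case 2
      then have "a \<noteq> b" using dist by auto
      then show ?thesis using 2 zc
        by (intro exI[of _ "c(a := (\<lambda>w. c e (False # w)), b := (\<lambda>w. c e (True # w)))"])
          (auto intro: zero_tail_parts splits_into_parts)
    qed
  qed
  then obtain c0 where c0': "\<forall>x. x \<notin> set p \<longrightarrow> c0 x = c x"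
    "\<forall>x\<in>set p. zero_tail_invariant (c0 x)"
    "\<forall>L. (\<forall>x\<in>set p. L x = c0 x) \<and> (\<forall>x\<in>set q. L x = c x) \<longrightarrow>
       (\<forall>e a b. p = [e] \<and> q = [a, b] \<or> p = [a, b] \<and> q = [e] \<longrightarrow> splits_into (L e) (L a) (L b))"
    by (elim exE conjE) (rule that)
  note c0 = c0'(1)[rule_format] c0'(2)[rule_format] c0'(3)[THEN spec, THEN mp]
  have zb: "zero_tail_invariant (c0 x)" if "x \<in> set (bottom_path D)" for x
    using that c0(1,2) zc attach.hyps(2) by (cases "x \<in> set p") auto
  from attach.IH[of c0, OF zb] obtain L0 where L0: "develops D L0" "\<forall>x\<in>set (bottom_path D). L0 x = c0 x"
    by blast
  define L where "L = (\<lambda>x. if x \<in> set q then c x else L0 x)"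
  have L_old: "L x = L0 x" if "x \<in> edges D" for x using that attach.hyps(4) by (auto simp: L_def)
  have "develops D L" using develops_cong[OF attach.hyps(1) L_old L0(1)] by simp
  moreover have "\<forall>x\<in>set p. L x = c0 x" using L_old L0(2) sub attach.hyps(2) by auto
  moreover have Lq: "\<forall>x\<in>set q. L x = c x" by (simp add: L_def)
  moreover have "\<forall>x\<in>set q. zero_tail_invariant (L x)" using zc by (simp add: L_def)
  ultimately have dev: "develops (attach_cell D l p q r) L"
    unfolding develops_attach using c0(3)[of L] by simp
  have "L x = c x" if "x \<in> set l \<union> set r" for x
  proof -
    have "x \<in> edges D" "x \<notin> set p" "x \<in> set (bottom_path D)" using that sub dist attach.hyps(2) by auto
    then show ?thesis using L_old L0(2) c0(1) by simp
  qed
  then have "\<forall>x\<in>set (bottom_path (attach_cell D l p q r)). L x = c x"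
    using Lq by (simp add: ball_Un)
  then show ?case using dev by blast
qed

lemma develops_unique:
  assumes "layered D" "develops D L" "develops D L'" "\<forall>x\<in>set (bottom_path D). L x = L' x"
  shows "\<forall>x\<in>edges D. L x = L' x"
  using assms
proof (induction rule: layered.induct)
  case (base u p v)
  then show ?case by simp
next
  case (attach D l p r q)
  have sub: "set (l @ p @ r) \<subseteq> edges D" using layered_edges[OF attach.hyps(1)] attach.hyps(2) by metis
  note dev = attach.prems(1,2)[unfolded develops_attach]
  have q: "\<forall>x\<in>set q. L x = L' x" and lr: "\<forall>x\<in>set l \<union> set r. L x = L' x" using attach.prems(3) by auto
  have z: "zero_tail_invariant (L x)" "zero_tail_invariant (L' x)" if "x \<in> set p" for x
    using dev that sub unfolding develops_def by auto
  from attach.hyps(3) have "\<forall>x\<in>set p. L x = L' x"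
    unfolding cell_shape_def
  proof (elim exE conjE disjE)
    fix e a b assume pq: "p = [e]" "q = [a, b]"
    then have "splits_into (L e) (L a) (L b)" "splits_into (L' e) (L a) (L b)" using dev q by auto
    then show ?thesis using splits_into_unique2 z pq by auto
  next
    fix e a b assume pq: "p = [a, b]" "q = [e]"
    then have "splits_into (L e) (L a) (L b)" "splits_into (L e) (L' a) (L' b)" using dev q by auto
    then show ?thesis using splits_into_unique1 pq by fastforce
  qed
  then have "\<forall>x\<in>set (bottom_path D). L x = L' x"
    using lr by (simp add: attach.hyps(2) ball_Un)
  then have "\<forall>x\<in>edges D. L x = L' x"
    using attach.IH dev by blast
  then show ?case using q by (simp add: ball_Un)
qed

text \<open>
  For a diagram in \<open>F\<close>, the values \<open>\<alpha>\<close> on its bottom edge force values \<open>\<beta>\<close> on its top edge. This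
  relation is the homeomorphism of the diagram in disguise, and the invariant that all arguments
  about products rest on.
\<close>
definition transports :: "diagram \<Rightarrow> (bool list \<Rightarrow> 'v) \<Rightarrow> (bool list \<Rightarrow> 'v) \<Rightarrow> bool" where
  "transports D \<alpha> \<beta> \<longleftrightarrow>
     (\<exists>L. develops D L \<and> L (hd (bottom_path D)) = \<alpha> \<and> L (hd (top_path D)) = \<beta>)"

definition F_shaped :: "diagram \<Rightarrow> bool" where
  "F_shaped D \<longleftrightarrow> is_diagram D \<and> length (top_path D) = 1 \<and> length (bottom_path D) = 1"

lemma F_shaped_paths:
  assumes "F_shaped D"
  shows "top_path D = [hd (top_path D)]" "bottom_path D = [hd (bottom_path D)]" "layered D"
    "hd (top_path D) \<in> edges D" "hd (bottom_path D) \<in> edges D"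
proof -
  show t: "top_path D = [hd (top_path D)]" "bottom_path D = [hd (bottom_path D)]"
    using assms unfolding F_shaped_def by (auto simp: length_Suc_conv)
  show s: "layered D" using assms by (simp add: F_shaped_def is_diagram_iff_layered)
  show "hd (top_path D) \<in> edges D" "hd (bottom_path D) \<in> edges D"
    using layered_edges[OF s] t by (metis list.set_intros(1) subsetD)+
qed

lemma transports_exists:
  assumes "F_shaped D" "zero_tail_invariant \<alpha>" shows "\<exists>\<beta>. transports D \<alpha> \<beta>"
proof -
  obtain L where "develops D L" "\<forall>x\<in>set (bottom_path D). L x = \<alpha>"
    using develops_exists[OF F_shaped_paths(3)[OF assms(1)], of "\<lambda>_. \<alpha>"] assms(2) by blast
  moreover have "hd (bottom_path D) \<in> set (bottom_path D)"
    using F_shaped_paths(2)[OF assms(1)] by (metis list.set_intros(1))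
  ultimately show ?thesis unfolding transports_def by blast
qed

lemma transports_unique:
  assumes "F_shaped D" "transports D \<alpha> \<beta>" "transports D \<alpha> \<beta>'" shows "\<beta> = \<beta>'"
proof -
  note F = F_shaped_paths[OF assms(1)]
  obtain L L' where L: "develops D L" "L (hd (bottom_path D)) = \<alpha>" "L (hd (top_path D)) = \<beta>"
    "develops D L'" "L' (hd (bottom_path D)) = \<alpha>" "L' (hd (top_path D)) = \<beta>'"
    using assms(2,3) unfolding transports_def by blast
  have "\<forall>x\<in>set (bottom_path D). L x = L' x"
    by (subst F(2)) (use L in simp)
  then have "L (hd (top_path D)) = L' (hd (top_path D))"
    using develops_unique[OF F(3) L(1,4)] F(4) by blast
  then show ?thesis using L by simp
qed

lemma transports_zero_tail:
  assumes "F_shaped D" "transports D \<alpha> \<beta>"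
  shows "zero_tail_invariant \<alpha>" "zero_tail_invariant \<beta>"
  using assms F_shaped_paths[OF assms(1)] unfolding transports_def develops_def by auto

lemma transports_natural:
  assumes "transports D \<alpha> \<beta>" shows "transports D (h \<circ> \<alpha>) (h \<circ> \<beta>)"
proof -
  obtain L where L: "develops D L" "L (hd (bottom_path D)) = \<alpha>" "L (hd (top_path D)) = \<beta>"
    using assms unfolding transports_def by blast
  have "develops D (\<lambda>x. h \<circ> L x)"
    using L(1) unfolding develops_def zero_tail_invariant_def splits_into_def by auto
  then show ?thesis unfolding transports_def using L by (intro exI[of _ "\<lambda>x. h \<circ> L x"]) auto
qed

lemma transports_compose:
  assumes "F_shaped D1" "F_shaped D2" "composable D1 D2" "transports D2 \<alpha> \<beta>" "transports D1 \<beta> \<gamma>"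
  shows "transports (compose_diagram D1 D2) \<alpha> \<gamma>"
proof -
  note F1 = F_shaped_paths[OF assms(1)] and F2 = F_shaped_paths[OF assms(2)]
  obtain L1 L2 where L: "develops D2 L2" "L2 (hd (bottom_path D2)) = \<alpha>" "L2 (hd (top_path D2)) = \<beta>"
    "develops D1 L1" "L1 (hd (bottom_path D1)) = \<beta>" "L1 (hd (top_path D1)) = \<gamma>"
    using assms(4,5) unfolding transports_def by blast
  have bt: "bottom_path D1 = top_path D2" using assms(3) by (simp add: composable_def)
  have "edges D1 \<inter> edges D2 = set [hd (top_path D2)]"
    using assms(3) F2(1) unfolding composable_def by metis
  then have sh: "edges D1 \<inter> edges D2 = {hd (top_path D2)}" by simp
  define L where "L = (\<lambda>x. if x \<in> edges D2 then L2 x else L1 x)"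
  have L2: "L x = L2 x" if "x \<in> edges D2" for x using that by (simp add: L_def)
  have L1: "L x = L1 x" if "x \<in> edges D1" for x
  proof (cases "x \<in> edges D2")
    case True
    then have "x = hd (top_path D2)" using that sh by blast
    then show ?thesis using L bt True by (simp add: L_def)
  qed (simp add: L_def)
  have "develops D1 L" "develops D2 L"
    using develops_cong[OF F1(3) L1 L(4)] develops_cong[OF F2(3) L2 L(1)] by simp_all
  then have "develops (compose_diagram D1 D2) L"
    unfolding develops_def compose_diagram_def by auto
  then show ?thesis unfolding transports_def
    using L L1 L2 F1(4) F2(5) by (intro exI[of _ L]) (auto simp: compose_diagram_def)
qed

lemma transports_isotopic:
  assumes "F_shaped D" "isotopic D D'" "transports D' \<alpha> \<beta>" shows "transports D \<alpha> \<beta>"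
proof -
  note F = F_shaped_paths[OF assms(1)]
  obtain g where D': "D' = map_diagram g D" using assms(2) unfolding isotopic_def by blast
  obtain L where L: "develops D' L" "L (hd (bottom_path D')) = \<alpha>" "L (hd (top_path D')) = \<beta>"
    using assms(3) unfolding transports_def by blast
  have "develops D (\<lambda>x. L (g x))"
    unfolding develops_def
  proof (intro conjI ballI allI impI)
    fix x assume "x \<in> edges D" then show "zero_tail_invariant (L (g x))"
      using L(1) unfolding develops_def D' by simp
  next
    fix e a b assume "([e], [a, b]) \<in> cells D \<or> ([a, b], [e]) \<in> cells D"
    then have "([g e], [g a, g b]) \<in> cells D' \<or> ([g a, g b], [g e]) \<in> cells D'"
      unfolding D' by force
    then show "splits_into (L (g e)) (L (g a)) (L (g b))" using L(1) unfolding develops_def by blast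
  qed
  moreover have "hd (bottom_path D') = g (hd (bottom_path D))" "hd (top_path D') = g (hd (top_path D))"
    unfolding D' map_diagram_simps by (metis F(1,2) list.map(2) list.sel(1))+
  ultimately show ?thesis unfolding transports_def using L by (intro exI[of _ "\<lambda>x. L (g x)"]) auto
qed

text \<open>
  The outer paths of a dipole carry the same values, since both are computed from the path between
  the cells in the same way. So identifying them is compatible with a developing map.
\<close>
lemma transports_eliminates:
  assumes "F_shaped D" "eliminates_dipole D D'" "transports D' \<alpha> \<beta>" shows "transports D \<alpha> \<beta>"
proof -
  note F = F_shaped_paths[OF assms(1)]
  note C = layered_cells(1)[OF F(3)]
  obtain p q r g where dip: "dipole D p q r" and ident: "map g p = map g r"
    and D': "D' = map_diagram g (remove_dipole_cells D p q r)"
    using assms(2) unfolding eliminates_dipole_def by blast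
  have c: "(p, q) \<in> cells D" "(q, r) \<in> cells D" using dip by (auto simp: dipole_def)
  have neq: "(p, q) \<noteq> (q, r)" using C[OF c(1)] by (auto simp: cell_shape_def)
  obtain L where L: "develops D' L" "L (hd (bottom_path D')) = \<alpha>" "L (hd (top_path D')) = \<beta>"
    using assms(3) unfolding transports_def by blast
  have edges': "edges D' = g ` (edges D - set q)"
    and bt': "bottom_path D' = map g (bottom_path D)" "top_path D' = map g (top_path D)"
    by (simp_all add: D' remove_dipole_cells_def)
  have zL: "zero_tail_invariant (L (g x))" if "x \<in> edges D" "x \<notin> set q" for x
    using L(1) that unfolding develops_def edges' by blast
  have pq: "set p \<inter> set q = {}" using layered_cells_disjoint[OF F(3) c neq] by simp
  have rq: "set r \<inter> set q = {}" using layered_cells_disjoint[OF F(3) c neq] by auto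
  have pE: "zero_tail_invariant (L (g x))" if "x \<in> set p" for x
    using zL that pq C[OF c(1)] by auto
  \<comment> \<open>The path between the two cells is not seen by \<open>L\<close>; its values are computed from those above.\<close>
  have "\<exists>M. (\<forall>x\<in>set q. zero_tail_invariant (M x)) \<and>
     (\<forall>N. (\<forall>x\<in>set p \<union> set r. N x = L (g x)) \<and> (\<forall>x\<in>set q. N x = M x) \<longrightarrow>
       (\<forall>e a b. ([e], [a, b]) \<in> {(p, q), (q, r)} \<or> ([a, b], [e]) \<in> {(p, q), (q, r)} \<longrightarrow>
          splits_into (N e) (N a) (N b)))"
  proof -
    from C[OF c(1)] C[OF c(2)] consider e a b e' where "p = [e]" "q = [a, b]" "r = [e']"
      | a b e a' b' where "p = [a, b]" "q = [e]" "r = [a', b']"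
      by (auto simp: cell_shape_def)
    then show ?thesis
    proof cases
      case 1
      then have g: "g e' = g e" using ident by simp
      have "distinct [a, b]"
        using 1 layered_cell_distinct[OF F(3) c(1)] by simp
      then show ?thesis using 1 pE[of e] g
        by (intro exI[of _ "(\<lambda>_. L (g e))(a := (\<lambda>w. L (g e) (False # w)), b := (\<lambda>w. L (g e) (True # w)))"])
          (auto intro: zero_tail_parts splits_into_parts)
    next
      case 2
      then have g: "g a' = g a" "g b' = g b" using ident by auto
      show ?thesis using 2 pE[of a] pE[of b] g
        by (intro exI[of _ "\<lambda>_. join (L (g a)) (L (g b))"])
          (auto intro: zero_tail_join splits_into_join)
    qed
  qed
  then obtain M where M': "\<forall>x\<in>set q. zero_tail_invariant (M x)"
     "\<forall>N. (\<forall>x\<in>set p \<union> set r. N x = L (g x)) \<and> (\<forall>x\<in>set q. N x = M x) \<longrightarrow>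
       (\<forall>e a b. ([e], [a, b]) \<in> {(p, q), (q, r)} \<or> ([a, b], [e]) \<in> {(p, q), (q, r)} \<longrightarrow>
          splits_into (N e) (N a) (N b))"
    by (elim exE conjE) (rule that)
  note M = M'(1)[rule_format] M'(2)[THEN spec, THEN mp]
  define N where "N = (\<lambda>x. if x \<in> set q then M x else L (g x))"
  have N_new: "\<forall>e a b. ([e], [a, b]) \<in> {(p, q), (q, r)} \<or> ([a, b], [e]) \<in> {(p, q), (q, r)} \<longrightarrow>
          splits_into (N e) (N a) (N b)"
    by (rule M(2)) (use pq rq in \<open>auto simp: N_def\<close>)
  have N_old: "splits_into (N e) (N a) (N b)"
    if cell: "([e], [a, b]) \<in> cells D - {(p, q), (q, r)} \<or> ([a, b], [e]) \<in> cells D - {(p, q), (q, r)}"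
    for e a b
  proof -
    have off: "set x \<inter> set q = {} \<and> set y \<inter> set q = {}"
      if "(x, y) \<in> cells D - {(p, q), (q, r)}" for x y
      using layered_cells_disjoint[OF F(3), of x y p q] layered_cells_disjoint[OF F(3), of x y q r] that c by auto
    have "e \<notin> set q" "a \<notin> set q" "b \<notin> set q" using cell off by fastforce+
    moreover have "([g e], [g a, g b]) \<in> cells D' \<or> ([g a, g b], [g e]) \<in> cells D'"
      using cell unfolding D' remove_dipole_cells_def by force
    then have "splits_into (L (g e)) (L (g a)) (L (g b))"
      using L(1) unfolding develops_def by blast
    ultimately show ?thesis by (simp add: N_def)
  qed
  have "develops D N" unfolding develops_def
  proof (intro conjI ballI allI impI)
    fix x assume "x \<in> edges D" then show "zero_tail_invariant (N x)" using M(1) zL by (simp add: N_def)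
  next
    fix e a b assume "([e], [a, b]) \<in> cells D \<or> ([a, b], [e]) \<in> cells D"
    then show "splits_into (N e) (N a) (N b)" using N_new N_old by blast
  qed
  moreover have "hd (bottom_path D') = g (hd (bottom_path D))" "hd (top_path D') = g (hd (top_path D))"
    unfolding bt' by (metis F(1,2) list.map(2) list.sel(1))+
  moreover have "hd (bottom_path D) \<notin> set q" "hd (top_path D) \<notin> set q"
  proof -
    have "set q \<inter> set (bottom_path D) = {}" "set q \<inter> set (top_path D) = {}"
      using C[OF c(1)] C[OF c(2)] by auto
    then show "hd (bottom_path D) \<notin> set q" "hd (top_path D) \<notin> set q"
      using F(1,2) by (metis disjoint_iff list.set_intros(1))+
  qed
  ultimately show ?thesis unfolding transports_def using L
    by (intro exI[of _ N]) (auto simp: N_def)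
qed

text \<open>
  As transport is a total function, one inclusion between two transports is an equality.
\<close>
lemma transports_iffI:
  fixes \<alpha> \<beta> :: "bool list \<Rightarrow> 'v"
  assumes "F_shaped D" "F_shaped D'"
    "\<And>\<alpha> \<beta> :: bool list \<Rightarrow> 'v. transports D' \<alpha> \<beta> \<Longrightarrow> transports D \<alpha> \<beta>"
  shows "transports D \<alpha> \<beta> \<longleftrightarrow> transports D' \<alpha> \<beta>"
proof
  assume *: "transports D \<alpha> \<beta>"
  then obtain \<beta>' where b': "transports D' \<alpha> \<beta>'"
    using transports_exists[OF assms(2)] transports_zero_tail[OF assms(1)] by blast
  then show "transports D' \<alpha> \<beta>" using transports_unique[OF assms(1) * assms(3)[OF b']] b' by simp
qed (rule assms(3))

lemma isotopic_length:
  "isotopic D D' \<Longrightarrow> length (top_path D') = length (top_path D) \<and>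
     length (bottom_path D') = length (bottom_path D)"
  unfolding isotopic_def by auto

lemma transports_dipole_equivalent:
  assumes "F_shaped D" "dipole_equivalent D D'"
  shows "F_shaped D' \<and> (\<forall>\<alpha> \<beta> :: bool list \<Rightarrow> 'v. transports D \<alpha> \<beta> \<longleftrightarrow> transports D' \<alpha> \<beta>)"
  using assms(2) unfolding dipole_equivalent_def
proof (induction rule: equivclp_induct)
  case base
  then show ?case using assms(1) by simp
next
  case (step D1 D2)
  have *: "F_shaped X \<longleftrightarrow> F_shaped Y"
    "F_shaped X \<Longrightarrow> transports X \<alpha> \<beta> \<longleftrightarrow> transports Y \<alpha> \<beta>"
    if "is_diagram X \<and> is_diagram Y \<and> (isotopic X Y \<or> eliminates_dipole X Y)"
    for X Y and \<alpha> \<beta> :: "bool list \<Rightarrow> 'v"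
  proof -
    show 1: "F_shaped X \<longleftrightarrow> F_shaped Y"
      using that isotopic_length[of X Y] eliminates_dipole_length[of X Y] unfolding F_shaped_def by auto
    assume "F_shaped X"
    then show "transports X \<alpha> \<beta> \<longleftrightarrow> transports Y \<alpha> \<beta>"
      using that 1 transports_isotopic transports_eliminates by (intro transports_iffI) blast+
  qed
  from step.hyps(2) show ?case using step.IH *[of D1 D2] *[of D2 D1] by blast
qed

section \<open>Reduced diagrams as pairs of trees\<close>

datatype 'a tree = Leaf 'a | Node 'a "'a tree" "'a tree"

primrec root_label :: "'a tree \<Rightarrow> 'a" where
  "root_label (Leaf x) = x"
| "root_label (Node x l r) = x"

primrec leaf_labels :: "'a tree \<Rightarrow> 'a list" where
  "leaf_labels (Leaf x) = [x]"
| "leaf_labels (Node x l r) = leaf_labels l @ leaf_labels r"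

primrec node_labels :: "'a tree \<Rightarrow> 'a list" where
  "node_labels (Leaf x) = []"
| "node_labels (Node x l r) = x # node_labels l @ node_labels r"

primrec addresses :: "'a tree \<Rightarrow> bool list list" where
  "addresses (Leaf x) = [[]]"
| "addresses (Node x l r) = map (Cons False) (addresses l) @ map (Cons True) (addresses r)"

abbreviation shape :: "'a tree \<Rightarrow> unit tree" where
  "shape \<equiv> map_tree (\<lambda>_. ())"

text \<open>
  Each inner node of a tree labelled by edges is a cell: its label is the upper boundary, the labels of
  its two children form the lower boundary.
\<close>
primrec carets :: "edge tree \<Rightarrow> (path \<times> path) set" where
  "carets (Leaf x) = {}"
| "carets (Node x l r) = insert ([x], [root_label l, root_label r]) (carets l \<union> carets r)"

primrec plane_tree :: "edge tree \<Rightarrow> bool" where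
  "plane_tree (Leaf x) \<longleftrightarrow> True"
| "plane_tree (Node x l r) \<longleftrightarrow> triangle x (root_label l) (root_label r) \<and> plane_tree l \<and> plane_tree r"

lemma leaf_labels_nonempty [simp]: "leaf_labels t \<noteq> []"
  by (induction t) auto

lemma addresses_nonempty [simp]: "addresses t \<noteq> []"
  by (induction t) auto

lemma length_addresses [simp]: "length (addresses t) = length (leaf_labels t)"
  by (induction t) auto

lemma set_tree_eq: "set_tree t = set (node_labels t) \<union> set (leaf_labels t)"
  by (induction t) auto

lemma root_label_in [simp]: "root_label t \<in> set_tree t"
  by (cases t) auto

lemma addresses_map [simp]: "addresses (map_tree g t) = addresses t"
  by (induction t) auto

lemma leaf_labels_map [simp]: "leaf_labels (map_tree g t) = map g (leaf_labels t)"
  by (induction t) auto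

lemma node_labels_map [simp]: "node_labels (map_tree g t) = map g (node_labels t)"
  by (induction t) auto

lemma root_label_map [simp]: "root_label (map_tree g t) = g (root_label t)"
  by (cases t) auto

lemma carets_map: "carets (map_tree g t) = (\<lambda>(p, q). (map g p, map g q)) ` carets t"
  by (induction t) (auto simp: image_Un)

lemma plane_tree_ends:
  "plane_tree t \<Longrightarrow> is_path u (leaf_labels t) v \<longleftrightarrow> is_path u [root_label t] v"
  by (induction t arbitrary: u v) (auto simp: is_path_append triangle_def)

lemma plane_tree_vertices:
  "plane_tree t \<Longrightarrow> source ` set_tree t \<union> target ` set_tree t = path_vertices (leaf_labels t)"
proof (induction t)
  case (Leaf x)
  then show ?case by (auto simp: path_vertices_def)
next
  case (Node x l r)
  have "source x \<in> source ` set_tree l" "target x \<in> target ` set_tree r"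
    using Node.prems by (auto simp: triangle_def image_iff intro: bexI[OF _ root_label_in])
  then show ?case using Node by (auto simp: path_vertices_append image_Un)
qed

text \<open>
  The tree \<open>T\<close> is drawn with its root at the top, the trees in \<open>Fs\<close> are drawn below it with their
  roots at the bottom; they share their leaves, which form the longest positive path.
\<close>
definition forest_diagram :: "edge tree \<Rightarrow> edge tree list \<Rightarrow> diagram" where
  "forest_diagram T Fs =
     \<lparr>edges = set_tree T \<union> (\<Union>t\<in>set Fs. set_tree t), cells = carets T \<union> (\<Union>t\<in>set Fs. (carets t)\<inverse>),
      top_path = [root_label T], bottom_path = map root_label Fs\<rparr>"

definition matching_forests :: "edge tree \<Rightarrow> edge tree list \<Rightarrow> bool" where
  "matching_forests T Fs \<longleftrightarrow> plane_tree T \<and> (\<forall>t\<in>set Fs. plane_tree t) \<and>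
     concat (map leaf_labels Fs) = leaf_labels T \<and>
     distinct (node_labels T @ leaf_labels T @ concat (map node_labels Fs)) \<and>
     (\<exists>u v. simple_path u (leaf_labels T) v)"

lemma forest_diagram_simps [simp]:
  "edges (forest_diagram T Fs) = set_tree T \<union> (\<Union>t\<in>set Fs. set_tree t)"
  "cells (forest_diagram T Fs) = carets T \<union> (\<Union>t\<in>set Fs. (carets t)\<inverse>)"
  "top_path (forest_diagram T Fs) = [root_label T]"
  "bottom_path (forest_diagram T Fs) = map root_label Fs"
  by (simp_all add: forest_diagram_def)

lemma forest_edges:
  assumes "matching_forests T Fs"
  shows "edges (forest_diagram T Fs) = set (node_labels T @ leaf_labels T @ concat (map node_labels Fs))"
proof -
  have "set (concat (map leaf_labels Fs)) = set (leaf_labels T)"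
    using assms by (simp add: matching_forests_def del: set_concat)
  then have "(\<Union>t\<in>set Fs. set (leaf_labels t)) = set (leaf_labels T)" by simp
  then show ?thesis by (auto simp: set_tree_eq)
qed

primrec expand :: "'a \<Rightarrow> 'a \<Rightarrow> 'a \<Rightarrow> 'a tree \<Rightarrow> 'a tree" where
  "expand e a b (Leaf x) = (if x = e then Node x (Leaf a) (Leaf b) else Leaf x)"
| "expand e a b (Node x l r) = Node x (expand e a b l) (expand e a b r)"

lemma expand_root [simp]: "root_label (expand e a b t) = root_label t"
  by (cases t) auto

lemma expand_leaves:
  "leaf_labels (expand e a b t) = concat (map (\<lambda>x. if x = e then [a, b] else [x]) (leaf_labels t))"
  by (induction t) auto

lemma expand_nodes:
  "set (node_labels (expand e a b t)) = set (node_labels t) \<union> {e} \<inter> set (leaf_labels t)"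
  by (induction t) auto

lemma expand_distinct:
  "distinct (node_labels t @ leaf_labels t) \<Longrightarrow> distinct (node_labels (expand e a b t))"
proof (induction t)
  case (Node x l r)
  then show ?case by (auto simp: expand_nodes)
qed simp

lemma expand_carets:
  "carets (expand e a b t) = carets t \<union> (if e \<in> set (leaf_labels t) then {([e], [a, b])} else {})"
  by (induction t) auto

lemma expand_plane: "plane_tree t \<Longrightarrow> triangle e a b \<Longrightarrow> plane_tree (expand e a b t)"
  by (induction t) auto

text \<open>
  Build the diagram cell by cell. A merging cell joins two neighbouring trees at the bottom. A splitting
  cell below an inner root of a tree at the bottom would form a dipole with the cell of
  this root; so it splits a tree that is a single leaf, and this adds a caret to \<open>T\<close>.
\<close>
lemma reduced_forest_diagram:
  assumes "layered D" "reduced D" "length (top_path D) = 1"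
  shows "\<exists>T Fs. matching_forests T Fs \<and> D = forest_diagram T Fs"
  using assms
proof (induction rule: layered.induct)
  case (base u p v)
  then obtain e where p: "p = [e]" by (auto simp: length_Suc_conv)
  have "matching_forests (Leaf e) [Leaf e]"
    using base p by (auto simp: matching_forests_def)
  moreover have "path_diagram p = forest_diagram (Leaf e) [Leaf e]"
    by (simp add: p path_diagram_def forest_diagram_def)
  ultimately show ?case by blast
next
  case (attach E l p r q)
  have "reduced E" using attach.prems(1) by (auto simp: reduced_def dipole_def)
  then obtain T Fs where M: "matching_forests T Fs" and E: "E = forest_diagram T Fs"
    using attach by auto
  have "map root_label Fs = l @ p @ r" using attach.hyps(2) E by simp
  then obtain A C where AC: "Fs = A @ C" "l = map root_label A" "p @ r = map root_label C"
    unfolding map_eq_append_conv by blast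
  from AC(3)[symmetric] obtain P B where PB: "C = P @ B" "p = map root_label P" "r = map root_label B"
    unfolding map_eq_append_conv by blast
  have Fs: "Fs = A @ P @ B" "map root_label A = l" "map root_label P = p" "map root_label B = r"
    using AC PB by auto
  obtain u v where uv: "simple_path u (leaf_labels T) v" using M by (auto simp: matching_forests_def)
  note EE = forest_edges[OF M, folded E]
  from attach.hyps(3) consider e a b where "p = [a, b]" "q = [e]" "triangle e a b"
    | e a b where "p = [e]" "q = [a, b]" "triangle e a b"
    by (auto simp: cell_shape_def)
  then show ?case
  proof cases
    case 1
    then obtain t1 t2 where P: "P = [t1, t2]" "root_label t1 = a" "root_label t2 = b"
      using Fs(3) by auto
    let ?Fs = "A @ [Node e t1 t2] @ B"
    have "e \<notin> edges E" using attach.hyps(4) 1 by auto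
    then have "matching_forests T ?Fs"
      using M 1 P unfolding EE by (auto simp: matching_forests_def Fs)
    moreover have "attach_cell E l p q r = forest_diagram T ?Fs"
      using 1 P Fs by (auto simp: attach_cell_def forest_diagram_def E)
    ultimately show ?thesis by blast
  next
    case 2
    then obtain t where P: "P = [t]" "root_label t = e" using Fs(3) by auto
    have t: "t = Leaf e"
    proof (cases t)
      case (Node x t1 t2)
      then have "([root_label t1, root_label t2], [e]) \<in> cells E"
        using P Fs E by auto
      then have "dipole (attach_cell E l p q r) [root_label t1, root_label t2] [e] [a, b]"
        using 2 by (simp add: dipole_def)
      then show ?thesis using attach.prems(1) by (auto simp: reduced_def)
    qed (use P in simp)
    let ?T = "expand e a b T" and ?Fs = "A @ [Leaf a, Leaf b] @ B"
    have lT: "leaf_labels T = concat (map leaf_labels A) @ [e] @ concat (map leaf_labels B)"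
    proof -
      have "concat (map leaf_labels Fs) = leaf_labels T" using M by (simp add: matching_forests_def)
      then show ?thesis unfolding Fs(1) P(1) t by simp
    qed
    have eT: "e \<in> set (leaf_labels T)" using lT by simp
    have dT: "distinct (leaf_labels T)" using M by (simp add: matching_forests_def)
    have keep: "concat (map (\<lambda>x. if x = e then [a, b] else [x]) xs) = xs" if "e \<notin> set xs" for xs
      using that by (induction xs) auto
    have lT': "leaf_labels ?T = concat (map leaf_labels A) @ [a, b] @ concat (map leaf_labels B)"
      using dT keep[of "concat (map leaf_labels A)"] keep[of "concat (map leaf_labels B)"]
      unfolding expand_leaves lT by (simp del: set_concat)
    have ab: "a \<notin> edges E" "b \<notin> edges E" using attach.hyps(4) 2 by auto
    have "source b \<in> vertices (attach_cell E l p q r)" "source b \<notin> vertices E" "source a \<in> vertices E"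
    proof -
      show "source b \<notin> vertices E"
        using attach.hyps(5) 2 by (auto simp: interior_vertices_def triangle_def)
      have "e \<in> edges E" using eT EE by auto
      then show "source a \<in> vertices E" using 2 by (auto simp: triangle_def vertices_def)
    qed (use 2 in \<open>auto simp: path_vertices_def\<close>)
    then have "a \<noteq> b" by auto
    have "simple_path u (leaf_labels ?T) v"
      unfolding lT'
    proof (rule cell_shape_replace)
      show "simple_path u (concat (map leaf_labels A) @ [e] @ concat (map leaf_labels B)) v"
        using uv lT by simp
      show "cell_shape [e] [a, b]" using 2 by (auto simp: cell_shape_def)
      have "path_vertices (leaf_labels T) \<subseteq> vertices E" using EE by (intro path_vertices_subset) auto
      then show "interior_vertices [a, b] \<inter>
          path_vertices (concat (map leaf_labels A) @ [e] @ concat (map leaf_labels B)) = {}"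
        using attach.hyps(5) 2 lT by auto
    qed
    moreover have "distinct (node_labels ?T @ leaf_labels ?T @ concat (map node_labels ?Fs))"
    proof -
      have d: "distinct (node_labels T @ leaf_labels T @ concat (map node_labels A) @ concat (map node_labels B))"
        using M Fs P t by (simp add: matching_forests_def)
      have fr: "{a, b} \<inter> set (node_labels T @ leaf_labels T @ concat (map node_labels A) @ concat (map node_labels B)) = {}"
        using ab unfolding EE by (simp add: Fs P t)
      have "distinct (node_labels ?T)" using d by (intro expand_distinct) auto
      then show ?thesis
        using d fr \<open>a \<noteq> b\<close> eT unfolding lT' lT by (auto simp: expand_nodes lT)
    qed
    ultimately have "matching_forests ?T ?Fs"
      using M P Fs 2 lT' by (auto simp: matching_forests_def expand_plane)
    moreover have "attach_cell E l p q r = forest_diagram ?T ?Fs"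
    proof (rule diagram.equality)
      have "set_tree ?T = set_tree T \<union> {a, b}"
        unfolding set_tree_eq using lT' lT eT by (auto simp: expand_nodes)
      then show "edges (attach_cell E l p q r) = edges (forest_diagram ?T ?Fs)"
        using 2 Fs P t eT by (auto simp: E set_tree_eq)
      show "cells (attach_cell E l p q r) = cells (forest_diagram ?T ?Fs)"
        using 2 Fs P t eT by (auto simp: E expand_carets)
    qed (use 2 Fs in \<open>auto simp: E\<close>)
    ultimately show ?thesis by blast
  qed
qed

abbreviation pair_diagram :: "edge tree \<Rightarrow> edge tree \<Rightarrow> diagram" where
  "pair_diagram T S \<equiv> forest_diagram T [S]"

abbreviation matching_pair :: "edge tree \<Rightarrow> edge tree \<Rightarrow> bool" where
  "matching_pair T S \<equiv> matching_forests T [S]"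

lemma reduced_pair_diagram:
  assumes "D \<in> reduced_F_diagrams"
  obtains T S where "matching_pair T S" "D = pair_diagram T S"
proof -
  have "layered D" "reduced D" "length (top_path D) = 1" "length (bottom_path D) = 1"
    using assms is_diagram_iff_layered by (auto simp: reduced_F_diagrams_def)
  then obtain T Fs where "matching_forests T Fs" "D = forest_diagram T Fs"
    using reduced_forest_diagram by blast
  moreover have "\<exists>S. Fs = [S]"
    using calculation(2) \<open>length (bottom_path D) = 1\<close> by (simp add: length_Suc_conv)
  ultimately show ?thesis using that by blast
qed

lemma list_matching:
  assumes "distinct xs" "distinct ys" "length xs = length ys"
  shows "\<exists>g. map g xs = ys \<and> inj_on g (set xs)"
proof -
  have "map (the \<circ> map_of (zip xs ys)) xs = ys"
    using assms by (intro nth_equalityI) (auto simp: map_of_zip_nth)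
  then show ?thesis using assms(2) by (metis distinct_map)
qed

lemma map_tree_eqI:
  "shape t = shape t' \<Longrightarrow> map g (leaf_labels t) = leaf_labels t' \<Longrightarrow>
   map g (node_labels t) = node_labels t' \<Longrightarrow> map_tree g t = t'"
proof (induction t arbitrary: t')
  case (Leaf x)
  then show ?case by (cases t') auto
next
  case (Node x l r)
  then obtain x' l' r' where t': "t' = Node x' l' r'" by (cases t') auto
  have len: "length (leaf_labels s) = length (leaf_labels s')" "length (node_labels s) = length (node_labels s')"
    if "shape s = shape s'" for s :: "'a tree" and s' :: "'b tree"
    using that by (metis leaf_labels_map length_map, metis node_labels_map length_map)
  have "shape l = shape l'" "shape r = shape r'" using Node.prems(1) t' by auto
  then show ?case using Node t' len by auto
qed

lemma respects_ends_path:
  "is_path u p v \<Longrightarrow> is_path u' (map g p) v' \<Longrightarrow>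
   map f (u # map target p) = u' # map target (map g p) \<Longrightarrow> respects_ends f g (set p)"
proof (induction p arbitrary: u u')
  case (Cons e p)
  then have "respects_ends f g (set p)" by (intro Cons.IH[of "target e" "target (g e)"]) auto
  then show ?case using Cons.prems by (auto simp: respects_ends_def)
qed (simp add: respects_ends_def)

lemma respects_ends_tree:
  "plane_tree t \<Longrightarrow> plane_tree (map_tree g t) \<Longrightarrow> respects_ends f g (set (leaf_labels t)) \<Longrightarrow>
   respects_ends f g (set_tree t)"
proof (induction t)
  case (Node x l r)
  have "respects_ends f g (set (leaf_labels l))" "respects_ends f g (set (leaf_labels r))"
    using Node.prems(3) by (auto intro: respects_ends_subset)
  then have "respects_ends f g (set_tree l)" "respects_ends f g (set_tree r)"
    using Node.IH Node.prems by simp_all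
  moreover have "source x = source (root_label l)" "target x = target (root_label r)"
    "source (g x) = source (g (root_label l))" "target (g x) = target (g (root_label r))"
    using Node.prems by (auto simp: triangle_def)
  ultimately show ?case using root_label_in[of l] root_label_in[of r]
    unfolding respects_ends_def by auto
qed simp

lemma vertices_pair_diagram:
  "matching_pair T S \<Longrightarrow> vertices (pair_diagram T S) = path_vertices (leaf_labels T)"
  using plane_tree_vertices[of T] plane_tree_vertices[of S]
  by (auto simp: vertices_def matching_forests_def image_Un)

text \<open>
  The shapes of the two trees determine how many edges there are and how they are incident, so matching
  the lists of labels position by position is an isotopy.
\<close>
lemma isotopic_pair_diagrams:
  assumes M: "matching_pair T S" and M': "matching_pair T' S'"
    and sh: "shape T = shape T'" "shape S = shape S'"
  shows "isotopic (pair_diagram T S) (pair_diagram T' S')"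
proof -
  have leaves: "leaf_labels S = leaf_labels T" "leaf_labels S' = leaf_labels T'"
    using M M' by (auto simp: matching_forests_def)
  have len: "length (leaf_labels s) = length (leaf_labels s')" "length (node_labels s) = length (node_labels s')"
    if "shape s = shape s'" for s s' :: "edge tree"
    using that by (metis leaf_labels_map length_map, metis node_labels_map length_map)
  let ?xs = "node_labels T @ leaf_labels T @ node_labels S"
  let ?ys = "node_labels T' @ leaf_labels T' @ node_labels S'"
  obtain g where g: "map g ?xs = ?ys" "inj_on g (set ?xs)"
    using list_matching[of ?xs ?ys] M M' len[OF sh(1)] len[OF sh(2)]
    by (auto simp: matching_forests_def)
  then have gm: "map g (node_labels T) = node_labels T'" "map g (leaf_labels T) = leaf_labels T'"
    "map g (node_labels S) = node_labels S'"
    using len[OF sh(1)] len[OF sh(2)] by auto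
  have gT: "map_tree g T = T'" using map_tree_eqI[OF sh(1)] gm by blast
  have gS: "map_tree g S = S'" using map_tree_eqI[OF sh(2)] gm leaves by simp
  obtain u v u' v' where sp: "simple_path u (leaf_labels T) v" "simple_path u' (leaf_labels T') v'"
    using M M' by (auto simp: matching_forests_def)
  have "\<exists>f. map f (u # map target (leaf_labels T)) = u' # map target (leaf_labels T') \<and>
      inj_on f (set (u # map target (leaf_labels T)))"
    by (rule list_matching) (use sp len[OF sh(1)] in \<open>simp_all add: simple_path_def\<close>)
  then obtain f where f: "map f (u # map target (leaf_labels T)) = u' # map target (leaf_labels T')"
    "inj_on f (set (u # map target (leaf_labels T)))" by (elim exE conjE) (rule that)
  have resp_leaves: "respects_ends f g (set (leaf_labels T))"
    using respects_ends_path[of u "leaf_labels T" v u' g v' f] sp f(1) gm(2) by (simp add: simple_path_def)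
  have "respects_ends f g (set_tree T)" "respects_ends f g (set_tree S)"
    using respects_ends_tree[of T g f] respects_ends_tree[of S g f] M M' resp_leaves gT gS leaves
    by (auto simp: matching_forests_def)
  then have "respects_ends f g (edges (pair_diagram T S))" by (auto simp: respects_ends_def)
  moreover have "inj_on f (vertices (pair_diagram T S))"
  proof -
    have "path_vertices (leaf_labels T) = set (u # map target (leaf_labels T))"
      using path_vertices_path[of u "leaf_labels T" v] sp by (simp add: simple_path_def)
    then show ?thesis using f(2) vertices_pair_diagram[OF M] by simp
  qed
  moreover have "inj_on g (edges (pair_diagram T S))"
    using g(2) forest_edges[OF M] by simp
  moreover have "pair_diagram T' S' = map_diagram g (pair_diagram T S)"
  proof (rule diagram.equality)
    show "cells (pair_diagram T' S') = cells (map_diagram g (pair_diagram T S))"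
      unfolding gT[symmetric] gS[symmetric] by (auto simp: carets_map image_Un)
  qed (auto simp: gT[symmetric] gS[symmetric] tree.set_map image_Un)
  ultimately show ?thesis unfolding isotopic_def by blast
qed

section \<open>Every matching pair of trees is a diagram\<close>

text \<open>
  All carets of \<open>t\<close> are attached below its root; \<open>merge_below\<close> attaches their mirror images below
  the leaves of \<open>t\<close>.
\<close>
definition graft_below :: "diagram \<Rightarrow> path \<Rightarrow> edge tree \<Rightarrow> path \<Rightarrow> diagram" where
  "graft_below D l t r = \<lparr>edges = edges D \<union> set_tree t, cells = cells D \<union> carets t,
     top_path = top_path D, bottom_path = l @ leaf_labels t @ r\<rparr>"

definition merge_below :: "diagram \<Rightarrow> path \<Rightarrow> edge tree \<Rightarrow> path \<Rightarrow> diagram" where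
  "merge_below D l t r = \<lparr>edges = edges D \<union> set_tree t, cells = cells D \<union> (carets t)\<inverse>,
     top_path = top_path D, bottom_path = l @ [root_label t] @ r\<rparr>"

lemma graft_below_simps [simp]:
  "edges (graft_below D l t r) = edges D \<union> set_tree t"
  "cells (graft_below D l t r) = cells D \<union> carets t"
  "top_path (graft_below D l t r) = top_path D"
  "bottom_path (graft_below D l t r) = l @ leaf_labels t @ r"
  by (simp_all add: graft_below_def)

lemma merge_below_simps [simp]:
  "edges (merge_below D l t r) = edges D \<union> set_tree t"
  "cells (merge_below D l t r) = cells D \<union> (carets t)\<inverse>"
  "top_path (merge_below D l t r) = top_path D"
  "bottom_path (merge_below D l t r) = l @ [root_label t] @ r"
  by (simp_all add: merge_below_def)

lemma simple_path_append_split: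
  assumes "simple_path u (p @ q) v" "p \<noteq> []" "q \<noteq> []"
  obtains w where "simple_path u p w" "simple_path w q v" "w \<in> target ` set p"
    "insert u (target ` set p) \<inter> target ` set q = {}"
proof -
  obtain w where w: "is_path u p w" "is_path w q v"
    using assms(1) by (auto simp: simple_path_def is_path_append)
  have w_in: "w \<in> target ` set p" using is_path_last[OF w(1) assms(2)] assms(2) last_in_set by blast
  have d: "distinct (u # map target (p @ q))" using assms(1) by (simp add: simple_path_def)
  then have disj: "insert u (target ` set p) \<inter> target ` set q = {}" by auto
  then have "w \<notin> target ` set q" using w_in by (metis disjoint_iff insertI2)
  then show ?thesis using that w w_in disj d assms by (simp add: simple_path_def)
qed

lemma layered_graft_below:
  assumes "plane_tree t" "layered D" "bottom_path D = l @ [root_label t] @ r"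
    "distinct (node_labels t @ leaf_labels t)" "set_tree t \<inter> edges D \<subseteq> {root_label t}"
    "simple_path u (leaf_labels t) v" "target ` set (butlast (leaf_labels t)) \<inter> vertices D = {}"
  shows "layered (graft_below D l t r)"
  using assms
proof (induction t arbitrary: D l r u v)
  case (Leaf x)
  then have "x \<in> edges D" using layered_edges[of D] by auto
  then have "graft_below D l (Leaf x) r = D"
    using Leaf.prems(3) by (cases D) (auto simp: graft_below_def)
  then show ?case using Leaf.prems(2) by simp
next
  case (Node e tl tr)
  let ?L = "leaf_labels tl" and ?R = "leaf_labels tr" and ?a = "root_label tl" and ?b = "root_label tr"
  obtain w where w: "simple_path u ?L w" "simple_path w ?R v" "w \<in> target ` set ?L"
    "insert u (target ` set ?L) \<inter> target ` set ?R = {}"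
    using simple_path_append_split[of u ?L ?R v] Node.prems(6) by auto
  have pl: "plane_tree tl" "plane_tree tr" "triangle e ?a ?b" using Node.prems(1) by auto
  have ends: "source ?a = u" "target ?a = w" "source ?b = w" "target ?b = v"
    using plane_tree_ends[OF pl(1), of u w] plane_tree_ends[OF pl(2), of w v] w
    by (auto simp: simple_path_def)
  have v_in: "v \<in> target ` set ?R"
    using w(2) is_path_last[of w ?R v] last_in_set[of ?R] unfolding simple_path_def by (metis imageI)
  have uw: "u \<noteq> w" using w(1) simple_path_neq by blast
  have disjT: "set_tree tl \<inter> set_tree tr = {}" "e \<notin> set_tree tl" "e \<notin> set_tree tr"
    using Node.prems(4) by (auto simp: set_tree_eq)
  have ab: "?a \<notin> set_tree tr" "?b \<notin> set_tree tl"
    using disjT(1) root_label_in[of tl] root_label_in[of tr] by (metis disjoint_iff)+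
  have subT: "set_tree tl \<inter> edges D = {}" "set_tree tr \<inter> edges D = {}"
    using Node.prems(5) disjT by auto
  have eD: "e \<in> edges D" using layered_edges[OF Node.prems(2)] Node.prems(3) by auto
  have butL: "target ` set ?L \<inter> vertices D = {}" "target ` set (butlast ?R) \<inter> vertices D = {}"
    using Node.prems(7) by (auto simp: butlast_append image_Un)
  let ?D1 = "attach_cell D l [e] [?a, ?b] r"
  have D1: "layered ?D1"
  proof (rule layered.attach)
    show "bottom_path D = l @ [e] @ r" using Node.prems(3) by simp
    show "cell_shape [e] [?a, ?b]" using pl(3) by (auto simp: cell_shape_def)
    have "?a \<notin> edges D" using subT root_label_in[of tl] by blast
    moreover have "?b \<notin> edges D" using subT root_label_in[of tr] by blast
    ultimately show "set [?a, ?b] \<inter> edges D = {}" by simp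
    have "w \<notin> vertices D" using w(3) butL(1) by (metis disjoint_iff)
    then show "interior_vertices [?a, ?b] \<inter> vertices D = {}" using ends by (simp add: interior_vertices_def)
  qed (rule Node.prems)
  have vD1: "vertices ?D1 = vertices D \<union> {u, w, v}"
    using ends by (auto simp: path_vertices_def)
  have dL: "distinct (map target ?L)" "u \<notin> target ` set ?L" using w(1) by (auto simp: simple_path_def)
  have dR: "distinct (map target ?R)" "w \<notin> target ` set ?R" using w(2) by (auto simp: simple_path_def)
  have lastL: "target (last ?L) = w" and lastR: "target (last ?R) = v"
    using w is_path_last by (auto simp: simple_path_def)
  have butnot: "target (last p) \<notin> target ` set (butlast p)" if "distinct (map target p)" "p \<noteq> []" for p
    using that by (cases p rule: rev_cases) auto
  have D2: "layered (graft_below ?D1 l tl ([?b] @ r))"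
  proof (rule Node.IH(1)[OF pl(1) D1])
    show "distinct (node_labels tl @ leaf_labels tl)" using Node.prems(4) by auto
    show "set_tree tl \<inter> edges ?D1 \<subseteq> {?a}"
      using subT ab by auto
    show "target ` set (butlast ?L) \<inter> vertices ?D1 = {}"
    proof -
      have 1: "target ` set (butlast ?L) \<subseteq> target ` set ?L" by (auto dest: in_set_butlastD)
      have "u \<notin> target ` set (butlast ?L)" using 1 dL(2) by (metis subsetD)
      moreover have "w \<notin> target ` set (butlast ?L)" using butnot[OF dL(1)] lastL by simp
      moreover have "v \<notin> target ` set (butlast ?L)" using 1 v_in w(4) by (metis disjoint_iff insertI2 subsetD)
      moreover have "target ` set (butlast ?L) \<inter> vertices D = {}" using 1 butL(1) by (metis disjoint_iff subsetD)
      ultimately show ?thesis unfolding vD1 by auto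
    qed
  qed (use w in simp_all)
  let ?D2 = "graft_below ?D1 l tl ([?b] @ r)"
  have vD2: "vertices ?D2 = vertices D \<union> insert u (target ` set ?L) \<union> {u, w, v}"
  proof -
    have "vertices ?D2 = vertices ?D1 \<union> (source ` set_tree tl \<union> target ` set_tree tl)"
      by (auto simp: vertices_def)
    also have "source ` set_tree tl \<union> target ` set_tree tl = insert u (target ` set ?L)"
      using plane_tree_vertices[OF pl(1)] path_vertices_path[of u ?L w] w(1) by (simp add: simple_path_def)
    finally show ?thesis unfolding vD1 by auto
  qed
  have "layered (graft_below ?D2 (l @ ?L) tr r)"
  proof (rule Node.IH(2)[OF pl(2) D2])
    show "distinct (node_labels tr @ leaf_labels tr)" using Node.prems(4) by auto
    show "set_tree tr \<inter> edges ?D2 \<subseteq> {?b}"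
      using subT disjT(1) ab by auto
    show "target ` set (butlast ?R) \<inter> vertices ?D2 = {}"
    proof -
      have 1: "target ` set (butlast ?R) \<subseteq> target ` set ?R" by (auto dest: in_set_butlastD)
      have "insert u (target ` set ?L) \<inter> target ` set (butlast ?R) = {}"
        using 1 w(4) by (metis disjoint_iff subsetD)
      moreover have "w \<notin> target ` set (butlast ?R)" using 1 dR(2) by (metis subsetD)
      moreover have "v \<notin> target ` set (butlast ?R)" using butnot[OF dR(1)] lastR by simp
      ultimately show ?thesis using butL(2) unfolding vD2 by auto
    qed
  qed (use w in simp_all)
  moreover have "graft_below ?D2 (l @ ?L) tr r = graft_below D l (Node e tl tr) r"
    using eD root_label_in[of tl] root_label_in[of tr] by (auto simp: graft_below_def)
  ultimately show ?case by simp
qed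

lemma layered_merge_below:
  assumes "plane_tree t" "layered D" "bottom_path D = l @ leaf_labels t @ r"
    "set (node_labels t) \<inter> edges D = {}" "distinct (node_labels t)"
  shows "layered (merge_below D l t r)"
  using assms
proof (induction t arbitrary: D l r)
  case (Leaf x)
  then have "x \<in> edges D" using layered_edges[of D] by auto
  then have "merge_below D l (Leaf x) r = D"
    using Leaf.prems(3) by (cases D) (auto simp: merge_below_def)
  then show ?case using Leaf.prems(2) by simp
next
  case (Node e tl tr)
  let ?L = "leaf_labels tl" and ?R = "leaf_labels tr" and ?a = "root_label tl" and ?b = "root_label tr"
  have pl: "plane_tree tl" "plane_tree tr" "triangle e ?a ?b" using Node.prems(1) by auto
  have leavesD: "set ?L \<subseteq> edges D" "set ?R \<subseteq> edges D"
    using layered_edges[OF Node.prems(2)] Node.prems(3) by auto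
  let ?D1 = "merge_below D l tl (?R @ r)"
  have D1: "layered ?D1"
    by (rule Node.IH(1)) (use Node.prems in auto)
  let ?D2 = "merge_below ?D1 (l @ [?a]) tr r"
  have D2: "layered ?D2"
    by (rule Node.IH(2)[OF pl(2) D1]) (use Node.prems leavesD in \<open>auto simp: set_tree_eq\<close>)
  have "e \<notin> edges ?D2" using Node.prems(4,5) leavesD by (auto simp: set_tree_eq)
  then have "layered (attach_cell ?D2 l [?a, ?b] [e] r)"
    by (intro layered.attach[OF D2]) (use pl(3) in \<open>auto simp: cell_shape_def interior_vertices_def\<close>)
  moreover have "attach_cell ?D2 l [?a, ?b] [e] r = merge_below D l (Node e tl tr) r"
    by (auto simp: attach_cell_def merge_below_def)
  ultimately show ?case by simp
qed

lemma matching_pairD: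
  assumes "matching_pair T S"
  shows "plane_tree T" "plane_tree S" "leaf_labels S = leaf_labels T"
    "distinct (node_labels T @ leaf_labels T @ node_labels S)"
  using assms by (auto simp: matching_forests_def)

lemma layered_pair_diagram:
  assumes "matching_pair T S" shows "layered (pair_diagram T S)"
proof -
  note M = matching_pairD[OF assms]
  obtain u v where sp: "simple_path u (leaf_labels T) v" using assms by (auto simp: matching_forests_def)
  have p: "is_path u [root_label T] v" using plane_tree_ends[OF M(1)] sp by (simp add: simple_path_def)
  have uv: "u \<noteq> v" using sp simple_path_neq by blast
  then have base: "layered (path_diagram [root_label T])"
    using p by (intro layered.base[of u _ v]) (auto simp: simple_path_def)
  have 1: "layered (graft_below (path_diagram [root_label T]) [] T [])"
  proof (rule layered_graft_below[OF M(1) base _ _ _ sp])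
    have "target (last (leaf_labels T)) = v" using sp is_path_last by (auto simp: simple_path_def)
    then have "target ` set (butlast (leaf_labels T)) \<inter> {u, v} = {}"
      using sp by (cases "leaf_labels T" rule: rev_cases) (auto simp: simple_path_def)
    then show "target ` set (butlast (leaf_labels T)) \<inter> vertices (path_diagram [root_label T]) = {}"
      using p by (auto simp: path_vertices_def)
  qed (use M(4) in auto)
  let ?G = "graft_below (path_diagram [root_label T]) [] T []"
  have "set (node_labels S) \<inter> set_tree T = {}" using M(4) by (auto simp: set_tree_eq)
  then have "layered (merge_below ?G [] S [])"
    using M root_label_in[of T]
    by (intro layered_merge_below[OF M(2) 1]) auto
  moreover have "merge_below ?G [] S [] = pair_diagram T S"
    using root_label_in[of T] by (auto simp: merge_below_def forest_diagram_def)
  ultimately show ?thesis by simp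
qed

lemma F_shaped_pair_diagram: "matching_pair T S \<Longrightarrow> F_shaped (pair_diagram T S)"
  using layered_pair_diagram by (simp add: F_shaped_def is_diagram_iff_layered)

section \<open>Reduced pairs are determined by their transport\<close>

lemma develops_tree:
  assumes "\<forall>e a b. ([e], [a, b]) \<in> carets t \<longrightarrow> splits_into (L e) (L a) (L b)"
  shows "list_all2 (\<lambda>a x. \<forall>w. L (root_label t) (a @ w) = L x w) (addresses t) (leaf_labels t)"
  using assms
proof (induction t)
  case (Node e l r)
  then have "splits_into (L e) (L (root_label l)) (L (root_label r))" by simp
  then show ?case using Node
    by (auto simp: list_all2_append list.rel_map splits_into_def)
qed simp

text \<open>
  A leaf belongs to both trees, and its value can be computed along the branches of either tree.
\<close>
lemma transports_pair:
  assumes "matching_pair T S" "transports (pair_diagram T S) \<alpha> \<beta>" "i < length (leaf_labels T)"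
  shows "\<beta> (addresses T ! i @ w) = \<alpha> (addresses S ! i @ w)"
proof -
  note M = matching_pairD[OF assms(1)]
  obtain L where L: "develops (pair_diagram T S) L" "L (root_label S) = \<alpha>" "L (root_label T) = \<beta>"
    using assms(2) unfolding transports_def by auto
  have "list_all2 (\<lambda>a x. \<forall>w. L (root_label T) (a @ w) = L x w) (addresses T) (leaf_labels T)"
    by (rule develops_tree) (use L(1) in \<open>auto simp: develops_def\<close>)
  moreover have "list_all2 (\<lambda>a x. \<forall>w. L (root_label S) (a @ w) = L x w) (addresses S) (leaf_labels S)"
    by (rule develops_tree) (use L(1) in \<open>auto simp: develops_def\<close>)
  ultimately show ?thesis using L M(3) assms(3) by (auto simp: list_all2_conv_all_nth)
qed

lemma shape_eqI: "addresses t = addresses t' \<Longrightarrow> shape t = shape t'"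
proof (induction t arbitrary: t')
  case (Leaf x)
  show ?case
  proof (cases t')
    case (Node y l r)
    have "[] \<in> set (addresses t')" using Leaf by (metis addresses.simps(1) list.set_intros(1))
    then show ?thesis using Node by auto
  qed simp
next
  case (Node x l r)
  show ?case
  proof (cases t')
    case (Leaf y)
    then have "[] \<in> set (addresses (Node x l r))" using Node.prems by simp
    then show ?thesis by auto
  next
    case (Node y l' r')
    have f: "filter (\<lambda>w. hd w = b) (map (Cons False) A @ map (Cons True) B) = map (Cons b) (if b then B else A)"
      for b A B by (simp add: filter_map o_def)
    have "map (Cons b) (if b then addresses r else addresses l) = map (Cons b) (if b then addresses r' else addresses l')" for b
      using Node.prems Node f[of b "addresses l" "addresses r"] f[of b "addresses l'" "addresses r'"]
      by simp
    from this[of True] this[of False] have "addresses l = addresses l'" "addresses r = addresses r'"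
      by (simp_all add: inj_map_eq_map)
    then show ?thesis using Node Node.IH by simp
  qed
qed

text \<open>
  A deepest inner node has two leaves as children; reducedness is about such pairs of leaves.
\<close>
lemma cherry_exists:
  "(\<exists>x. t = Leaf x) \<or> (\<exists>A v B. addresses t = A @ [v @ [False], v @ [True]] @ B)"
proof (induction t)
  case (Node x l r)
  from Node.IH(1) show ?case
  proof (elim disjE exE)
    fix A v B assume "addresses l = A @ [v @ [False], v @ [True]] @ B"
    then have "addresses (Node x l r) = map (Cons False) A @ [(False # v) @ [False], (False # v) @ [True]]
        @ (map (Cons False) B @ map (Cons True) (addresses r))" by simp
    then show ?thesis by blast
  next
    fix y assume l: "l = Leaf y"
    from Node.IH(2) show ?thesis
    proof (elim disjE exE)
      fix A v B assume "addresses r = A @ [v @ [False], v @ [True]] @ B"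
      then have "addresses (Node x l r) = ([False] # map (Cons True) A) @
          [(True # v) @ [False], (True # v) @ [True]] @ map (Cons True) B" using l by simp
      then show ?thesis by blast
    next
      fix z assume "r = Leaf z"
      then have "addresses (Node x l r) = [] @ [[] @ [False], [] @ [True]] @ []" using l by simp
      then show ?thesis by blast
    qed
  qed
qed simp

text \<open>
  Some leaf of \<open>t\<close> is an inner node of \<open>t'\<close>, witnessed by two sibling leaves of \<open>t'\<close> below it.
\<close>
definition refined_by :: "'a tree \<Rightarrow> 'b tree \<Rightarrow> bool" where
  "refined_by t t' \<longleftrightarrow> (\<exists>x\<in>set (addresses t). \<exists>v A B. addresses t' = A @ [x @ v @ [False], x @ v @ [True]] @ B)"

lemma refined_by_Node:
  "refined_by l l' \<Longrightarrow> refined_by (Node y l r) (Node y' l' r')"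
  "refined_by r r' \<Longrightarrow> refined_by (Node y l r) (Node y' l' r')"
proof -
  assume "refined_by l l'"
  then obtain x v A B where x: "x \<in> set (addresses l)"
    "addresses l' = A @ [x @ v @ [False], x @ v @ [True]] @ B" unfolding refined_by_def by blast
  then have "addresses (Node y' l' r') = map (Cons False) A @ [(False # x) @ v @ [False], (False # x) @ v @ [True]]
      @ (map (Cons False) B @ map (Cons True) (addresses r'))" by simp
  moreover have "False # x \<in> set (addresses (Node y l r))" using x by simp
  ultimately show "refined_by (Node y l r) (Node y' l' r')" unfolding refined_by_def by blast
next
  assume "refined_by r r'"
  then obtain x v A B where x: "x \<in> set (addresses r)"
    "addresses r' = A @ [x @ v @ [False], x @ v @ [True]] @ B" unfolding refined_by_def by blast
  then have "addresses (Node y' l' r') = (map (Cons False) (addresses l') @ map (Cons True) A) @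
      [(True # x) @ v @ [False], (True # x) @ v @ [True]] @ map (Cons True) B" by simp
  moreover have "True # x \<in> set (addresses (Node y l r))" using x by simp
  ultimately show "refined_by (Node y l r) (Node y' l' r')" unfolding refined_by_def by blast
qed

lemma refined_by_Leaf: "refined_by (Leaf y) (Node x l r)"
  using cherry_exists[of "Node x l r"] by (auto simp: refined_by_def)

lemma shape_or_refined: "shape t = shape t' \<or> refined_by t t' \<or> refined_by t' t"
proof (induction t arbitrary: t')
  case (Leaf x)
  then show ?case by (cases t') (auto intro: refined_by_Leaf)
next
  case (Node x l r)
  show ?case
  proof (cases t')
    case (Leaf y)
    then show ?thesis by (auto intro: refined_by_Leaf)
  next
    case (Node y l' r')
    show ?thesis using Node.IH(1)[of l'] Node.IH(2)[of r'] refined_by_Node[of l l'] refined_by_Node[of r r']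
      refined_by_Node[of l' l] refined_by_Node[of r' r] unfolding Node by auto
  qed
qed

lemma address_Nil: "[] \<in> set (addresses t) \<Longrightarrow> \<exists>x. t = Leaf x"
  by (cases t) auto

lemma sibling_caret:
  assumes "Suc i < length (leaf_labels t)" "addresses t ! i = z @ [False]" "addresses t ! Suc i = z @ [True]"
  shows "\<exists>e. ([e], [leaf_labels t ! i, leaf_labels t ! Suc i]) \<in> carets t"
  using assms
proof (induction t arbitrary: i z)
  case (Node y l r)
  let ?n = "length (leaf_labels l)"
  consider "Suc i < ?n" | "Suc i = ?n" | "?n \<le> i" by linarith
  then show ?case
  proof cases
    case 1
    then have "False # addresses l ! i = z @ [False]" "False # addresses l ! Suc i = z @ [True]"
      using Node.prems by (auto simp: nth_append)
    then obtain z' where "addresses l ! i = z' @ [False]" "addresses l ! Suc i = z' @ [True]"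
      by (cases z) auto
    then show ?thesis using Node.IH(1)[of i z'] 1 by (auto simp: nth_append)
  next
    case 2
    then have *: "False # addresses l ! i = z @ [False]" "True # addresses r ! 0 = z @ [True]"
      using Node.prems by (auto simp: nth_append)
    then have "z = []" by (cases z) auto
    then have "addresses l ! i = []" "addresses r ! 0 = []" using * by auto
    then have "[] \<in> set (addresses l)" "[] \<in> set (addresses r)"
      using 2 nth_mem[of i "addresses l"] nth_mem[of 0 "addresses r"] by auto
    then obtain x x' where "l = Leaf x" "r = Leaf x'" using address_Nil by metis
    then show ?thesis using 2 by auto
  next
    case 3
    then obtain j where j: "i = ?n + j" using le_Suc_ex by blast
    then have "True # addresses r ! j = z @ [False]" "True # addresses r ! Suc j = z @ [True]"
      using Node.prems by (auto simp: nth_append)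
    then obtain z' where "addresses r ! j = z' @ [False]" "addresses r ! Suc j = z' @ [True]"
      by (cases z) auto
    then show ?thesis using Node.IH(2)[of j z'] j Node.prems(1) by (auto simp: nth_append)
  qed
qed simp

text \<open>
  From the transport of such a function, the addresses of the leaves can be recovered.
\<close>
definition separating :: "(bool list \<Rightarrow> 'v) \<Rightarrow> bool" where
  "separating \<alpha> \<longleftrightarrow> (\<forall>x y. (\<forall>w. \<alpha> (x @ w) = \<alpha> (y @ w)) \<longrightarrow> x = y)"

text \<open>
  Let \<open>x\<close> be a leaf of \<open>T\<close> above two sibling leaves of \<open>T'\<close>. By the first diagram, the transported
  function below \<open>x\<close> copies \<open>\<alpha>\<close> below the corresponding leaf of \<open>S\<close>. Then the leaves of \<open>S'\<close> that correspond to the two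
  siblings are siblings, too, and the two carets form a dipole.
\<close>
lemma not_refined_by:
  assumes M: "matching_pair T S" and M': "matching_pair T' S'"
    and red: "reduced (pair_diagram T' S')" and sep: "separating \<alpha>"
    and tr: "transports (pair_diagram T S) \<alpha> \<beta>" "transports (pair_diagram T' S') \<alpha> \<beta>"
  shows "\<not> refined_by T T'"
proof
  assume "refined_by T T'"
  then obtain x v A B where x: "x \<in> set (addresses T)"
    and T': "addresses T' = A @ [x @ v @ [False], x @ v @ [True]] @ B" unfolding refined_by_def by blast
  obtain k where k: "k < length (leaf_labels T)" "addresses T ! k = x"
    using x by (metis in_set_conv_nth length_addresses)
  define i where "i = length A"
  have "length (leaf_labels T') = length A + 2 + length B"
    using length_addresses[of T'] unfolding T' by simp
  then have i: "Suc i < length (leaf_labels T')" "addresses T' ! i = x @ v @ [False]" "addresses T' ! Suc i = x @ v @ [True]"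
    by (simp_all add: i_def T' nth_append)
  have len: "length (leaf_labels S') = length (leaf_labels T')" "leaf_labels S' = leaf_labels T'"
    using matching_pairD(3)[OF M'] by simp_all
  have eq: "addresses S' ! j = addresses S ! k @ u"
    if "j < length (leaf_labels T')" "addresses T' ! j = x @ u" for j u
  proof -
    have "\<alpha> (addresses S' ! j @ w) = \<alpha> ((addresses S ! k @ u) @ w)" for w
      using transports_pair[OF M' tr(2) that(1), of w] transports_pair[OF M tr(1) k(1), of "u @ w"] k(2) that(2)
      by simp
    then show ?thesis using sep unfolding separating_def by blast
  qed
  have "addresses S' ! i = (addresses S ! k @ v) @ [False]" "addresses S' ! Suc i = (addresses S ! k @ v) @ [True]"
    using eq[of i "v @ [False]"] eq[of "Suc i" "v @ [True]"] i by auto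
  then obtain e where "([e], [leaf_labels S' ! i, leaf_labels S' ! Suc i]) \<in> carets S'"
    using sibling_caret[of i S'] i len by auto
  moreover obtain e' where "([e'], [leaf_labels T' ! i, leaf_labels T' ! Suc i]) \<in> carets T'"
    using sibling_caret[of i T' "x @ v"] i by auto
  ultimately have "dipole (pair_diagram T' S') [e'] [leaf_labels T' ! i, leaf_labels T' ! Suc i] [e]"
    using len by (auto simp: dipole_def)
  then show False using red by (auto simp: reduced_def)
qed

text \<open>
  Two different trees have a leaf of one above sibling leaves of the other, so the upper trees
  agree; then the transport yields the leaves of the lower trees.
\<close>
lemma reduced_transports_isotopic:
  assumes D: "D \<in> reduced_F_diagrams" and D': "D' \<in> reduced_F_diagrams" and sep: "separating \<alpha>"
    and tr: "transports D \<alpha> \<beta>" "transports D' \<alpha> \<beta>"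
  shows "isotopic D D'"
proof -
  obtain T S where M: "matching_pair T S" "D = pair_diagram T S" using reduced_pair_diagram[OF D] .
  obtain T' S' where M': "matching_pair T' S'" "D' = pair_diagram T' S'" using reduced_pair_diagram[OF D'] .
  have red: "reduced (pair_diagram T S)" "reduced (pair_diagram T' S')"
    using D D' M M' by (auto simp: reduced_F_diagrams_def)
  have shT: "shape T = shape T'"
    using shape_or_refined[of T T'] not_refined_by[OF M(1) M'(1) red(2) sep]
      not_refined_by[OF M'(1) M(1) red(1) sep] tr M M' by auto
  then have aT: "addresses T = addresses T'" by (metis addresses_map)
  then have len: "length (leaf_labels T) = length (leaf_labels T')" by (metis length_addresses)
  have "addresses S = addresses S'"
  proof (rule nth_equalityI)
    show "length (addresses S) = length (addresses S')"
      using len matching_pairD(3)[OF M(1)] matching_pairD(3)[OF M'(1)] by simp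
    fix i assume "i < length (addresses S)"
    then have i: "i < length (leaf_labels T)" "i < length (leaf_labels T')"
      using len matching_pairD(3)[OF M(1)] by simp_all
    have "\<alpha> (addresses S ! i @ w) = \<alpha> (addresses S' ! i @ w)" for w
      using transports_pair[OF M(1) _ i(1), of \<alpha> \<beta> w] transports_pair[OF M'(1) _ i(2), of \<alpha> \<beta> w]
        tr M(2) M'(2) aT by simp
    then show "addresses S ! i = addresses S' ! i" using sep unfolding separating_def by blast
  qed
  then have "shape S = shape S'" by (rule shape_eqI)
  then show ?thesis using isotopic_pair_diagrams[OF M(1) M'(1) shT] M(2) M'(2) by simp
qed

section \<open>Binary words as codes of n-ary intervals\<close>

text \<open>
  The word is read from left to right, \<open>s\<close> being the number of ones read so far in an incomplete code
  of a digit. In phase \<open>s\<close> the current interval consists of the last \<open>n - s\<close> of the \<open>n\<close> parts of a standard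
  interval, whose length is taken as 1: the letter 0 selects the first of these parts, 1 the other ones. The test \<open>s + 2 = n\<close>
  asks whether one more 1 completes the code of the last digit.
\<close>
fun left_end :: "nat \<Rightarrow> nat \<Rightarrow> bool list \<Rightarrow> real" where
  "left_end n s [] = 0"
| "left_end n s (False # w) = left_end n 0 w / real n"
| "left_end n s (True # w) =
     1 / real n + (if s + 2 = n then left_end n 0 w / real n else left_end n (Suc s) w)"

fun phase :: "nat \<Rightarrow> nat \<Rightarrow> bool list \<Rightarrow> nat" where
  "phase n s [] = s"
| "phase n s (False # w) = phase n 0 w"
| "phase n s (True # w) = (if s + 2 = n then phase n 0 w else phase n (Suc s) w)"

fun level :: "nat \<Rightarrow> nat \<Rightarrow> bool list \<Rightarrow> nat" where
  "level n s [] = 0"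
| "level n s (False # w) = Suc (level n 0 w)"
| "level n s (True # w) = (if s + 2 = n then Suc (level n 0 w) else level n (Suc s) w)"

definition width :: "nat \<Rightarrow> nat \<Rightarrow> bool list \<Rightarrow> real" where
  "width n s w = (real n - real (phase n s w)) / real n / real n ^ level n s w"

lemma width_simps:
  "width n s [] = (real n - real s) / real n"
  "width n s (False # w) = width n 0 w / real n"
  "width n s (True # w) = (if s + 2 = n then width n 0 w / real n else width n (Suc s) w)"
  by (auto simp: width_def)

lemma phase_bound: "s + 2 \<le> n \<Longrightarrow> phase n s w + 2 \<le> n"
  by (induction n s w rule: phase.induct) auto

lemma phase_append: "phase n s (x @ y) = phase n (phase n s x) y"
  by (induction n s x rule: phase.induct) auto

lemma level_append: "level n s (x @ y) = level n s x + level n (phase n s x) y"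
  by (induction n s x rule: phase.induct) auto

lemma left_end_append:
  "left_end n s (x @ y) = left_end n s x + left_end n (phase n s x) y / real n ^ level n s x"
  by (induction n s x rule: phase.induct) (auto simp: add_divide_distrib)

lemma width_append: "width n s (x @ y) = width n (phase n s x) y / real n ^ level n s x"
  by (simp add: width_def phase_append level_append power_add)

lemma width_pos: "s + 2 \<le> n \<Longrightarrow> width n s w > 0"
  using phase_bound[of s n w] by (auto simp: width_def)

lemma left_end_nonneg: "0 \<le> left_end n s w"
  by (induction n s w rule: left_end.induct) auto

text \<open>
  Letters only shrink the interval, and \<open>(n - s) / n\<close> is where the interval of the empty word ends.
\<close>
lemma right_end_le: "s + 2 \<le> n \<Longrightarrow> left_end n s w + width n s w \<le> (real n - real s) / real n"
proof (induction n s w rule: left_end.induct)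
  case (1 n s)
  then show ?case by (simp add: width_simps)
next
  case (2 n s w)
  then have "left_end n 0 w + width n 0 w \<le> 1" by simp
  then have "(left_end n 0 w + width n 0 w) / real n \<le> 1 / real n"
    using 2 by (intro divide_right_mono) auto
  also have "\<dots> \<le> (real n - real s) / real n" using 2 by (intro divide_right_mono) auto
  finally show ?case by (simp add: width_simps add_divide_distrib)
next
  case (3 n s w)
  show ?case
  proof (cases "s + 2 = n")
    case True
    then have "left_end n 0 w + width n 0 w \<le> 1" using 3 by simp
    then have "(left_end n 0 w + width n 0 w) / real n \<le> 1 / real n"
      using 3 by (intro divide_right_mono) auto
    moreover have "real s = real n - 2" using True by auto
    then have "(real n - real s) / real n = 1 / real n + 1 / real n" by (simp add: add_divide_distrib[symmetric])
    moreover have "left_end n s (True # w) + width n s (True # w)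
        = 1 / real n + (left_end n 0 w + width n 0 w) / real n"
      using True by (simp add: width_simps add_divide_distrib)
    ultimately show ?thesis by linarith
  next
    case False
    then have "left_end n (Suc s) w + width n (Suc s) w \<le> (real n - real (Suc s)) / real n" using 3 by simp
    moreover have "(real n - real s) / real n = 1 / real n + (real n - real (Suc s)) / real n"
      by (simp add: add_divide_distrib[symmetric])
    ultimately show ?thesis using False by (simp add: width_simps)
  qed
qed

lemma left_end_less_1: "n \<ge> 2 \<Longrightarrow> left_end n 0 w < 1"
  using right_end_le[of 0 n w] width_pos[of 0 n w] by simp

lemma left_end_snoc_False [simp]: "left_end n s (w @ [False]) = left_end n s w"
  by (simp add: left_end_append)

lemma left_end_zeros [simp]: "left_end n s (w @ replicate k False) = left_end n s w"
proof (induction k)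
  case (Suc k)
  have "w @ replicate (Suc k) False = (w @ replicate k False) @ [False]"
    by (simp add: replicate_append_same)
  then show ?case using Suc by (metis left_end_snoc_False)
qed simp

lemma left_end_snoc_True: "n \<ge> 2 \<Longrightarrow> left_end n s (w @ [True]) = left_end n s w + width n s (w @ [False])"
  by (simp add: left_end_append width_append width_simps)

lemma width_split:
  assumes "s + 2 \<le> n"
  shows "width n s (w @ [False]) + width n s (w @ [True]) = width n s w"
proof -
  let ?p = "phase n s w"
  have "?p + 2 \<le> n" using assms phase_bound by blast
  then have "width n ?p [False] + width n ?p [True] = (real n - real ?p) / real n"
    by (auto simp: width_simps field_simps)
  then have "(width n ?p [False] + width n ?p [True]) / real n ^ level n s w = width n s w"
    by (simp add: width_def)
  then show ?thesis by (simp add: width_append add_divide_distrib)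
qed

lemma left_end_snoc_True_pos: "n \<ge> 2 \<Longrightarrow> left_end n s (w @ [True]) > 0"
  using left_end_nonneg[of n s w] by (simp add: left_end_append add_nonneg_pos)

text \<open>
  Words that end in 1 have different left ends: a first letter 0 puts the left end below \<open>1/n\<close>, a first letter 1 does
  not. Without the final 1, the words \<open>w\<close> and \<open>w0\<close> have the same left end.
\<close>
lemma left_end_inj:
  assumes "s + 2 \<le> n" "left_end n s (x @ [True]) = left_end n s (y @ [True])"
  shows "x = y"
  using assms
proof (induction x arbitrary: s y)
  case Nil
  show ?case
  proof (cases y)
    case (Cons b y')
    have "left_end n 0 (y' @ [True]) / real n < 1 / real n"
      using left_end_less_1[of n "y' @ [True]"] Nil by (simp add: divide_strict_right_mono)
    moreover have "left_end n t (y' @ [True]) > 0" for t using left_end_snoc_True_pos Nil by simp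
    ultimately show ?thesis using Nil Cons by (cases b) (auto split: if_splits simp: add_pos_pos order_less_le)
  qed simp
next
  case (Cons a x)
  have n: "n \<ge> 2" using Cons.prems by simp
  have small: "left_end n 0 (z @ [True]) / real n < 1 / real n" for z
    using left_end_less_1[of n "z @ [True]"] n by (simp add: divide_strict_right_mono)
  have pos: "left_end n t (z @ [True]) > 0" for t z using left_end_snoc_True_pos n by simp
  have big: "left_end n s (True # (z @ [True])) \<ge> 1 / real n" for z
    using pos[of 0 z] pos[of "Suc s" z] n by auto
  show ?case
  proof (cases y)
    case Nil
    show ?thesis
    proof (cases a)
      case True
      then show ?thesis using Nil Cons.prems pos[of 0 x] pos[of "Suc s" x] n by (auto split: if_splits)
    next
      case False
      then show ?thesis using Nil Cons.prems small[of x] n by (auto split: if_splits)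
    qed
  next
    case (Cons b z)
    consider "a" "b" | "\<not> a" "\<not> b" | "a" "\<not> b" | "\<not> a" "b" by blast
    then show ?thesis
    proof cases
      case 1
      then have "left_end n (if s + 2 = n then 0 else Suc s) (x @ [True])
          = left_end n (if s + 2 = n then 0 else Suc s) (z @ [True])"
        using Cons Cons.prems n by (auto split: if_splits)
      then show ?thesis using Cons.IH[of "if s + 2 = n then 0 else Suc s" z] Cons.prems(1) Cons 1
        by (auto split: if_splits)
    next
      case 2
      then show ?thesis using Cons.IH[of 0 z] Cons Cons.prems n by auto
    next
      case 3
      then show ?thesis using big[of x] small[of z] Cons Cons.prems by auto
    next
      case 4
      then show ?thesis using big[of z] small[of x] Cons Cons.prems by auto
    qed
  qed
qed

section \<open>n-adic fractions modulo n - 1\<close>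

lemma n_adicI: "x = of_int a / real n ^ k \<Longrightarrow> x \<in> n_adic n"
  by (auto simp: n_adic_def)

lemma n_adic_of_int [simp]: "of_int a \<in> n_adic n"
  by (rule n_adicI[of _ a _ 0]) simp

lemma n_adic_of_nat [simp]: "of_nat a \<in> n_adic n"
  by (rule n_adicI[of _ "int a" _ 0]) simp

lemma n_adic_0 [simp]: "0 \<in> n_adic n" and n_adic_1 [simp]: "1 \<in> n_adic n"
  using n_adic_of_int[of 0 n] n_adic_of_int[of 1 n] by simp_all

lemma n_adic_add:
  assumes "n > 0" "x \<in> n_adic n" "y \<in> n_adic n" shows "x + y \<in> n_adic n"
proof -
  obtain a k b l where *: "x = of_int a / real n ^ k" "y = of_int b / real n ^ l"
    using assms unfolding n_adic_def by blast
  have "x + y = of_int (a * int n ^ l + b * int n ^ k) / real n ^ (k + l)"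
    using assms(1) by (simp add: * power_add field_simps)
  then show ?thesis by (rule n_adicI)
qed

lemma n_adic_mult:
  assumes "n > 0" "x \<in> n_adic n" "y \<in> n_adic n" shows "x * y \<in> n_adic n"
proof -
  obtain a k b l where *: "x = of_int a / real n ^ k" "y = of_int b / real n ^ l"
    using assms unfolding n_adic_def by blast
  have "x * y = of_int (a * b) / real n ^ (k + l)" by (simp add: * power_add)
  then show ?thesis by (rule n_adicI)
qed

lemma n_adic_uminus: "x \<in> n_adic n \<Longrightarrow> - x \<in> n_adic n"
  unfolding n_adic_def by (smt (verit) mem_Collect_eq minus_divide_left of_int_minus)

lemma n_adic_diff: "n > 0 \<Longrightarrow> x \<in> n_adic n \<Longrightarrow> y \<in> n_adic n \<Longrightarrow> x - y \<in> n_adic n"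
  using n_adic_add[of n x "- y"] n_adic_uminus by simp

lemma n_adic_powi: "real n powi k \<in> n_adic n"
proof (cases "k \<ge> 0")
  case True
  then show ?thesis by (intro n_adicI[of _ "int n ^ nat k" _ 0]) (simp add: power_int_def)
next
  case False
  then show ?thesis by (intro n_adicI[of _ 1 _ "nat (- k)"]) (simp add: power_int_def inverse_eq_divide power_one_over)
qed

text \<open>
  Congruence in \<open>\<int>[1/n]\<close> modulo its multiples of \<open>n - 1\<close>. Multiplication by \<open>n\<close> acts trivially on
  the quotient, which is \<open>\<int>/(n - 1)\<close>.
\<close>
definition residue_eq :: "nat \<Rightarrow> real \<Rightarrow> real \<Rightarrow> bool" where
  "residue_eq n x y \<longleftrightarrow> (x - y) / (real n - 1) \<in> n_adic n"

lemma residue_eq_refl [simp]: "residue_eq n x x"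
  by (simp add: residue_eq_def)

lemma residue_eq_sym: "residue_eq n x y \<Longrightarrow> residue_eq n y x"
  unfolding residue_eq_def using n_adic_uminus by (metis minus_diff_eq minus_divide_left)

lemma residue_eq_trans: "n \<ge> 2 \<Longrightarrow> residue_eq n x y \<Longrightarrow> residue_eq n y z \<Longrightarrow> residue_eq n x z"
  unfolding residue_eq_def using n_adic_add[of n "(x - y) / (real n - 1)" "(y - z) / (real n - 1)"]
  by (simp add: add_divide_distrib[symmetric])

lemma residue_eq_add:
  "n > 0 \<Longrightarrow> residue_eq n x y \<Longrightarrow> residue_eq n x' y' \<Longrightarrow> residue_eq n (x + x') (y + y')"
  unfolding residue_eq_def using n_adic_add[of n "(x - y) / (real n - 1)" "(x' - y') / (real n - 1)"]
  by (simp add: add_divide_distrib[symmetric] algebra_simps)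

lemma residue_eq_diff:
  assumes "n > 0" "residue_eq n x y" "residue_eq n x' y'" shows "residue_eq n (x - x') (y - y')"
proof -
  have "residue_eq n (- x') (- y')"
    using residue_eq_sym[OF assms(3)] by (simp add: residue_eq_def)
  then show ?thesis using residue_eq_add[OF assms(1,2)] by fastforce
qed

lemma residue_eq_div_n:
  assumes "n \<ge> 2" "x \<in> n_adic n" shows "residue_eq n (x / real n) x"
proof -
  have "(x / real n - x) / (real n - 1) = - x / real n"
    using assms(1) by (simp add: field_simps)
  moreover have "- x / real n \<in> n_adic n"
    using n_adic_mult[OF _ n_adic_uminus[OF assms(2)] n_adic_powi[of n "-1"]] assms(1)
    by (simp add: power_int_minus divide_inverse)
  ultimately show ?thesis by (simp add: residue_eq_def)
qed

lemma n_adic_div_n: "n > 0 \<Longrightarrow> x \<in> n_adic n \<Longrightarrow> x / real n \<in> n_adic n"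
  using n_adic_mult[OF _ _ n_adic_powi[of n "-1"], of x] by (simp add: power_int_minus divide_inverse)

lemma n_adic_div_power: "n > 0 \<Longrightarrow> x \<in> n_adic n \<Longrightarrow> x / real n ^ k \<in> n_adic n"
proof (induction k)
  case (Suc k)
  then show ?case using n_adic_div_n[of n "x / real n ^ k"] by (simp add: mult.commute)
qed simp

lemma residue_eq_div_power:
  assumes "n \<ge> 2" "x \<in> n_adic n" shows "residue_eq n (x / real n ^ k) x"
proof (induction k)
  case (Suc k)
  have "residue_eq n (x / real n ^ k / real n) (x / real n ^ k)"
    by (rule residue_eq_div_n[OF assms(1) n_adic_div_power]) (use assms in simp_all)
  then have "residue_eq n (x / real n ^ k / real n) x"
    using residue_eq_trans[OF assms(1)] Suc by blast
  then show ?case by (simp add: mult.commute)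
qed simp

lemma residue_eq_powi_mult:
  assumes "n \<ge> 2" "x \<in> n_adic n" shows "residue_eq n (real n powi k * x) x"
proof (cases "k \<ge> 0")
  case True
  have y: "real n powi k * x \<in> n_adic n" using n_adic_mult n_adic_powi assms by simp
  have "real n powi k * x / real n ^ nat k = x" using True assms(1) by (simp add: power_int_def)
  then show ?thesis using residue_eq_div_power[OF assms(1) y, of "nat k"] residue_eq_sym by metis
next
  case False
  then have "real n powi k * x = x / real n ^ nat (- k)"
    by (simp add: power_int_def divide_inverse power_inverse mult.commute)
  then show ?thesis using residue_eq_div_power[OF assms] by simp
qed

text \<open>
  No power of \<open>n\<close> has a common factor with \<open>n - 1\<close>, so denominators do not create new congruences
  between integers.
\<close>
lemma residue_eq_of_int:
  assumes "n \<ge> 2"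
  shows "residue_eq n (of_int i) (of_int j) \<longleftrightarrow> int (n - 1) dvd i - j"
proof
  assume "residue_eq n (of_int i) (of_int j)"
  then obtain a k where "(of_int i - of_int j) / (real n - 1) = of_int a / real n ^ k"
    unfolding residue_eq_def n_adic_def by blast
  then have "(of_int i - of_int j) * real n ^ k = of_int a * (real n - 1)"
    using assms by (simp add: field_simps)
  moreover have n1: "real_of_int (int (n - 1)) = real n - 1" using assms by (simp add: of_nat_diff)
  have "of_int (a * int (n - 1)) = (of_int a * (real n - 1) :: real)" unfolding of_int_mult n1 ..
  moreover have "of_int ((i - j) * int n ^ k) = ((of_int i - of_int j) * real n ^ k :: real)" by simp
  ultimately have "of_int ((i - j) * int n ^ k) = (of_int (a * int (n - 1)) :: real)" by metis
  then have "(i - j) * int n ^ k = a * int (n - 1)" using of_int_eq_iff by blast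
  then have "int (n - 1) dvd (i - j) * int n ^ k" by simp
  moreover have "coprime (int (n - 1)) (int n ^ k)"
  proof -
    have "coprime (n - 1) n" by (rule coprime_diff_one_left_nat) (use assms in simp)
    then show ?thesis by simp
  qed
  ultimately show "int (n - 1) dvd i - j" using coprime_dvd_mult_left_iff by blast
next
  assume "int (n - 1) dvd i - j"
  then obtain a where a: "i - j = int (n - 1) * a" by blast
  have "of_int i - of_int j = (of_int (int (n - 1) * a) :: real)" using a by (metis of_int_diff)
  then have "(of_int i - of_int j) / (real n - 1) = of_int a"
    using assms by (simp add: of_nat_diff)
  then show "residue_eq n (of_int i) (of_int j)" by (simp add: residue_eq_def)
qed

definition ones :: "bool list \<Rightarrow> nat" where
  "ones w = length (filter (\<lambda>b. b) w)"

lemma ones_simps [simp]: "ones [] = 0" "ones (False # w) = ones w" "ones (True # w) = Suc (ones w)"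
  "ones (u @ w) = ones u + ones w"
  by (simp_all add: ones_def)

lemma left_end_n_adic: "n \<ge> 2 \<Longrightarrow> left_end n s w \<in> n_adic n"
  by (induction n s w rule: left_end.induct)
    (auto intro!: n_adic_div_n n_adic_add)

text \<open>
  Each letter 1 moves the left end by a power of \<open>1/n\<close>, which is congruent to 1.
\<close>
lemma left_end_residue: "n \<ge> 2 \<Longrightarrow> residue_eq n (left_end n s w) (real (ones w))"
proof (induction n s w rule: left_end.induct)
  case (2 n s w)
  then have "residue_eq n (left_end n 0 w / real n) (left_end n 0 w)"
    using residue_eq_div_n left_end_n_adic by blast
  moreover have "residue_eq n (left_end n 0 w) (real (ones w))" using 2 by simp
  ultimately show ?case using residue_eq_trans[OF 2(2)] by simp
next
  case (3 n s w)
  have 1: "residue_eq n (1 / real n) 1" using residue_eq_div_n[of n 1] 3 by simp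
  have "residue_eq n (if s + 2 = n then left_end n 0 w / real n else left_end n (Suc s) w) (real (ones w))"
  proof (cases "s + 2 = n")
    case True
    then have "residue_eq n (left_end n 0 w / real n) (left_end n 0 w)"
      using residue_eq_div_n left_end_n_adic 3 by blast
    moreover have "residue_eq n (left_end n 0 w) (real (ones w))" using 3 True by simp
    ultimately have "residue_eq n (left_end n 0 w / real n) (real (ones w))"
      using residue_eq_trans[OF 3(3)] by blast
    then show ?thesis using True by simp
  next
    case False
    then show ?thesis using 3 by simp
  qed
  then have "residue_eq n (left_end n s (True # w)) (1 + real (ones w))"
    using residue_eq_add[OF _ 1] 3 by simp
  then show ?case by simp
qed simp

lemma residue_eq_ones:
  assumes "n \<ge> 2" "residue_eq n (left_end n s w) (left_end n s' w')"
  shows "ones w mod (n - 1) = ones w' mod (n - 1)"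
proof -
  have "residue_eq n (real (ones w)) (left_end n s' w')"
    using residue_eq_trans[OF assms(1) residue_eq_sym[OF left_end_residue[OF assms(1)]] assms(2)] .
  then have "residue_eq n (real (ones w)) (real (ones w'))"
    using residue_eq_trans[OF assms(1) _ left_end_residue[OF assms(1)]] by blast
  then have "int (n - 1) dvd int (ones w) - int (ones w')"
    using residue_eq_of_int[OF assms(1), of "int (ones w)" "int (ones w')"] by simp
  then have "int (ones w) mod int (n - 1) = int (ones w') mod int (n - 1)" by (simp add: mod_eq_dvd_iff)
  then show ?thesis by (metis of_nat_eq_iff zmod_int)
qed

lemma ones_residue_eq:
  assumes "n \<ge> 2" "ones w mod (n - 1) = ones w' mod (n - 1)"
  shows "residue_eq n (left_end n s w) (left_end n s' w')"
proof -
  have "int (ones w) mod int (n - 1) = int (ones w') mod int (n - 1)" using assms(2) by (metis zmod_int)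
  then have "int (n - 1) dvd int (ones w) - int (ones w')" by (simp add: mod_eq_dvd_iff)
  then have "residue_eq n (real (ones w)) (real (ones w'))"
    using residue_eq_of_int[OF assms(1), of "int (ones w)" "int (ones w')"] by simp
  then have "residue_eq n (real (ones w)) (left_end n s' w')"
    using residue_eq_trans[OF assms(1) _ residue_eq_sym[OF left_end_residue[OF assms(1)]]] by blast
  then show ?thesis using residue_eq_trans[OF assms(1) left_end_residue[OF assms(1)]] by blast
qed

lemma width_residue:
  assumes "n \<ge> 2" "s + 2 \<le> n"
  shows "residue_eq n (width n s w) (1 - real (phase n s w))"
proof -
  let ?x = "real n - real (phase n s w)"
  have x: "?x \<in> n_adic n" using n_adic_diff assms by simp
  have "residue_eq n (?x / real n / real n ^ level n s w) (?x / real n)"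
    by (rule residue_eq_div_power[OF assms(1) n_adic_div_n]) (use assms x in simp_all)
  moreover have "residue_eq n (?x / real n) ?x" using residue_eq_div_n x assms by simp
  moreover have "residue_eq n ?x (1 - real (phase n s w))"
    using assms by (simp add: residue_eq_def)
  ultimately show ?thesis unfolding width_def using residue_eq_trans[OF assms(1)] by blast
qed

text \<open>
  The residue of the width detects phase 0, because phases are smaller than \<open>n - 1\<close>.
\<close>
lemma width_residue_phase:
  assumes "n \<ge> 2" "residue_eq n (width n 0 w) (width n 0 w')" "phase n 0 w = 0"
  shows "phase n 0 w' = 0"
proof -
  have "residue_eq n (1 - real (phase n 0 w')) 1"
  proof -
    have 1: "residue_eq n (width n 0 w) 1" using width_residue[of n 0 w] assms(1,3) by simp
    have 2: "residue_eq n (1 - real (phase n 0 w')) (width n 0 w')"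
      using residue_eq_sym[OF width_residue[of n 0 w']] assms(1) by simp
    show ?thesis
      using residue_eq_trans[OF assms(1) residue_eq_trans[OF assms(1) 2 residue_eq_sym[OF assms(2)]] 1] .
  qed
  then have "int (n - 1) dvd (1 - int (phase n 0 w')) - 1"
    using residue_eq_of_int[OF assms(1), of "1 - int (phase n 0 w')" 1] by simp
  then have "n - 1 dvd phase n 0 w'" by simp
  moreover have "phase n 0 w' < n - 1" using phase_bound[of 0 n w'] assms(1) by auto
  ultimately show ?thesis by (metis dvd_imp_le not_le gr0I)
qed

lemma width_phase_0: "n \<ge> 2 \<Longrightarrow> phase n 0 w = 0 \<Longrightarrow> width n 0 w = 1 / real n ^ level n 0 w"
  by (simp add: width_def)

section \<open>Words of the standard intervals\<close>

lemma digit_word: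
  assumes "n \<ge> 2" "d < n"
  shows "\<exists>u. phase n 0 u = 0 \<and> level n 0 u = 1 \<and> left_end n 0 u = real d / real n"
proof -
  have ones: "s + d + 2 \<le> n \<Longrightarrow> phase n s (replicate d True @ [False]) = 0 \<and>
      level n s (replicate d True @ [False]) = 1 \<and>
      left_end n s (replicate d True @ [False]) = real d / real n" for s d
    by (induction d arbitrary: s) (auto simp: add_divide_distrib)
  have last: "s + d + 1 = n \<Longrightarrow> d > 0 \<Longrightarrow> phase n s (replicate d True) = 0 \<and>
      level n s (replicate d True) = 1 \<and> left_end n s (replicate d True) = real d / real n" for s d
  proof (induction d arbitrary: s)
    case (Suc d)
    then show ?case by (cases "d = 0") (auto simp: add_divide_distrib)
  qed simp
  show ?thesis
  proof (cases "d + 2 \<le> n")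
    case True
    then show ?thesis using ones[of 0 d] by auto
  next
    case False
    then show ?thesis using last[of 0 d] assms by auto
  qed
qed

lemma standard_word:
  assumes "n \<ge> 2" "b < n ^ l"
  shows "\<exists>w. phase n 0 w = 0 \<and> level n 0 w = l \<and> left_end n 0 w = real b / real n ^ l"
  using assms(2)
proof (induction l arbitrary: b)
  case 0
  then show ?case by (intro exI[of _ "[]"]) simp
next
  case (Suc l)
  define d b' where "d = b div n ^ l" and "b' = b mod n ^ l"
  have "n ^ l > 0" using assms(1) by simp
  have "d < n" using Suc.prems by (simp add: d_def less_mult_imp_div_less mult.commute)
  then obtain u where u: "phase n 0 u = 0" "level n 0 u = 1" "left_end n 0 u = real d / real n"
    using digit_word assms(1) by blast
  have "b' < n ^ l" using \<open>n ^ l > 0\<close> by (simp add: b'_def)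
  then obtain w where w: "phase n 0 w = 0" "level n 0 w = l" "left_end n 0 w = real b' / real n ^ l"
    using Suc.IH by blast
  have "b = d * n ^ l + b'" unfolding d_def b'_def by (rule div_mult_mod_eq[symmetric])
  then have "real b = real d * real n ^ l + real b'" by (metis of_nat_add of_nat_mult of_nat_power)
  then have "real b / real n ^ Suc l = real d / real n + real b' / real n ^ l / real n"
    using assms(1) by (simp add: field_simps)
  then show ?case using u w
    by (intro exI[of _ "u @ w"]) (simp add: phase_append level_append left_end_append)
qed

section \<open>The groups of piecewise linear maps\<close>

lemma carrier_F_group:
  "f \<in> carrier (F_group n) \<longleftrightarrow> f \<in> extensional {0..1} \<and> (\<exists>g. homeomorphism {0..1} {0..1} f g) \<and>
     strict_mono_on {0..1} f \<and> n_adic_piecewise_linear n f"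
  by (simp add: F_group_def)

lemma F_group_basic:
  assumes "f \<in> carrier (F_group n)"
  shows "f ` {0..1} = {0..1}" "continuous_on {0..1} f" "strict_mono_on {0..1} f" "f 0 = 0" "f 1 = 1"
proof -
  obtain g where h: "homeomorphism {0..1} {0..1} f g" using assms by (auto simp: carrier_F_group)
  show im: "f ` {0..1} = {0..1}" and "continuous_on {0..1} f" using h by (auto simp: homeomorphism_def)
  show sm: "strict_mono_on {0..1} f" using assms by (simp add: carrier_F_group)
  have mono: "f x \<le> f y" if "x \<in> {0..1}" "y \<in> {0..1}" "x \<le> y" for x y
    using sm that by (metis le_less strict_mono_onD)
  have in01: "f x \<in> {0..1}" if "x \<in> {0..1}" for x using im that by blast
  obtain x where x: "x \<in> {0..1}" "f x = 0" using im by (metis atLeastAtMost_iff imageE order_refl zero_le_one)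
  obtain y where y: "y \<in> {0..1}" "f y = 1" using im by (metis atLeastAtMost_iff imageE order_refl zero_le_one)
  show "f 0 = 0" using mono[of 0 x] in01[of 0] x by auto
  show "f 1 = 1" using mono[of y 1] in01[of 1] y by auto
qed

lemma F_group_range: "f \<in> carrier (F_group n) \<Longrightarrow> x \<in> {0..1} \<Longrightarrow> f x \<in> {0..1}"
  using F_group_basic(1) by blast

definition subdivision :: "nat \<Rightarrow> (real \<Rightarrow> real) \<Rightarrow> real list \<Rightarrow> bool" where
  "subdivision n f xs \<longleftrightarrow> xs \<noteq> [] \<and> sorted_wrt (<) xs \<and> hd xs = 0 \<and> last xs = 1 \<and> set xs \<subseteq> n_adic n \<and>
     (\<forall>i. Suc i < length xs \<longrightarrow>
        (\<exists>(k :: int) c. \<forall>x\<in>{xs ! i..xs ! Suc i}. f x = real n powi k * x + c))"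

lemma piecewise_iff_subdivision: "n_adic_piecewise_linear n f \<longleftrightarrow> (\<exists>xs. subdivision n f xs)"
  by (simp add: n_adic_piecewise_linear_def subdivision_def)

lemma sorted_locate:
  fixes xs :: "real list"
  assumes "sorted_wrt (<) xs" "xs \<noteq> []" "hd xs \<le> a" "a < b" "b \<le> last xs" "set xs \<inter> {a<..<b} = {}"
  shows "\<exists>i. Suc i < length xs \<and> xs ! i \<le> a \<and> b \<le> xs ! Suc i"
  using assms
proof (induction xs)
  case (Cons x ys)
  show ?case
  proof (cases "ys = []")
    case True
    then show ?thesis using Cons.prems by auto
  next
    case False
    show ?thesis
    proof (cases "hd ys \<le> a")
      case True
      then obtain i where "Suc i < length ys \<and> ys ! i \<le> a \<and> b \<le> ys ! Suc i"
        using Cons False by auto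
      then show ?thesis by (intro exI[of _ "Suc i"]) auto
    next
      case n: False
      have "hd ys \<in> set (x # ys)" using False by simp
      then have "b \<le> hd ys" using Cons.prems(6) n by (metis disjoint_iff greaterThanLessThan_iff not_le)
      then show ?thesis using Cons.prems(3) False by (intro exI[of _ 0]) (auto simp: hd_conv_nth)
    qed
  qed
qed simp

definition affine_on :: "nat \<Rightarrow> (real \<Rightarrow> real) \<Rightarrow> real \<Rightarrow> real \<Rightarrow> bool" where
  "affine_on n f a b \<longleftrightarrow> (\<exists>(k :: int) c. \<forall>x\<in>{a..b}. f x = real n powi k * x + c)"

text \<open>
  A description by a set of breaks is easier to handle than one by a list: for products
  and inverses the sets of breaks are obtained by images and unions.
\<close>
definition breaks_in :: "nat \<Rightarrow> (real \<Rightarrow> real) \<Rightarrow> real set \<Rightarrow> bool" where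
  "breaks_in n f B \<longleftrightarrow> finite B \<and> B \<subseteq> n_adic n \<and>
     (\<forall>a b. 0 \<le> a \<and> a < b \<and> b \<le> 1 \<and> B \<inter> {a<..<b} = {} \<longrightarrow> affine_on n f a b)"

lemma piecewise_iff_breaks: "n_adic_piecewise_linear n f \<longleftrightarrow> (\<exists>B. breaks_in n f B)"
proof
  assume "n_adic_piecewise_linear n f"
  then obtain xs where xs: "subdivision n f xs" by (auto simp: piecewise_iff_subdivision)
  have "breaks_in n f (set xs)"
    unfolding breaks_in_def
  proof (intro conjI allI impI)
    fix a b :: real assume ab: "0 \<le> a \<and> a < b \<and> b \<le> 1 \<and> set xs \<inter> {a<..<b} = {}"
    then obtain i where i: "Suc i < length xs" "xs ! i \<le> a" "b \<le> xs ! Suc i"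
      using sorted_locate[of xs a b] xs unfolding subdivision_def by auto
    obtain k :: int and c where "\<forall>x\<in>{xs ! i..xs ! Suc i}. f x = real n powi k * x + c"
      using xs i(1) unfolding subdivision_def by blast
    then have "\<forall>x\<in>{a..b}. f x = real n powi k * x + c" using i(2,3) by auto
    then show "affine_on n f a b" unfolding affine_on_def by blast
  qed (use xs in \<open>auto simp: subdivision_def\<close>)
  then show "\<exists>B. breaks_in n f B" by blast
next
  assume "\<exists>B. breaks_in n f B"
  then obtain B where B: "breaks_in n f B" by blast
  define C where "C = insert 0 (insert 1 (B \<inter> {0..1}))"
  have fin: "finite C" using B by (simp add: C_def breaks_in_def)
  define xs where "xs = sorted_list_of_set C"
  have xs: "sorted_wrt (<) xs" "set xs = C" using fin by (simp_all add: xs_def)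
  then have ne: "xs \<noteq> []" by (auto simp: C_def)
  have C01: "C \<subseteq> {0..1}" by (auto simp: C_def)
  have nth_in: "xs ! i \<in> {0..1}" if "i < length xs" for i using that xs(2) C01 nth_mem by blast
  have mono: "xs ! i < xs ! j" if "i < j" "j < length xs" for i j
    using that xs(1) by (simp add: sorted_wrt_nth_less)
  have hd: "hd xs = 0"
  proof -
    obtain i where i: "i < length xs" "xs ! i = 0" using xs(2) by (metis C_def in_set_conv_nth insertI1)
    have "i = 0" using mono[of 0 i] i nth_in[of 0] ne by (cases i) auto
    then show ?thesis using i ne by (simp add: hd_conv_nth)
  qed
  have last: "last xs = 1"
  proof -
    obtain i where i: "i < length xs" "xs ! i = 1" using xs(2) by (metis C_def in_set_conv_nth insertI1 insertI2)
    have "i = length xs - 1"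
    proof (rule ccontr)
      assume "i \<noteq> length xs - 1"
      then have "i < length xs - 1" "length xs - 1 < length xs" using i(1) ne by auto
      then show False using mono[of i "length xs - 1"] i(2) nth_in[of "length xs - 1"] by simp
    qed
    then show ?thesis using i ne by (simp add: last_conv_nth)
  qed
  have "subdivision n f xs"
    unfolding subdivision_def
  proof (intro conjI allI impI)
    show "set xs \<subseteq> n_adic n" using B xs(2) by (auto simp: C_def breaks_in_def)
    fix i assume i: "Suc i < length xs"
    have "C \<inter> {xs ! i<..<xs ! Suc i} = {}"
    proof (rule Int_emptyI)
      fix y assume "y \<in> C" "y \<in> {xs ! i<..<xs ! Suc i}"
      then obtain j where j: "j < length xs" "xs ! i < xs ! j" "xs ! j < xs ! Suc i"
        using xs(2) by (metis greaterThanLessThan_iff in_set_conv_nth)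
      have "\<not> j \<le> i" using j mono[of j i] i by (cases "j = i") auto
      moreover have "\<not> Suc i \<le> j" using j mono[of "Suc i" j] by (cases "j = Suc i") auto
      ultimately show False by simp
    qed
    moreover have "0 \<le> xs ! i" "xs ! Suc i \<le> 1" using nth_in[of i] nth_in[of "Suc i"] i by auto
    moreover have "B \<inter> {xs ! i<..<xs ! Suc i} \<subseteq> C \<inter> {xs ! i<..<xs ! Suc i}"
      using calculation(2,3) by (auto simp: C_def)
    ultimately have "affine_on n f (xs ! i) (xs ! Suc i)"
      using B mono[of i "Suc i"] i unfolding breaks_in_def by blast
    then show "\<exists>(k :: int) c. \<forall>x\<in>{xs ! i..xs ! Suc i}. f x = real n powi k * x + c"
      unfolding affine_on_def .
  qed (use xs ne hd last in auto)
  then show "n_adic_piecewise_linear n f" by (auto simp: piecewise_iff_subdivision)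
qed

lemma affine_step:
  assumes n: "n \<ge> 2" and f: "\<forall>x\<in>{a..b}. f x = real n powi k * x + c"
    and a: "a \<in> n_adic n" "f a \<in> n_adic n" "residue_eq n (f a) a" and x: "x \<in> {a..b}" "x \<in> n_adic n"
  shows "f x \<in> n_adic n \<and> residue_eq n (f x) x"
proof -
  have fx: "f x = f a + real n powi k * (x - a)"
    using f x(1) by (auto simp: algebra_simps)
  have d: "x - a \<in> n_adic n" using n_adic_diff x(2) a(1) n by simp
  have "f x \<in> n_adic n"
    unfolding fx using n by (intro n_adic_add n_adic_mult a d n_adic_powi) auto
  moreover have "residue_eq n (f x) (a + (x - a))"
    unfolding fx using n by (intro residue_eq_add a(3) residue_eq_powi_mult d) auto
  ultimately show ?thesis by simp
qed

text \<open>
  On a linear piece the differences of values are the differences of arguments times a power of \<open>n\<close>,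
  hence congruent to them. Starting at \<open>f 0 = 0\<close>, this propagates from one break to the next.
\<close>
lemma F_group_n_adic:
  assumes n: "n \<ge> 2" and f: "f \<in> carrier (F_group n)" and x: "x \<in> {0..1}" "x \<in> n_adic n"
  shows "f x \<in> n_adic n" "residue_eq n (f x) x"
proof -
  obtain xs where xs: "subdivision n f xs"
    using f by (auto simp: carrier_F_group piecewise_iff_subdivision)
  have nth: "f (xs ! i) \<in> n_adic n \<and> residue_eq n (f (xs ! i)) (xs ! i)" if "i < length xs" for i
    using that
  proof (induction i)
    case 0
    then show ?case using xs F_group_basic(4)[OF f] by (simp add: subdivision_def hd_conv_nth)
  next
    case (Suc i)
    obtain k :: int and c where kc: "\<forall>x\<in>{xs ! i..xs ! Suc i}. f x = real n powi k * x + c"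
      using xs Suc.prems unfolding subdivision_def by blast
    have "xs ! i < xs ! Suc i" using xs Suc.prems by (simp add: subdivision_def sorted_wrt_nth_less)
    moreover have "xs ! i \<in> n_adic n" "xs ! Suc i \<in> n_adic n"
      using xs Suc.prems unfolding subdivision_def by (meson Suc_lessD nth_mem subsetD)+
    ultimately show ?case using affine_step[OF n kc] Suc by simp
  qed
  have "f x \<in> n_adic n \<and> residue_eq n (f x) x"
  proof (cases "x = 1")
    case True
    then show ?thesis using F_group_basic(5)[OF f] by simp
  next
    case False
    \<comment> \<open>Up to the next break, or up to 1, there is a nondegenerate interval to the right of \<open>x\<close> that
      lies in one linear piece.\<close>
    obtain e where e: "e > 0" "x + e \<le> 1" "set xs \<inter> {x<..<x + e} = {}"
    proof -
      have "finite (insert 1 (set xs \<inter> {x<..}))" by simp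
      moreover have "insert 1 (set xs \<inter> {x<..}) \<noteq> {}" by simp
      ultimately have m: "Min (insert 1 (set xs \<inter> {x<..})) \<in> insert 1 (set xs \<inter> {x<..})"
        "\<And>y. y \<in> insert 1 (set xs \<inter> {x<..}) \<Longrightarrow> Min (insert 1 (set xs \<inter> {x<..})) \<le> y"
        by (metis Min_in, metis Min_le)
      let ?m = "Min (insert 1 (set xs \<inter> {x<..}))"
      have "?m > x" using m(1) x(1) False by auto
      then show ?thesis using that[of "?m - x"] m(2) by force
    qed
    then obtain i where i: "Suc i < length xs" "xs ! i \<le> x" "x + e \<le> xs ! Suc i"
      using sorted_locate[of xs x "x + e"] xs x unfolding subdivision_def by auto
    obtain k :: int and c where kc: "\<forall>x\<in>{xs ! i..xs ! Suc i}. f x = real n powi k * x + c"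
      using xs i(1) unfolding subdivision_def by blast
    have "xs ! i \<in> n_adic n" using xs i unfolding subdivision_def by (meson Suc_lessD nth_mem subsetD)
    then show ?thesis using affine_step[OF n kc] nth[of i] i e x by simp
  qed
  then show "f x \<in> n_adic n" "residue_eq n (f x) x" by auto
qed

lemma F_group_inverse:
  assumes n: "n \<ge> 2" and f: "f \<in> carrier (F_group n)"
  shows "\<exists>g\<in>carrier (F_group n). \<forall>x\<in>{0..1}. g (f x) = x \<and> f (g x) = x"
proof -
  obtain g0 where h: "homeomorphism {0..1} {0..1} f g0" using f by (auto simp: carrier_F_group)
  define g where "g = restrict g0 {0..1}"
  have "homeomorphism {0..1} {0..1} g0 f" using h homeomorphism_symD by blast
  then have hg: "homeomorphism {0..1} {0..1} g f"
    by (rule homeomorphism_cong) (auto simp: g_def)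
  have gf: "g (f x) = x" "f (g x) = x" "g x \<in> {0..1}" if "x \<in> {0..1}" for x
    using hg that unfolding homeomorphism_def by auto
  note sm = F_group_basic(3)[OF f]
  have smg: "g x < g y" if "x \<in> {0..1}" "y \<in> {0..1}" "x < y" for x y
  proof (rule ccontr)
    assume "\<not> g x < g y"
    then consider "g y < g x" | "g y = g x" by linarith
    then have "f (g y) \<le> f (g x)"
      using strict_mono_onD[OF sm gf(3)[OF that(2)] gf(3)[OF that(1)]] by cases auto
    then show False using gf(2)[OF that(1)] gf(2)[OF that(2)] that(3) by simp
  qed
  obtain B where B: "breaks_in n f B" using f by (auto simp: carrier_F_group piecewise_iff_breaks)
  define C where "C = f ` (B \<inter> {0..1})"
  have "breaks_in n g C"
    unfolding breaks_in_def
  proof (intro conjI allI impI)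
    show "finite C" using B by (simp add: C_def breaks_in_def)
    show "C \<subseteq> n_adic n" using B F_group_n_adic[OF n f] by (auto simp: C_def breaks_in_def)
    fix a b :: real assume ab: "0 \<le> a \<and> a < b \<and> b \<le> 1 \<and> C \<inter> {a<..<b} = {}"
    have gab: "0 \<le> g a" "g a < g b" "g b \<le> 1" using gf(3)[of a] gf(3)[of b] smg[of a b] ab by auto
    have "B \<inter> {g a<..<g b} = {}"
    proof (rule Int_emptyI)
      fix y assume y: "y \<in> B" "y \<in> {g a<..<g b}"
      then have y01: "y \<in> {0..1}" using gab by auto
      have "f (g a) < f y" "f y < f (g b)"
        using strict_mono_onD[OF sm, of "g a" y] strict_mono_onD[OF sm, of y "g b"] y y01 gab by auto
      then have "f y \<in> {a<..<b}" using gf(2)[of a] gf(2)[of b] ab by simp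
      moreover have "f y \<in> C" using y(1) y01 by (simp add: C_def)
      ultimately show False using ab by (metis disjoint_iff)
    qed
    then have "affine_on n f (g a) (g b)" using B gab unfolding breaks_in_def by blast
    then obtain k :: int and c where kc: "\<forall>x\<in>{g a..g b}. f x = real n powi k * x + c"
      unfolding affine_on_def by blast
    have "\<forall>y\<in>{a..b}. g y = real n powi (- k) * y + (- c * real n powi (- k))"
    proof
      fix y assume y: "y \<in> {a..b}"
      then have y01: "y \<in> {0..1}" using ab by auto
      have "g y \<in> {g a..g b}" using smg[of a y] smg[of y b] y y01 ab by (cases "y = a"; cases "y = b") auto
      then have "y = real n powi k * g y + c" using kc gf(2)[OF y01] by metis
      then have "real n powi (- k) * (y - c) = real n powi (- k) * real n powi k * g y" by simp
      also have "real n powi (- k) * real n powi k = 1" using n by (simp add: power_int_minus)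
      finally show "g y = real n powi (- k) * y + (- c * real n powi (- k))" by (simp add: algebra_simps)
    qed
    then show "affine_on n g a b" unfolding affine_on_def by blast
  qed
  moreover have "strict_mono_on {0..1} g" using smg by (auto simp: strict_mono_on_def)
  ultimately have "g \<in> carrier (F_group n)"
    using hg by (auto simp: carrier_F_group piecewise_iff_breaks g_def)
  then show ?thesis using gf by blast
qed

lemma F_group_compose:
  assumes n: "n \<ge> 2" and f: "f \<in> carrier (F_group n)" and g: "g \<in> carrier (F_group n)"
  shows "compose {0..1} g f \<in> carrier (F_group n)"
proof -
  let ?h = "compose {0..1} g f"
  have hx: "?h x = g (f x)" if "x \<in> {0..1}" for x using that by (simp add: compose_def)
  note f01 = F_group_range[OF f] and smf = F_group_basic(3)[OF f] and smg = F_group_basic(3)[OF g]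
  obtain f' g' where h: "homeomorphism {0..1} {0..1} f f'" "homeomorphism {0..1} {0..1} g g'"
    using f g by (auto simp: carrier_F_group)
  have "homeomorphism {0..1} {0..1} ?h (f' \<circ> g')"
    by (rule homeomorphism_cong[OF homeomorphism_compose[OF h]]) (auto simp: compose_def)
  moreover have "strict_mono_on {0..1} ?h"
    using strict_mono_onD[OF smf] strict_mono_onD[OF smg] f01 hx by (auto simp: strict_mono_on_def)
  moreover have "n_adic_piecewise_linear n ?h"
  proof -
    obtain Bf where Bf: "breaks_in n f Bf" using f by (auto simp: carrier_F_group piecewise_iff_breaks)
    obtain Bg where Bg: "breaks_in n g Bg" using g by (auto simp: carrier_F_group piecewise_iff_breaks)
    obtain e where e: "e \<in> carrier (F_group n)" "\<forall>x\<in>{0..1}. e (f x) = x \<and> f (e x) = x"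
      using F_group_inverse[OF n f] by blast
    define B where "B = Bf \<union> e ` (Bg \<inter> {0..1})"
    have "breaks_in n ?h B"
      unfolding breaks_in_def
    proof (intro conjI allI impI)
      show "finite B" using Bf Bg by (simp add: B_def breaks_in_def)
      show "B \<subseteq> n_adic n" using Bf Bg F_group_n_adic[OF n e(1)] by (auto simp: B_def breaks_in_def)
      fix a b :: real assume ab: "0 \<le> a \<and> a < b \<and> b \<le> 1 \<and> B \<inter> {a<..<b} = {}"
      then have "affine_on n f a b" using Bf unfolding breaks_in_def B_def by blast
      then obtain k :: int and c where kc: "\<forall>x\<in>{a..b}. f x = real n powi k * x + c"
        unfolding affine_on_def by blast
      have fab: "0 \<le> f a" "f a < f b" "f b \<le> 1"
        using f01[of a] f01[of b] strict_mono_onD[OF smf, of a b] ab by auto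
      have "Bg \<inter> {f a<..<f b} = {}"
      proof (rule Int_emptyI)
        fix y assume y: "y \<in> Bg" "y \<in> {f a<..<f b}"
        then have y01: "y \<in> {0..1}" using fab by auto
        have "e (f a) < e y" "e y < e (f b)"
          using strict_mono_onD[OF F_group_basic(3)[OF e(1)], of "f a" y]
            strict_mono_onD[OF F_group_basic(3)[OF e(1)], of y "f b"] y y01 fab by auto
        then have "e y \<in> {a<..<b}" using e(2) ab by simp
        moreover have "e y \<in> B" using y(1) y01 by (simp add: B_def)
        ultimately show False using ab by (metis disjoint_iff)
      qed
      then have "affine_on n g (f a) (f b)" using Bg fab unfolding breaks_in_def by blast
      then obtain k' :: int and c' where kc': "\<forall>x\<in>{f a..f b}. g x = real n powi k' * x + c'"
        unfolding affine_on_def by blast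
      have "\<forall>x\<in>{a..b}. ?h x = real n powi (k' + k) * x + (real n powi k' * c + c')"
      proof
        fix x assume x: "x \<in> {a..b}"
        then have x01: "x \<in> {0..1}" using ab by auto
        have "f x \<in> {f a..f b}"
          using strict_mono_onD[OF smf, of a x] strict_mono_onD[OF smf, of x b] x x01 ab
          by (cases "x = a"; cases "x = b") auto
        then show "?h x = real n powi (k' + k) * x + (real n powi k' * c + c')"
          using kc kc' x hx[OF x01] n by (simp add: power_int_add algebra_simps)
      qed
      then show "affine_on n ?h a b" unfolding affine_on_def by blast
    qed
    then show ?thesis by (auto simp: piecewise_iff_breaks)
  qed
  ultimately show ?thesis by (auto simp: carrier_F_group)
qed

lemma F_group_id: "restrict id {0..1} \<in> carrier (F_group n)"
proof -
  have "homeomorphism {0..1} {0..1} (restrict id {0..1}) (id :: real \<Rightarrow> real)"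
    by (rule homeomorphism_cong[of "{0..1}" "{0..1}" id id]) (auto simp: homeomorphism_def)
  moreover have "breaks_in n (restrict id {0..1}) {}"
    unfolding breaks_in_def affine_on_def
    by (auto intro!: exI[of _ "0::int"] exI[of _ "0::real"])
  ultimately show ?thesis
    by (auto simp: carrier_F_group piecewise_iff_breaks strict_mono_on_def)
qed

lemma group_F_group:
  assumes n: "n \<ge> 2" shows "group (F_group n)"
proof (rule groupI)
  have mult: "f \<otimes>\<^bsub>F_group n\<^esub> g = compose {0..1} g f" and one: "\<one>\<^bsub>F_group n\<^esub> = restrict id {0..1}" for f g
    by (simp_all add: F_group_def)
  have ext: "f \<in> extensional {0..1}" if "f \<in> carrier (F_group n)" for f
    using that by (simp add: carrier_F_group)
  show "\<one>\<^bsub>F_group n\<^esub> \<in> carrier (F_group n)" unfolding one by (rule F_group_id)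
  fix f assume f: "f \<in> carrier (F_group n)"
  show "\<one>\<^bsub>F_group n\<^esub> \<otimes>\<^bsub>F_group n\<^esub> f = f"
    unfolding mult one using ext[OF f] by (auto simp: compose_def extensional_def)
  obtain g where g: "g \<in> carrier (F_group n)" "\<forall>x\<in>{0..1}. g (f x) = x \<and> f (g x) = x"
    using F_group_inverse[OF n f] by blast
  have "g \<otimes>\<^bsub>F_group n\<^esub> f = \<one>\<^bsub>F_group n\<^esub>"
    unfolding mult one using g(2) by (auto simp: compose_def)
  then show "\<exists>g\<in>carrier (F_group n). g \<otimes>\<^bsub>F_group n\<^esub> f = \<one>\<^bsub>F_group n\<^esub>" using g(1) by blast
  fix g assume g: "g \<in> carrier (F_group n)"
  show "f \<otimes>\<^bsub>F_group n\<^esub> g \<in> carrier (F_group n)" unfolding mult by (rule F_group_compose[OF n f g])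
  fix h assume "h \<in> carrier (F_group n)"
  show "f \<otimes>\<^bsub>F_group n\<^esub> g \<otimes>\<^bsub>F_group n\<^esub> h = f \<otimes>\<^bsub>F_group n\<^esub> (g \<otimes>\<^bsub>F_group n\<^esub> h)"
    unfolding mult using F_group_range[OF f] by (auto simp: compose_def)
qed

text \<open>
  The left ends of words include all \<open>n\<close>-adic fractions in \<open>[0,1)\<close>, so continuity does the rest.
\<close>
lemma F_group_eqI:
  assumes n: "n \<ge> 2" and f: "f \<in> carrier (F_group n)" and g: "g \<in> carrier (F_group n)"
    and eq: "\<And>w. f (left_end n 0 w) = g (left_end n 0 w)"
  shows "f = g"
proof (rule extensionalityI[of _ "{0..1}"])
  show "f \<in> extensional {0..1}" "g \<in> extensional {0..1}" using f g by (auto simp: carrier_F_group)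
  fix x :: real assume x: "x \<in> {0..1}"
  show "f x = g x"
  proof (cases "x = 1")
    case True
    then show ?thesis using F_group_basic(5) f g by metis
  next
    case False
    \<comment> \<open>Truncated \<open>n\<close>-ary expansions of \<open>x\<close>.\<close>
    define b where "b k = nat \<lfloor>x * real n ^ k\<rfloor>" for k
    define y where "y k = real (b k) / real n ^ k" for k
    have pos: "real n ^ k > 0" for k using n by simp
    have rb: "real (b k) = of_int \<lfloor>x * real n ^ k\<rfloor>" for k
      using x pos[of k] by (simp add: b_def)
    have bk: "real (b k) \<le> x * real n ^ k" "x * real n ^ k < real (b k) + 1" for k
      unfolding rb by linarith+
    have yx: "y k \<le> x" "x < y k + 1 / real n ^ k" for k
      using bk[of k] by (simp_all add: y_def add_divide_distrib[symmetric]
          pos_divide_le_eq[OF pos] pos_less_divide_eq[OF pos])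
    have b_less: "b k < n ^ k" for k
    proof -
      have "x * real n ^ k < 1 * real n ^ k" using x False pos[of k] by (intro mult_strict_right_mono) auto
      then have "real (b k) < real (n ^ k)" unfolding of_nat_power using bk(1)[of k] by linarith
      then show ?thesis by (simp only: of_nat_less_iff)
    qed
    have y01: "y k \<in> {0..1}" for k using yx(1)[of k] x by (auto simp: y_def)
    have fg: "f (y k) = g (y k)" for k
    proof -
      obtain w where "left_end n 0 w = y k" using standard_word[OF n b_less[of k]] by (auto simp: y_def)
      then show ?thesis using eq[of w] by simp
    qed
    have lim: "y \<longlonglongrightarrow> x"
    proof (rule tendsto_sandwich[of "\<lambda>k. x - (1 / real n) ^ k" _ _ "\<lambda>k. x"])
      show "\<forall>\<^sub>F k in sequentially. x - (1 / real n) ^ k \<le> y k"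
        using yx(2) by (intro always_eventually) (auto simp: power_one_over less_imp_le algebra_simps)
      show "\<forall>\<^sub>F k in sequentially. y k \<le> x" using yx(1) by simp
      have "(\<lambda>k. (1 / real n) ^ k) \<longlonglongrightarrow> 0" using n by (intro LIMSEQ_realpow_zero) auto
      then show "(\<lambda>k. x - (1 / real n) ^ k) \<longlonglongrightarrow> x" using tendsto_diff[of "\<lambda>_. x" x] by fastforce
    qed simp
    have "(\<lambda>k. h (y k)) \<longlonglongrightarrow> h x" if "h \<in> carrier (F_group n)" for h
      using continuous_on_tendsto_compose[OF F_group_basic(2)[OF that] lim x] y01 by simp
    from this[OF f] this[OF g] show ?thesis unfolding fg by (rule LIMSEQ_unique)
  qed
qed

section \<open>Walks in a graph with unique parents\<close>

lemma cas_snoc: "pre_digraph.cas G u (p @ [a]) v \<longleftrightarrow> pre_digraph.cas G u p (tail G a) \<and> head G a = v"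
  by (induction p arbitrary: u) (auto simp: pre_digraph.cas.simps)

text \<open>
  If every vertex other than \<open>u\<close> has exactly one incoming arc of the kind \<open>A\<close>, and these arcs increase
  \<open>cnt\<close> by one, then walking back from \<open>v\<close> is forced and reaches \<open>u\<close> after \<open>cnt v\<close> steps.
\<close>
lemma unique_walk_length:
  fixes G :: "('v, 'e) pre_digraph" and cnt :: "'v \<Rightarrow> nat"
  assumes u: "u \<in> verts G" "cnt u = 0"
    and arc: "\<And>a. a \<in> arcs G \<Longrightarrow> a \<in> A \<Longrightarrow>
      head G a \<noteq> u \<and> tail G a \<in> verts G \<and> cnt (head G a) = Suc (cnt (tail G a))"
    and inj: "inj_on (head G) (arcs G \<inter> A)"
    and ex: "\<And>v. v \<in> verts G \<Longrightarrow> v \<noteq> u \<Longrightarrow> \<exists>a\<in>arcs G \<inter> A. head G a = v"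
    and v: "v \<in> verts G"
  shows "length (THE p. pre_digraph.awalk G u p v \<and> set p \<subseteq> A) = cnt v"
proof -
  let ?W = "\<lambda>p v. pre_digraph.awalk G u p v \<and> set p \<subseteq> A"
  have W: "?W p v \<longleftrightarrow> set p \<subseteq> arcs G \<inter> A \<and> pre_digraph.cas G u p v" for p v
    using u by (auto simp: pre_digraph.awalk_def)
  have exists: "\<exists>p. ?W p v" if "v \<in> verts G" for v
    using that
  proof (induction "cnt v" arbitrary: v rule: less_induct)
    case less
    show ?case
    proof (cases "v = u")
      case True
      then show ?thesis unfolding W by (intro exI[of _ "[]"]) (simp add: pre_digraph.cas.simps)
    next
      case False
      then obtain a where a: "a \<in> arcs G" "a \<in> A" "head G a = v" using ex less.prems by auto
      then obtain p where "?W p (tail G a)" using less.hyps[of "tail G a"] arc[OF a(1,2)] by auto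
      then have "?W (p @ [a]) v" using a unfolding W by (auto simp: cas_snoc)
      then show ?thesis by blast
    qed
  qed
  have len: "length p = cnt v" if "?W p v" for p v
    using that
  proof (induction p arbitrary: v rule: rev_induct)
    case Nil
    then show ?case using u unfolding W by (simp add: pre_digraph.cas.simps)
  next
    case (snoc a p)
    then have a: "a \<in> arcs G" "a \<in> A" "head G a = v" "?W p (tail G a)" unfolding W by (auto simp: cas_snoc)
    then show ?case using snoc.IH[OF a(4)] arc[OF a(1,2)] by simp
  qed
  have uniq: "p = q" if "?W p v" "?W q v" for p q v
    using that
  proof (induction p arbitrary: q v rule: rev_induct)
    case Nil
    then show ?case using len[of "[]" v] len[of q v] by simp
  next
    case (snoc a p)
    have "length q = length (p @ [a])" using len[OF snoc.prems(1)] len[OF snoc.prems(2)] by simp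
    then obtain b q' where q: "q = q' @ [b]" by (cases q rule: rev_cases) auto
    have "a \<in> arcs G \<inter> A" "b \<in> arcs G \<inter> A" "head G a = v" "head G b = v"
      "?W p (tail G a)" "?W q' (tail G b)"
      using snoc.prems unfolding W q by (auto simp: cas_snoc)
    then show ?case using inj snoc.IH[of "tail G a" q'] q by (auto dest: inj_onD)
  qed
  have "?W (THE p. ?W p v) v"
    using exists[OF v] uniq by (metis (mono_tags, lifting) theI)
  then show ?thesis by (rule len)
qed

section \<open>Incoming edges in a pair of trees\<close>

primrec left_children :: "edge tree \<Rightarrow> edge set" where
  "left_children (Leaf x) = {}"
| "left_children (Node x l r) = insert (root_label l) (left_children l \<union> left_children r)"

primrec right_children :: "edge tree \<Rightarrow> edge set" where
  "right_children (Leaf x) = {}"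
| "right_children (Node x l r) = insert (root_label r) (right_children l \<union> right_children r)"

text \<open>
  Adjacent incoming edges of a vertex, the upper one first: a caret puts its root directly above the
  right child.
\<close>
primrec tree_above :: "edge tree \<Rightarrow> (edge \<times> edge) set" where
  "tree_above (Leaf x) = {}"
| "tree_above (Node x l r) = insert (x, root_label r) (tree_above l \<union> tree_above r)"

lemma children_in_tree: "left_children t \<subseteq> set_tree t" "right_children t \<subseteq> set_tree t"
  by (induction t) auto

lemma children_distinct:
  assumes "distinct (node_labels t @ leaf_labels t)"
  shows "root_label t \<notin> left_children t \<union> right_children t" "left_children t \<inter> right_children t = {}"
  using assms
proof (induction t)
  case (Node x l r)
  {
    case 1
    have d: "x \<notin> set_tree l" "x \<notin> set_tree r" "set_tree l \<inter> set_tree r = {}"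
      "distinct (node_labels l @ leaf_labels l)" "distinct (node_labels r @ leaf_labels r)"
      using 1 by (auto simp: set_tree_eq)
    note c = children_in_tree[of l] children_in_tree[of r] root_label_in[of l] root_label_in[of r]
    show ?case using d(1,2) c by auto
  next
    case 2
    have d: "set_tree l \<inter> set_tree r = {}"
      "distinct (node_labels l @ leaf_labels l)" "distinct (node_labels r @ leaf_labels r)"
      using 2 by (auto simp: set_tree_eq)
    note c = children_in_tree[of l] children_in_tree[of r] root_label_in[of l] root_label_in[of r]
    have lr: "p \<noteq> q" if "p \<in> set_tree l" "q \<in> set_tree r" for p q using d(1) that by auto
    show ?case
    proof (rule Int_emptyI)
      fix y assume y: "y \<in> left_children (Node x l r)" "y \<in> right_children (Node x l r)"
      then have "y = root_label l \<or> y \<in> left_children l \<or> y \<in> left_children r"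
        "y = root_label r \<or> y \<in> right_children l \<or> y \<in> right_children r" by auto
      then show False
        using c lr Node.IH(1)[OF d(2)] Node.IH(2)[OF d(2)] Node.IH(3)[OF d(3)] Node.IH(4)[OF d(3)]
        by (metis UnI1 UnI2 disjoint_iff subsetD)
    qed
  }
qed simp_all

lemma tree_above_target: "(x, y) \<in> tree_above t \<Longrightarrow> y \<in> right_children t \<and> x \<in> set (node_labels t)"
  by (induction t) auto

lemma tree_above_carets: "tree_above t = (\<lambda>(p, q). (last p, last q)) ` carets t"
  by (induction t) (simp_all add: image_Un)

lemma directly_above_pair:
  "directly_above (pair_diagram T S) = tree_above T \<union> (tree_above S)\<inverse>"
proof -
  have "directly_above D = (\<lambda>(p, q). (last p, last q)) ` cells D" for D
    unfolding directly_above_def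
  proof (intro equalityI subsetI)
    fix x assume "x \<in> {(last p, last q) |p q. (p, q) \<in> cells D}"
    then obtain p q where "(p, q) \<in> cells D" "x = (last p, last q)" by blast
    then show "x \<in> (\<lambda>(p, q). (last p, last q)) ` cells D" by (intro image_eqI[of _ _ "(p, q)"]) auto
  qed auto
  moreover have "(\<lambda>(p, q). (last p, last q)) ` (X\<inverse>) = ((\<lambda>(p, q). (last p, last q)) ` X)\<inverse>"
    for X :: "(path \<times> path) set"
    by force
  ultimately show ?thesis by (simp add: tree_above_carets image_Un)
qed

lemma target_in_leaves: "plane_tree t \<Longrightarrow> x \<in> set_tree t \<Longrightarrow> target x \<in> target ` set (leaf_labels t)"
proof (induction t arbitrary: x)
  case (Node e l r)
  have "target e = target (root_label r)" using Node.prems(1) by (simp add: triangle_def)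
  moreover have "target (root_label r) \<in> target ` set (leaf_labels r)"
    using Node.IH(2)[OF _ root_label_in] Node.prems(1) by simp
  ultimately show ?case using Node.IH Node.prems by (auto simp: image_Un)
qed simp

lemma source_in_leaves: "plane_tree t \<Longrightarrow> x \<in> set_tree t \<Longrightarrow> source x \<in> source ` set (leaf_labels t)"
proof (induction t arbitrary: x)
  case (Node e l r)
  have "source e = source (root_label l)" using Node.prems(1) by (simp add: triangle_def)
  moreover have "source (root_label l) \<in> source ` set (leaf_labels l)"
    using Node.IH(1)[OF _ root_label_in] Node.prems(1) by simp
  ultimately show ?case using Node.IH Node.prems by (auto simp: image_Un)
qed simp

text \<open>
  The edges with the same target as the root form the right border of the tree.
\<close>
lemma root_above:
  assumes "plane_tree t" "simple_path u (leaf_labels t) v" "x \<in> set_tree t" "target x = v"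
  shows "(root_label t, x) \<in> (tree_above t)\<^sup>*"
  using assms
proof (induction t arbitrary: u)
  case (Node e l r)
  have "simple_path u (leaf_labels l @ leaf_labels r) v" using Node.prems(2) by simp
  then obtain w where w: "simple_path u (leaf_labels l) w" "simple_path w (leaf_labels r) v"
    "w \<in> target ` set (leaf_labels l)"
    "insert u (target ` set (leaf_labels l)) \<inter> target ` set (leaf_labels r) = {}"
    by (rule simple_path_append_split) simp_all
  have v: "v \<in> target ` set (leaf_labels r)"
    using w(2) is_path_last[of w "leaf_labels r" v] last_in_set[of "leaf_labels r"]
    unfolding simple_path_def by (metis imageI)
  have "x \<notin> set_tree l"
    using target_in_leaves[of l x] Node.prems v w(4) by (metis disjoint_iff insertI2 plane_tree.simps(2))
  then consider "x = e" | "x \<in> set_tree r" using Node.prems(3) by auto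
  then show ?case
  proof cases
    case 2
    then have "(root_label r, x) \<in> (tree_above r)\<^sup>*" using Node w by simp
    then have "(root_label r, x) \<in> (tree_above (Node e l r))\<^sup>*" by (rule rtrancl_mono[THEN subsetD, rotated]) auto
    moreover have "(e, root_label r) \<in> tree_above (Node e l r)" by simp
    ultimately have "(e, x) \<in> (tree_above (Node e l r))\<^sup>*"
      by (rule converse_rtrancl_into_rtrancl[rotated])
    then show ?thesis by simp
  qed simp
qed simp

lemma leaf_below: "plane_tree t \<Longrightarrow> x \<in> set_tree t \<Longrightarrow>
    \<exists>y\<in>set (leaf_labels t). target y = target x \<and> (x, y) \<in> (tree_above t)\<^sup>*"
proof (induction t arbitrary: x)
  case (Node e l r)
  have mono: "(tree_above l)\<^sup>* \<subseteq> (tree_above (Node e l r))\<^sup>*" "(tree_above r)\<^sup>* \<subseteq> (tree_above (Node e l r))\<^sup>*"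
    by (rule rtrancl_mono; auto)+
  have pl: "plane_tree l" "plane_tree r" "target e = target (root_label r)"
    using Node.prems(1) by (auto simp: triangle_def)
  consider "x = e" | "x \<in> set_tree l" | "x \<in> set_tree r" using Node.prems(2) by auto
  then show ?case
  proof cases
    case 1
    obtain y where y: "y \<in> set (leaf_labels r)" "target y = target (root_label r)"
      "(root_label r, y) \<in> (tree_above r)\<^sup>*"
      using Node.IH(2)[OF pl(2) root_label_in] by blast
    have "(e, root_label r) \<in> tree_above (Node e l r)" by simp
    moreover have "(root_label r, y) \<in> (tree_above (Node e l r))\<^sup>*" using y(3) mono(2) by (rule subsetD[rotated])
    ultimately have "(e, y) \<in> (tree_above (Node e l r))\<^sup>*" by (rule converse_rtrancl_into_rtrancl)
    then show ?thesis using y(1,2) 1 pl(3) by auto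
  next
    case 2
    then show ?thesis using Node.IH(1)[OF pl(1) 2] subsetD[OF mono(1)] by auto
  next
    case 3
    then show ?thesis using Node.IH(2)[OF pl(2) 3] subsetD[OF mono(2)] by auto
  qed
qed simp

lemma path_sources: "is_path u p v \<Longrightarrow> p \<noteq> [] \<Longrightarrow> map source p = u # map target (butlast p)"
proof (induction p arbitrary: u)
  case (Cons e p)
  then show ?case by (cases "p = []") auto
qed simp

lemma path_tl_sources: "is_path u p v \<Longrightarrow> p \<noteq> [] \<Longrightarrow> map source (tl p) = map target (butlast p)"
  using path_sources[of u p v] by (cases p) auto

lemma tl_sources:
  assumes "simple_path u p v"
  shows "source ` set (tl p) = target ` set (butlast p)" "source ` set (tl p) = target ` set p - {v}"
    "u \<notin> source ` set (tl p)" "distinct (map source p)" "source ` set p = insert u (source ` set (tl p))"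
proof -
  have p: "is_path u p v" "p \<noteq> []" "distinct (u # map target p)" using assms by (auto simp: simple_path_def)
  show 1: "source ` set (tl p) = target ` set (butlast p)"
    using path_tl_sources[OF p(1,2)] by (metis list.set_map)
  obtain q e where q: "p = q @ [e]" using p(2) by (cases p rule: rev_cases) auto
  have v: "target e = v" using is_path_last[OF p(1,2)] q by simp
  have d: "distinct (u # map target q @ [target e])" using p(3) q by simp
  show "source ` set (tl p) = target ` set p - {v}"
    unfolding 1 using d v q by auto
  show "u \<notin> source ` set (tl p)" unfolding 1 using d q by auto
  show "distinct (map source p)" using path_sources[OF p(1,2)] d q by auto
  show "source ` set p = insert u (source ` set (tl p))"
    using p(1,2) by (cases p) auto
qed

text \<open>
  The vertex between two neighbouring leaves is the middle of exactly one caret. The left child of this caret is the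
  topmost edge ending there, and the other edges of the tree ending there form the right border of its subtree.
\<close>
lemma left_child_above:
  assumes "plane_tree t" "simple_path u (leaf_labels t) v" "y \<in> source ` set (tl (leaf_labels t))"
  shows "\<exists>e\<in>left_children t. target e = y \<and> (\<forall>x\<in>set_tree t. target x = y \<longrightarrow> (e, x) \<in> (tree_above t)\<^sup>*)"
  using assms
proof (induction t arbitrary: u v)
  case (Node e l r)
  let ?L = "leaf_labels l" and ?R = "leaf_labels r"
  obtain w where w: "simple_path u ?L w" "simple_path w ?R v" "w \<in> target ` set ?L"
    "insert u (target ` set ?L) \<inter> target ` set ?R = {}"
    using simple_path_append_split[of u ?L ?R v] Node.prems(2) by auto
  have pl: "plane_tree l" "plane_tree r" "target e = target (root_label r)" "target (root_label l) = source (root_label r)"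
    using Node.prems(1) by (auto simp: triangle_def)
  have mono: "(tree_above l)\<^sup>* \<subseteq> (tree_above (Node e l r))\<^sup>*" "(tree_above r)\<^sup>* \<subseteq> (tree_above (Node e l r))\<^sup>*"
    by (rule rtrancl_mono; auto)+
  have ends: "target (root_label l) = w" "target (root_label r) = v"
    using plane_tree_ends[OF pl(1), of u w] plane_tree_ends[OF pl(2), of w v] w by (auto simp: simple_path_def)
  have v_in: "v \<in> target ` set ?R"
    using w(2) is_path_last[of w ?R v] last_in_set[of ?R] unfolding simple_path_def by (metis imageI)
  have srcL: "source ` set (tl ?L) \<subseteq> target ` set ?L" "w \<notin> source ` set (tl ?L)"
    and srcR: "source ` set (tl ?R) \<subseteq> target ` set ?R" "v \<notin> source ` set (tl ?R)"
    using tl_sources(2)[OF w(1)] tl_sources(2)[OF w(2)] by auto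
  have tR: "target x \<in> target ` set ?R" if "x \<in> set_tree r" for x using target_in_leaves pl(2) that by blast
  have tL: "target x \<in> target ` set ?L" if "x \<in> set_tree l" for x using target_in_leaves pl(1) that by blast
  have LR: "p \<noteq> q" if "p \<in> target ` set ?L" "q \<in> target ` set ?R" for p q
    using w(4) that by (metis disjoint_iff insertI2)
  have "leaf_labels (Node e l r) = ?L @ ?R" by simp
  then have "tl (leaf_labels (Node e l r)) = tl ?L @ ?R" by (simp add: tl_append2)
  moreover have "set ?R = insert (hd ?R) (set (tl ?R))"
    by (metis leaf_labels_nonempty list.exhaust_sel list.simps(15))
  moreover have "source (hd ?R) = w" using w(2) is_path_hd by (auto simp: simple_path_def)
  ultimately consider "y \<in> source ` set (tl ?L)" | "y = w" | "y \<in> source ` set (tl ?R)"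
    using Node.prems(3) by auto
  then show ?case
  proof cases
    case 1
    obtain f where f: "f \<in> left_children l" "target f = y" "\<forall>x\<in>set_tree l. target x = y \<longrightarrow> (f, x) \<in> (tree_above l)\<^sup>*"
      using Node.IH(1)[OF pl(1) w(1) 1] by blast
    have y: "y \<in> target ` set ?L" using srcL 1 by blast
    have "(f, x) \<in> (tree_above (Node e l r))\<^sup>*" if "x \<in> set_tree (Node e l r)" "target x = y" for x
    proof -
      have "x \<noteq> e" using that(2) pl(3) ends LR[OF y v_in] by auto
      moreover have "x \<notin> set_tree r" using tR[of x] LR[OF y] that(2) by auto
      ultimately show ?thesis using f(3) that mono(1) by auto
    qed
    then show ?thesis using f by auto
  next
    case 2
    have "(root_label l, x) \<in> (tree_above (Node e l r))\<^sup>*" if "x \<in> set_tree (Node e l r)" "target x = y" for x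
    proof -
      have "x \<noteq> e" using that(2) pl(3) ends LR[OF w(3) v_in] 2 by auto
      moreover have "x \<notin> set_tree r" using tR[of x] LR[OF w(3)] that(2) 2 by auto
      ultimately have "x \<in> set_tree l" using that(1) by auto
      then show ?thesis using root_above[OF pl(1) w(1)] that(2) 2 mono(1) by auto
    qed
    then show ?thesis using 2 ends by auto
  next
    case 3
    obtain f where f: "f \<in> left_children r" "target f = y" "\<forall>x\<in>set_tree r. target x = y \<longrightarrow> (f, x) \<in> (tree_above r)\<^sup>*"
      using Node.IH(2)[OF pl(2) w(2) 3] by blast
    have y: "y \<in> target ` set ?R" "y \<noteq> v" using srcR 3 by auto
    have "(f, x) \<in> (tree_above (Node e l r))\<^sup>*" if "x \<in> set_tree (Node e l r)" "target x = y" for x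
    proof -
      have "x \<noteq> e" using that(2) pl(3) ends y(2) by auto
      moreover have "x \<notin> set_tree l" using tL[of x] LR[OF _ y(1)] that(2) by auto
      ultimately show ?thesis using f(3) that mono(2) by auto
    qed
    then show ?thesis using f by auto
  qed
qed simp

section \<open>Goodness in terms of addresses\<close>

text \<open>
  A form of topmost edges that can be used for bottommost edges as well, with the converse relation.
\<close>
definition top_of :: "(edge \<times> edge) set \<Rightarrow> edge set \<Rightarrow> nat \<Rightarrow> edge \<Rightarrow> bool" where
  "top_of R E v e \<longleftrightarrow> e \<in> E \<and> target e = v \<and> (\<forall>e'\<in>E. target e' = v \<longrightarrow> (e, e') \<in> R\<^sup>*)"

lemma topmost_iff: "topmost_incoming D v e \<longleftrightarrow> top_of (directly_above D) (edges D) v e"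
  by (simp add: topmost_incoming_def top_of_def)

lemma bottommost_iff: "bottommost_incoming D v e \<longleftrightarrow> top_of ((directly_above D)\<inverse>) (edges D) v e"
  by (simp add: bottommost_incoming_def top_of_def rtrancl_converse)

text \<open>
  Unlike a matching pair, this notion is symmetric in the two trees; so statements about top paths
  carry over to bottom paths.
\<close>
definition tree_pair :: "edge tree \<Rightarrow> edge tree \<Rightarrow> nat \<Rightarrow> nat \<Rightarrow> bool" where
  "tree_pair T S u v \<longleftrightarrow> plane_tree T \<and> plane_tree S \<and> leaf_labels S = leaf_labels T \<and>
     distinct (node_labels T @ leaf_labels T @ node_labels S) \<and> simple_path u (leaf_labels T) v"

lemma tree_pair_sym: "tree_pair T S u v \<Longrightarrow> tree_pair S T u v"
proof -
  assume P: "tree_pair T S u v"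
  then have d: "distinct (node_labels T)" "distinct (leaf_labels T)" "distinct (node_labels S)"
    "set (leaf_labels T) \<inter> set (node_labels S) = {}"
    "set (node_labels T) \<inter> (set (leaf_labels T) \<union> set (node_labels S)) = {}"
    by (auto simp: tree_pair_def)
  have "set (node_labels T) \<inter> set (leaf_labels T) = {}" "set (node_labels T) \<inter> set (node_labels S) = {}"
    using d(5) by (metis Int_Un_distrib Un_empty)+
  then have "distinct (node_labels S @ leaf_labels T @ node_labels T)"
    using d by (simp add: Int_Un_distrib Int_commute)
  then show ?thesis using P by (simp add: tree_pair_def)
qed

text \<open>
  An edge directly below another one is a right child in the upper tree, or an inner node of the lower
  tree.
\<close>
lemma no_edge_above_left_child:
  assumes "tree_pair T S u v" "e \<in> left_children T" "(x, e) \<in> (tree_above T \<union> (tree_above S)\<inverse>)\<^sup>*"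
  shows "x = e"
proof (rule ccontr)
  assume "x \<noteq> e"
  then obtain z where "(z, e) \<in> tree_above T \<union> (tree_above S)\<inverse>"
    using assms(3) by (metis rtranclE)
  then consider "(z, e) \<in> tree_above T" | "(e, z) \<in> tree_above S" by auto
  then show False
  proof cases
    case 1
    have "distinct (node_labels T @ leaf_labels T)" using assms(1) by (auto simp: tree_pair_def)
    then show False using tree_above_target[OF 1] children_distinct(2)[of T] assms(2) by (metis disjoint_iff)
  next
    case 2
    then have "e \<in> set (node_labels S)" using tree_above_target by blast
    moreover have "e \<in> set_tree T" using children_in_tree assms(2) by blast
    ultimately show False using assms(1) unfolding tree_pair_def set_tree_eq by auto
  qed
qed

lemma top_of_left_child:
  assumes P: "tree_pair T S u v" and y: "y \<in> source ` set (tl (leaf_labels T))"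
  shows "\<exists>e\<in>left_children T. target e = y \<and>
    (\<forall>e'. top_of (tree_above T \<union> (tree_above S)\<inverse>) (set_tree T \<union> set_tree S) y e' \<longleftrightarrow> e' = e) \<and>
    (\<forall>e'\<in>left_children T. target e' = y \<longrightarrow> e' = e)"
proof -
  let ?R = "tree_above T \<union> (tree_above S)\<inverse>" and ?E = "set_tree T \<union> set_tree S"
  have pl: "plane_tree T" "plane_tree S" "simple_path u (leaf_labels T) v" "leaf_labels S = leaf_labels T"
    using P by (auto simp: tree_pair_def)
  obtain e where e: "e \<in> left_children T" "target e = y"
    "\<forall>x\<in>set_tree T. target x = y \<longrightarrow> (e, x) \<in> (tree_above T)\<^sup>*"
    using left_child_above[OF pl(1,3) y] by blast
  have mono: "(tree_above T)\<^sup>* \<subseteq> ?R\<^sup>*" "((tree_above S)\<inverse>)\<^sup>* \<subseteq> ?R\<^sup>*" by (rule rtrancl_mono; auto)+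
  have eT: "e \<in> set_tree T" using e(1) children_in_tree by blast
  have top: "top_of ?R ?E y e"
    unfolding top_of_def
  proof (intro conjI ballI impI)
    fix x assume x: "x \<in> ?E" "target x = y"
    show "(e, x) \<in> ?R\<^sup>*"
    proof (cases "x \<in> set_tree T")
      case True
      then show ?thesis using e(3) x(2) mono(1) by blast
    next
      case False
      then obtain z where z: "z \<in> set (leaf_labels S)" "target z = y" "(x, z) \<in> (tree_above S)\<^sup>*"
        using leaf_below[OF pl(2), of x] x by auto
      have "z \<in> set_tree T" using z(1) pl(4) by (simp add: set_tree_eq)
      then have "(e, z) \<in> ?R\<^sup>*" using e(3) z(2) mono(1) by blast
      moreover have "(z, x) \<in> ?R\<^sup>*" using z(3) mono(2) by (auto simp: rtrancl_converse)
      ultimately show ?thesis by (rule rtrancl_trans)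
    qed
  qed (use e eT in auto)
  have "e' = e" if "top_of ?R ?E y e'" for e'
    using no_edge_above_left_child[OF P e(1), of e'] that eT e(2) unfolding top_of_def by blast
  moreover have "e' = e" if "e' \<in> left_children T" "target e' = y" for e'
  proof -
    have "e' \<in> set_tree T" using that(1) children_in_tree by blast
    then have "(e, e') \<in> ?R\<^sup>*" using e(3) that(2) mono(1) by blast
    from no_edge_above_left_child[OF P that(1) this] show ?thesis by simp
  qed
  ultimately show ?thesis using top e by blast
qed

text \<open>
  If \<open>cnt\<close> counts the ones in the address of the leaf that starts at a vertex, then passing from the
  source to the target of a left child means passing to the right sibling, which adds a one.
\<close>
lemma count_left_children:
  assumes "plane_tree t" "list_all2 (\<lambda>x a. cnt (source x) = k + ones a) (leaf_labels t) (addresses t)"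
  shows "cnt (source (root_label t)) = k \<and> (\<forall>e\<in>left_children t. cnt (target e) = Suc (cnt (source e)))"
  using assms
proof (induction t arbitrary: k)
  case (Node e l r)
  have "list_all2 (\<lambda>x a. cnt (source x) = k + ones a) (leaf_labels l) (map (Cons False) (addresses l))"
    "list_all2 (\<lambda>x a. cnt (source x) = k + ones a) (leaf_labels r) (map (Cons True) (addresses r))"
    using Node.prems(2) by (auto simp: list_all2_append)
  then have "list_all2 (\<lambda>x a. cnt (source x) = k + ones a) (leaf_labels l) (addresses l)"
    "list_all2 (\<lambda>x a. cnt (source x) = Suc k + ones a) (leaf_labels r) (addresses r)"
    by (simp_all add: list.rel_map)
  then have "cnt (source (root_label l)) = k \<and> (\<forall>e\<in>left_children l. cnt (target e) = Suc (cnt (source e)))"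
    "cnt (source (root_label r)) = Suc k \<and> (\<forall>e\<in>left_children r. cnt (target e) = Suc (cnt (source e)))"
    using Node.IH(1)[of k] Node.IH(2)[of "Suc k"] Node.prems(1) by simp_all
  then show ?case using Node.prems(1) by (auto simp: triangle_def)
qed simp

text \<open>
  The upper arcs are the left children of \<open>T\<close>. Used with exchanged trees, the lemma is about bottom
  paths.
\<close>
lemma top_walk_length:
  fixes G :: "(nat, 'e) pre_digraph" and c :: "edge \<Rightarrow> 'e"
  assumes P: "tree_pair T S u v"
    and I: "I = source ` set (tl (leaf_labels T))" and verts: "verts G = insert u I"
    and arcs: "arcs G \<inter> A =
      c ` {e. \<exists>y\<in>I. top_of (tree_above T \<union> (tree_above S)\<inverse>) (set_tree T \<union> set_tree S) y e}"
    and ends: "\<And>e. tail G (c e) = source e" "\<And>e. head G (c e) = target e"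
    and i: "i < length (leaf_labels T)"
  shows "length (THE p. pre_digraph.awalk G u p (source (leaf_labels T ! i)) \<and> set p \<subseteq> A)
    = ones (addresses T ! i)"
proof -
  have pl: "plane_tree T" "simple_path u (leaf_labels T) v" using P by (auto simp: tree_pair_def)
  note src = tl_sources[OF pl(2)]
  define cnt where "cnt = (\<lambda>y. the (map_of (zip (map source (leaf_labels T)) (map ones (addresses T))) y))"
  have cnt: "cnt (source (leaf_labels T ! j)) = ones (addresses T ! j)" if "j < length (leaf_labels T)" for j
    using map_of_zip_nth[of "map source (leaf_labels T)" "map ones (addresses T)" j] src(4) that
    by (simp add: cnt_def)
  have count: "cnt (source (root_label T)) = 0 \<and> (\<forall>e\<in>left_children T. cnt (target e) = Suc (cnt (source e)))"
    by (rule count_left_children[OF pl(1)]) (simp add: list_all2_conv_all_nth cnt)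
  have root: "source (root_label T) = u"
    using plane_tree_ends[OF pl(1), of u v] pl(2) by (simp add: simple_path_def)
  have left: "arcs G \<inter> A = c ` {e \<in> left_children T. target e \<in> I}"
    unfolding arcs
  proof (rule arg_cong[of _ _ "image c"], rule Collect_cong)
    fix e
    show "(\<exists>y\<in>I. top_of (tree_above T \<union> (tree_above S)\<inverse>) (set_tree T \<union> set_tree S) y e) \<longleftrightarrow>
        e \<in> left_children T \<and> target e \<in> I"
    proof
      assume "\<exists>y\<in>I. top_of (tree_above T \<union> (tree_above S)\<inverse>) (set_tree T \<union> set_tree S) y e"
      then show "e \<in> left_children T \<and> target e \<in> I" using top_of_left_child[OF P] I by metis
    next
      assume "e \<in> left_children T \<and> target e \<in> I"
      then show "\<exists>y\<in>I. top_of (tree_above T \<union> (tree_above S)\<inverse>) (set_tree T \<union> set_tree S) y e"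
        using top_of_left_child[OF P, of "target e"] I by metis
    qed
  qed
  have "length (THE p. pre_digraph.awalk G u p (source (leaf_labels T ! i)) \<and> set p \<subseteq> A)
      = cnt (source (leaf_labels T ! i))"
  proof (rule unique_walk_length)
    show "u \<in> verts G" using verts by simp
    show "cnt u = 0" using count root by simp
    show "source (leaf_labels T ! i) \<in> verts G"
      unfolding verts I src(5)[symmetric] using i by simp
  next
    fix a assume "a \<in> arcs G" "a \<in> A"
    then obtain e where e: "a = c e" "e \<in> left_children T" "target e \<in> I" using left by blast
    have "e \<in> set_tree T" using e(2) children_in_tree by blast
    then have "source e \<in> insert u I" using source_in_leaves[OF pl(1)] src(5) I by metis
    moreover have "target e \<noteq> u" using e(3) src(3) I by metis
    ultimately show "head G a \<noteq> u \<and> tail G a \<in> verts G \<and> cnt (head G a) = Suc (cnt (tail G a))"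
      using count e verts ends by simp
  next
    show "inj_on (head G) (arcs G \<inter> A)"
    proof (rule inj_onI)
      fix a b assume "a \<in> arcs G \<inter> A" "b \<in> arcs G \<inter> A" and eq: "head G a = head G b"
      then obtain e f where e: "a = c e" "e \<in> left_children T" "target e \<in> I" "b = c f" "f \<in> left_children T"
        unfolding left by blast
      have "target f = target e" using eq e ends by simp
      then have "f = e" using top_of_left_child[OF P, of "target e"] e I by metis
      then show "a = b" using e by simp
    qed
  next
    fix y assume "y \<in> verts G" "y \<noteq> u"
    then have y: "y \<in> I" using verts by simp
    then obtain e where "e \<in> left_children T" "target e = y" using top_of_left_child[OF P, of y] I by metis
    then show "\<exists>a\<in>arcs G \<inter> A. head G a = y" unfolding left using y ends by auto
  qed
  then show ?thesis using cnt[OF i] by simp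
qed

lemma ones_first_address: "ones (addresses t ! 0) = 0"
proof (induction t)
  case (Node x l r)
  have "addresses l ! 0 = hd (addresses l)" by (simp add: hd_conv_nth)
  then show ?case using Node by (cases "addresses l") auto
qed simp

lemma good_pair_diagram:
  assumes M: "matching_pair T S"
  shows "good m (pair_diagram T S) \<longleftrightarrow>
    (\<forall>i<length (leaf_labels T). ones (addresses T ! i) mod m = ones (addresses S ! i) mod m)"
proof -
  let ?D = "pair_diagram T S"
  obtain u v where "simple_path u (leaf_labels T) v" using M by (auto simp: matching_forests_def)
  then have P: "tree_pair T S u v" using matching_pairD[OF M] by (simp add: tree_pair_def)
  then have P': "tree_pair S T u v" by (rule tree_pair_sym)
  have pl: "plane_tree T" "simple_path u (leaf_labels T) v" "leaf_labels S = leaf_labels T"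
    using P by (auto simp: tree_pair_def)
  note src = tl_sources[OF pl(2)]
  define I where "I = source ` set (tl (leaf_labels T))"
  have ends: "source (root_label T) = u" "target (root_label T) = v"
    using plane_tree_ends[OF pl(1), of u v] pl(2) by (auto simp: simple_path_def)
  then have uv: "initial_vertex ?D = u" "terminal_vertex ?D = v"
    by (simp_all add: initial_vertex_def terminal_vertex_def)
  have v_in: "v \<in> target ` set (leaf_labels T)"
    using pl(2) is_path_last[of u "leaf_labels T" v] last_in_set[of "leaf_labels T"]
    unfolding simple_path_def by (metis imageI)
  have u_notin: "u \<notin> target ` set (leaf_labels T)" using pl(2) by (simp add: simple_path_def)
  have V: "vertices ?D = insert u (target ` set (leaf_labels T))"
    unfolding vertices_pair_diagram[OF M] using path_vertices_path[of u "leaf_labels T" v] pl(2)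
    by (simp add: simple_path_def)
  have inner: "inner_vertices ?D = I"
    unfolding inner_vertices_def V uv I_def src(2) using u_notin by auto
  have verts: "verts (thompson_graph ?D) = insert u I"
    unfolding thompson_graph_def V uv I_def src(2) using u_notin v_in by auto
  have edges: "edges ?D = set_tree T \<union> set_tree S" by simp
  let ?G = "thompson_graph ?D"
  have up: "arcs ?G \<inter> range Upper =
      Upper ` {e. \<exists>y\<in>I. top_of (tree_above T \<union> (tree_above S)\<inverse>) (set_tree T \<union> set_tree S) y e}"
    unfolding thompson_graph_def inner topmost_iff directly_above_pair edges by auto
  have conv: "(tree_above T \<union> (tree_above S)\<inverse>)\<inverse> = tree_above S \<union> (tree_above T)\<inverse>" by auto
  have down: "arcs ?G \<inter> range Lower =
      Lower ` {e. \<exists>y\<in>I. top_of (tree_above S \<union> (tree_above T)\<inverse>) (set_tree S \<union> set_tree T) y e}"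
    unfolding thompson_graph_def inner bottommost_iff directly_above_pair conv edges Un_commute[of "set_tree S"]
    by auto
  have tops: "length (thompson_top_path ?D (source (leaf_labels T ! i))) = ones (addresses T ! i)"
    "length (thompson_bottom_path ?D (source (leaf_labels T ! i))) = ones (addresses S ! i)"
    if i: "i < length (leaf_labels T)" for i
  proof -
    show "length (thompson_top_path ?D (source (leaf_labels T ! i))) = ones (addresses T ! i)"
      unfolding thompson_top_path_def uv
      by (rule top_walk_length[OF P I_def verts up _ _ i]) (simp_all add: thompson_graph_def)
    show "length (thompson_bottom_path ?D (source (leaf_labels T ! i))) = ones (addresses S ! i)"
      unfolding thompson_bottom_path_def uv pl(3)[symmetric]
      by (rule top_walk_length[OF P' _ verts down]) (simp_all add: thompson_graph_def I_def pl(3) i)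
  qed
  have I_nth: "I = (\<lambda>i. source (leaf_labels T ! i)) ` {i. 0 < i \<and> i < length (leaf_labels T)}"
  proof -
    have "set (tl (leaf_labels T)) = (\<lambda>i. leaf_labels T ! i) ` {i. 0 < i \<and> i < length (leaf_labels T)}"
    proof (intro equalityI subsetI)
      fix x assume "x \<in> set (tl (leaf_labels T))"
      then obtain j where "j < length (tl (leaf_labels T))" "tl (leaf_labels T) ! j = x" by (metis in_set_conv_nth)
      then show "x \<in> (\<lambda>i. leaf_labels T ! i) ` {i. 0 < i \<and> i < length (leaf_labels T)}"
        by (intro image_eqI[of _ _ "Suc j"]) (auto simp: nth_tl)
    next
      fix x assume "x \<in> (\<lambda>i. leaf_labels T ! i) ` {i. 0 < i \<and> i < length (leaf_labels T)}"
      then obtain i where i: "0 < i" "i < length (leaf_labels T)" "x = leaf_labels T ! i" by auto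
      then obtain j where j: "i = Suc j" by (cases i) auto
      have "j < length (tl (leaf_labels T))" "tl (leaf_labels T) ! j = x" using i j by (auto simp: nth_tl)
      then show "x \<in> set (tl (leaf_labels T))" using nth_mem by metis
    qed
    then show ?thesis unfolding I_def by (simp add: image_image)
  qed
  have "good m ?D \<longleftrightarrow> (\<forall>i. 0 < i \<and> i < length (leaf_labels T) \<longrightarrow>
      ones (addresses T ! i) mod m = ones (addresses S ! i) mod m)"
    unfolding good_def inner I_nth using tops by auto
  also have "\<dots> \<longleftrightarrow> (\<forall>i<length (leaf_labels T). ones (addresses T ! i) mod m = ones (addresses S ! i) mod m)"
    using ones_first_address by (metis gr0I)
  finally show ?thesis .
qed

section \<open>Subdivisions given by words\<close>

fun covers :: "nat \<Rightarrow> nat \<Rightarrow> bool list list \<Rightarrow> real \<Rightarrow> real \<Rightarrow> bool" where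
  "covers n s [] x y \<longleftrightarrow> x = y"
| "covers n s (w # ws) x y \<longleftrightarrow> left_end n s w = x \<and> covers n s ws (x + width n s w) y"

lemma covers_append: "covers n s (ws @ vs) x y \<longleftrightarrow> (\<exists>z. covers n s ws x z \<and> covers n s vs z y)"
  by (induction ws arbitrary: x) auto

lemma covers_addresses:
  "n \<ge> 2 \<Longrightarrow> covers n 0 (map (\<lambda>v. u @ v) (addresses t)) (left_end n 0 u) (left_end n 0 u + width n 0 u)"
proof (induction t arbitrary: u)
  case (Node x l r)
  have "covers n 0 (map (\<lambda>v. u @ v) (map (Cons False) (addresses l)))
      (left_end n 0 u) (left_end n 0 u + width n 0 (u @ [False]))"
    using Node.IH(1)[of "u @ [False]"] Node.prems by (simp add: o_def)
  moreover have "covers n 0 (map (\<lambda>v. u @ v) (map (Cons True) (addresses r)))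
      (left_end n 0 u + width n 0 (u @ [False])) (left_end n 0 u + width n 0 u)"
    using Node.IH(2)[of "u @ [True]"] Node.prems left_end_snoc_True[of n 0 u] width_split[of 0 n u]
    by (simp add: o_def add.assoc)
  ultimately show ?case by (auto simp: covers_append)
qed simp

lemma covers_all: "n \<ge> 2 \<Longrightarrow> covers n 0 (addresses t) 0 1"
  using covers_addresses[of n "[]" t] by (simp add: width_simps)

lemma covers_sum: "covers n s ws x y \<Longrightarrow> y = x + sum_list (map (width n s) ws)"
proof (induction ws arbitrary: x)
  case (Cons w ws)
  then have "y = (x + width n s w) + sum_list (map (width n s) ws)" by (intro Cons.IH) simp
  then show ?case by simp
qed simp

lemma covers_left: "s + 2 \<le> n \<Longrightarrow> covers n s ws x y \<Longrightarrow> w \<in> set ws \<Longrightarrow> x \<le> left_end n s w"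
proof (induction ws arbitrary: x)
  case (Cons v ws)
  have "width n s v > 0" using width_pos Cons.prems(1) by blast
  then show ?case using Cons.IH[of "x + width n s v"] Cons.prems by auto
qed simp

lemma covers_right: "covers n s ws x y \<Longrightarrow> ws \<noteq> [] \<Longrightarrow>
    (\<And>w. w \<in> set ws \<Longrightarrow> left_end n s w + width n s w \<le> c) \<Longrightarrow> y \<le> c"
proof (induction ws arbitrary: x)
  case (Cons v ws)
  show ?case
  proof (cases "ws = []")
    case True
    then show ?thesis using Cons.prems by auto
  next
    case False
    then show ?thesis using Cons.IH[of "x + width n s v"] Cons.prems by auto
  qed
qed simp

lemma covers_False:
  "n > 0 \<Longrightarrow> covers n s (map (Cons False) ws) (x / real n) (y / real n) \<longleftrightarrow> covers n 0 ws x y"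
proof (induction ws arbitrary: x)
  case (Cons w ws)
  have "x / real n + width n s (False # w) = (x + width n 0 w) / real n"
    by (simp add: width_simps add_divide_distrib)
  then show ?case using Cons by simp
qed simp

lemma covers_True:
  "s + 2 \<noteq> n \<Longrightarrow> covers n s (map (Cons True) ws) (1 / real n + x) (1 / real n + y) \<longleftrightarrow> covers n (Suc s) ws x y"
proof (induction ws arbitrary: x)
  case (Cons w ws)
  have e: "1 / real n + x + width n s (True # w) = 1 / real n + (x + width n (Suc s) w)"
    using Cons.prems by (simp add: width_simps)
  have "covers n s (map (Cons True) (w # ws)) (1 / real n + x) (1 / real n + y) \<longleftrightarrow>
      left_end n (Suc s) w = x \<and> covers n s (map (Cons True) ws) (1 / real n + x + width n s (True # w)) (1 / real n + y)"
    using Cons.prems by simp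
  also have "\<dots> \<longleftrightarrow> covers n (Suc s) (w # ws) x y" unfolding e Cons.IH[OF Cons.prems] by simp
  finally show ?case .
qed simp

lemma covers_True_last:
  "s + 2 = n \<Longrightarrow> covers n s (map (Cons True) ws) (1 / real n + x / real n) (1 / real n + y / real n) \<longleftrightarrow>
    covers n 0 ws x y"
proof (induction ws arbitrary: x)
  case (Cons w ws)
  have e: "1 / real n + x / real n + width n s (True # w) = 1 / real n + (x + width n 0 w) / real n"
    using Cons.prems by (simp add: width_simps add_divide_distrib)
  have "n > 0" using Cons.prems by simp
  then have "covers n s (map (Cons True) (w # ws)) (1 / real n + x / real n) (1 / real n + y / real n) \<longleftrightarrow>
      left_end n 0 w = x \<and>
      covers n s (map (Cons True) ws) (1 / real n + x / real n + width n s (True # w)) (1 / real n + y / real n)"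
    using Cons.prems by simp
  also have "\<dots> \<longleftrightarrow> covers n 0 (w # ws) x y" unfolding e Cons.IH[OF Cons.prems] by simp
  finally show ?case .
qed simp

text \<open>
  Unless the cover consists of the empty word, the words starting with 0 lie to the left of \<open>1/n\<close> and
  those starting with 1 to the right, so they cover the two halves separately.
\<close>
lemma tree_of_cover:
  "s + 2 \<le> n \<Longrightarrow> covers n s ws 0 ((real n - real s) / real n) \<Longrightarrow> \<exists>t :: unit tree. addresses t = ws"
proof (induction "sum_list (map length ws)" arbitrary: s ws rule: less_induct)
  case less
  have n: "n \<ge> 2" "real n > 0" using less.prems by auto
  have tot: "(real n - real s) / real n > 1 / real n"
    using less.prems(1) by (intro divide_strict_right_mono) auto
  then have tot0: "(real n - real s) / real n > 0" by (meson less_trans n(2) zero_less_divide_1_iff)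
  show ?case
  proof (cases "[] \<in> set ws")
    case True
    then obtain A B where ws: "ws = A @ [] # B" by (auto simp: in_set_conv_decomp)
    have "sum_list (map (width n s) A) + sum_list (map (width n s) B) = 0"
      using covers_sum[OF less.prems(2)] by (simp add: ws width_simps)
    moreover have "sum_list (map (width n s) A) \<ge> 0" "sum_list (map (width n s) B) \<ge> 0"
      using width_pos[OF less.prems(1)] by (auto intro!: sum_list_nonneg simp: less_imp_le)
    moreover have pos: "sum_list (map (width n s) C) > 0" if C: "C \<noteq> []" for C
    proof -
      obtain c C' where "C = c # C'" using C by (cases C) auto
      moreover have "sum_list (map (width n s) C') \<ge> 0"
        using width_pos[OF less.prems(1)] by (auto intro!: sum_list_nonneg simp: less_imp_le)
      ultimately show ?thesis using width_pos[OF less.prems(1), of c] by simp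
    qed
    ultimately have "A = []" "B = []" using pos[of A] pos[of B] by linarith+
    then show ?thesis using ws by (intro exI[of _ "Leaf ()"]) simp
  next
    case False
    define A where "A = map tl (takeWhile (\<lambda>w. \<not> hd w) ws)"
    define B where "B = map tl (dropWhile (\<lambda>w. \<not> hd w) ws)"
    have FA: "map (Cons False) A = takeWhile (\<lambda>w. \<not> hd w) ws"
    proof -
      have "False # tl w = w" if "w \<in> set (takeWhile (\<lambda>w. \<not> hd w) ws)" for w
        using set_takeWhileD[OF that] False by (cases w) auto
      then show ?thesis unfolding A_def map_map by (intro map_idI) simp
    qed
    obtain z where z: "covers n s (takeWhile (\<lambda>w. \<not> hd w) ws) 0 z"
      "covers n s (dropWhile (\<lambda>w. \<not> hd w) ws) z ((real n - real s) / real n)"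
      using less.prems(2) covers_append by (metis takeWhile_dropWhile_id)
    have small: "left_end n s (False # w) < 1 / real n" "left_end n s (False # w) + width n s (False # w) \<le> 1 / real n" for w
    proof -
      have "left_end n 0 w < 1" using left_end_less_1 n by blast
      then show "left_end n s (False # w) < 1 / real n" using n by (simp add: divide_strict_right_mono)
      have "left_end n 0 w + width n 0 w \<le> 1" using right_end_le[of 0 n w] n by simp
      then have "(left_end n 0 w + width n 0 w) / real n \<le> 1 / real n" using n by (intro divide_right_mono) auto
      then show "left_end n s (False # w) + width n s (False # w) \<le> 1 / real n"
        by (simp add: width_simps add_divide_distrib)
    qed
    have big: "left_end n s (True # w) \<ge> 1 / real n" for w
      using left_end_nonneg[of n] by simp
    have drop: "dropWhile (\<lambda>w. \<not> hd w) ws \<noteq> []"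
    proof
      assume e: "dropWhile (\<lambda>w. \<not> hd w) ws = []"
      then have zt: "z = (real n - real s) / real n" using z(2) unfolding e by simp
      have "takeWhile (\<lambda>w. \<not> hd w) ws \<noteq> []" using z(1) zt tot0 by auto
      then have "z \<le> 1 / real n"
        by (rule covers_right[OF z(1)]) (use small in \<open>auto simp: FA[symmetric]\<close>)
      then show False using zt tot by simp
    qed
    then obtain v vs where dv: "dropWhile (\<lambda>w. \<not> hd w) ws = v # vs" by (cases "dropWhile (\<lambda>w. \<not> hd w) ws") auto
    have "hd v" using dv hd_dropWhile[of "\<lambda>w. \<not> hd w" ws] drop by simp
    moreover have v_ne: "v \<noteq> []" using dv False by (metis dropWhile_eq_Cons_conv list.set_intros(1) set_dropWhileD)
    ultimately have vT: "v = True # tl v" by (cases v) auto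
    then have z_ge: "z \<ge> 1 / real n" using z(2) big[of "tl v"] by (simp add: dv)
    have "hd w" if "w \<in> set (dropWhile (\<lambda>w. \<not> hd w) ws)" for w
    proof (rule ccontr)
      assume "\<not> hd w"
      moreover have "w \<noteq> []" using that False set_dropWhileD by metis
      ultimately have "w = False # tl w" by (cases w) auto
      then show False using covers_left[OF less.prems(1) z(2) that] z_ge small(1)[of "tl w"] by simp
    qed
    then have "True # tl w = w" if "w \<in> set (dropWhile (\<lambda>w. \<not> hd w) ws)" for w
      using that False set_dropWhileD by (metis (full_types) list.exhaust_sel)
    then have TB: "map (Cons True) B = dropWhile (\<lambda>w. \<not> hd w) ws"
      unfolding B_def map_map by (intro map_idI) simp
    have take: "takeWhile (\<lambda>w. \<not> hd w) ws \<noteq> []" using z(1) z_ge n by auto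
    have "z \<le> 1 / real n"
      by (rule covers_right[OF z(1) take]) (use small in \<open>auto simp: FA[symmetric]\<close>)
    then have z_eq: "z = 1 / real n" using z_ge by simp
    have ws: "ws = map (Cons False) A @ map (Cons True) B" unfolding FA TB by simp
    have AB: "A \<noteq> []" "B \<noteq> []" using take drop unfolding FA[symmetric] TB[symmetric] by auto
    have "sum_list (map length ws) = sum_list (map length A) + length A + (sum_list (map length B) + length B)"
      unfolding ws by (simp add: sum_list_Suc o_def)
    then have meas: "sum_list (map length A) < sum_list (map length ws)" "sum_list (map length B) < sum_list (map length ws)"
      using AB by (auto simp: length_greater_0_conv[symmetric] simp del: length_greater_0_conv)
    have "covers n 0 A 0 1"
      using z(1) covers_False[of n s A 0 1] n unfolding FA[symmetric] z_eq by simp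
    then obtain l :: "unit tree" where l: "addresses l = A" using less.hyps[OF meas(1), of 0] n by auto
    have "\<exists>r :: unit tree. addresses r = B"
    proof (cases "s + 2 = n")
      case True
      have "real n - real s = 1 + 1" using True by auto
      then have e: "(real n - real s) / real n = 1 / real n + 1 / real n"
        by (simp add: add_divide_distrib[symmetric])
      have "covers n s (map (Cons True) B) (1 / real n + 0 / real n) (1 / real n + 1 / real n)"
        using z(2) unfolding TB[symmetric] z_eq e by simp
      then have "covers n 0 B 0 1" using covers_True_last[OF True] by blast
      then show ?thesis using less.hyps[OF meas(2), of 0] n by simp
    next
      case f: False
      have "(real n - real s) / real n = 1 / real n + (real n - real (Suc s)) / real n"
        by (simp add: add_divide_distrib[symmetric])
      then have "covers n (Suc s) B 0 ((real n - real (Suc s)) / real n)"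
        using z(2) covers_True[OF f, of B 0] unfolding TB[symmetric] z_eq by simp
      then show ?thesis using less.hyps[OF meas(2), of "Suc s"] f less.prems(1) by simp
    qed
    then obtain r :: "unit tree" where r: "addresses r = B" by blast
    show ?thesis by (rule exI[of _ "Node () l r"]) (simp add: l r ws)
  qed
qed

text \<open>
  So a function that ignores trailing zeros is determined by its values below the leaves.
\<close>
lemma addresses_complete: "\<exists>k a w. a \<in> set (addresses t) \<and> u @ replicate k False = a @ w"
proof (induction t arbitrary: u)
  case (Leaf x)
  then show ?case by (intro exI[of _ 0] exI[of _ "[]"] exI[of _ u]) simp
next
  case (Node x l r)
  show ?case
  proof (cases u)
    case Nil
    obtain k a w where *: "a \<in> set (addresses l)" "[] @ replicate k False = a @ w" using Node.IH(1) by blast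
    then show ?thesis using Nil by (intro exI[of _ "Suc k"] exI[of _ "False # a"] exI[of _ w]) auto
  next
    case (Cons b v)
    show ?thesis
    proof (cases b)
      case True
      obtain k a w where "a \<in> set (addresses r)" "v @ replicate k False = a @ w" using Node.IH(2) by blast
      then show ?thesis using Cons True by (intro exI[of _ k] exI[of _ "True # a"] exI[of _ w]) auto
    next
      case False
      obtain k a w where "a \<in> set (addresses l)" "v @ replicate k False = a @ w" using Node.IH(1) by blast
      then show ?thesis using Cons False by (intro exI[of _ k] exI[of _ "False # a"] exI[of _ w]) auto
    qed
  qed
qed

lemma zero_tail_replicate: "zero_tail_invariant c \<Longrightarrow> c (u @ replicate k False) = c u"
proof (induction k)
  case (Suc k)
  have "u @ replicate (Suc k) False = (u @ replicate k False) @ [False]"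
    by (simp add: replicate_append_same)
  then show ?case using Suc unfolding zero_tail_invariant_def by metis
qed simp

lemma zero_tail_left_end: "zero_tail_invariant (left_end n s)"
  by (simp add: zero_tail_invariant_def)

section \<open>Piecewise linear interpolation\<close>

definition interpolates :: "nat \<Rightarrow> (real \<Rightarrow> real) \<Rightarrow> bool list \<Rightarrow> bool list \<Rightarrow> bool" where
  "interpolates n f t s \<longleftrightarrow> (\<forall>z\<in>{left_end n 0 t..left_end n 0 t + width n 0 t}.
     f z = left_end n 0 s + (z - left_end n 0 t) * (width n 0 s / width n 0 t))"

text \<open>
  The linear pieces are glued one by one from the right; they agree at the common ends because both
  lists are adjacent.
\<close>
lemma interpolant_exists:
  assumes "n \<ge> 2" "covers n 0 ts x X" "covers n 0 ss y Y" "length ts = length ss"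
  shows "\<exists>f. f x = y \<and> f X = Y \<and> continuous_on {x..X} f \<and> strict_mono_on {x..X} f \<and>
    list_all2 (interpolates n f) ts ss"
  using assms(2-)
proof (induction ts arbitrary: ss x y)
  case Nil
  then show ?case by (intro exI[of _ "\<lambda>_. y"]) (auto simp: strict_mono_on_def)
next
  case (Cons t ts)
  then obtain s ss' where ss: "ss = s # ss'" by (cases ss) auto
  have t: "left_end n 0 t = x" "covers n 0 ts (x + width n 0 t) X" using Cons.prems by auto
  have s: "left_end n 0 s = y" "covers n 0 ss' (y + width n 0 s) Y" using Cons.prems ss by auto
  define m where "m = x + width n 0 t"
  define c where "c = width n 0 s / width n 0 t"
  have wt: "width n 0 t > 0" "width n 0 s > 0" using width_pos assms(1) by simp_all
  have c: "c > 0" using wt by (simp add: c_def)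
  obtain g where g: "g m = y + width n 0 s" "g X = Y" "continuous_on {m..X} g" "strict_mono_on {m..X} g"
    "list_all2 (interpolates n g) ts ss'"
    using Cons.IH[OF t(2) s(2)] Cons.prems(3) ss unfolding m_def by auto
  have mX: "m \<le> X"
  proof -
    have "0 \<le> sum_list (map (width n 0) ts)"
      by (rule sum_list_nonneg) (use width_pos[of 0 n] assms(1) in \<open>auto simp: less_imp_le\<close>)
    then show ?thesis using covers_sum[OF t(2)] by (simp add: m_def)
  qed
  define f where "f = (\<lambda>z. if z \<le> m then y + (z - x) * c else g z)"
  have "(m - x) * c = width n 0 s" using wt by (simp add: m_def c_def)
  then have fm: "y + (m - x) * c = g m" using g(1) by simp
  have f_right: "f z = g z" if "z \<ge> m" for z using that fm by (cases "z = m") (auto simp: f_def)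
  have "continuous_on {x..X} f"
    unfolding f_def
  proof (rule continuous_on_cases_le)
    show "continuous_on {z \<in> {x..X}. z \<le> m} (\<lambda>z. y + (z - x) * c)" by (intro continuous_intros)
    show "continuous_on {z \<in> {x..X}. m \<le> z} g" by (rule continuous_on_subset[OF g(3)]) auto
  qed (use fm in \<open>auto intro: continuous_intros\<close>)
  moreover have "strict_mono_on {x..X} f"
  proof (rule strict_mono_onI)
    fix a b assume ab: "a \<in> {x..X}" "b \<in> {x..X}" "a < b"
    consider "b \<le> m" | "m \<le> a" | "a < m" "m < b" using ab(3) by linarith
    then show "f a < f b"
    proof cases
      case 1
      then show ?thesis using ab c by (simp add: f_def)
    next
      case 2
      then show ?thesis using strict_mono_onD[OF g(4), of a b] ab f_right by simp
    next
      case 3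
      have "f a < g m" using 3 c fm[symmetric] by (simp add: f_def)
      also have "g m < g b" using strict_mono_onD[OF g(4), of m b] ab 3 mX by simp
      finally show ?thesis using f_right[of b] 3 by simp
    qed
  qed
  moreover have "interpolates n f t s"
    unfolding interpolates_def t s by (auto simp: f_def m_def c_def)
  moreover have "list_all2 (interpolates n f) ts ss'"
  proof -
    have "interpolates n f t' s'" if "t' \<in> set ts" "interpolates n g t' s'" for t' s'
    proof -
      have "m \<le> left_end n 0 t'" using covers_left[OF _ t(2) that(1)] assms(1) by (simp add: m_def)
      then show ?thesis using that(2) f_right unfolding interpolates_def by auto
    qed
    then show ?thesis using g(5) by (auto simp: list_all2_conv_all_nth)
  qed
  moreover have "f x = y" using wt by (simp add: f_def m_def)
  moreover have "f X = Y" using f_right[OF mX] g(2) by simp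
  ultimately show ?case using ss by (intro exI[of _ f]) simp
qed

lemma covers_locate:
  assumes "covers n 0 ts x X" "x \<le> a" "a < b" "b \<le> X" "left_end n 0 ` set ts \<inter> {a<..<b} = {}"
  shows "\<exists>t\<in>set ts. left_end n 0 t \<le> a \<and> b \<le> left_end n 0 t + width n 0 t"
  using assms
proof (induction ts arbitrary: x)
  case (Cons t ts)
  let ?m = "x + width n 0 t"
  have t: "left_end n 0 t = x" "covers n 0 ts ?m X" using Cons.prems by auto
  consider "b \<le> ?m" | "?m \<le> a" | "a < ?m" "?m < b" by linarith
  then show ?case
  proof cases
    case 1
    then show ?thesis using t Cons.prems by auto
  next
    case 2
    then show ?thesis using Cons.IH[OF t(2)] Cons.prems by auto
  next
    case 3
    then obtain t' ts' where "ts = t' # ts'" using t(2) Cons.prems by (cases ts) auto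
    then have "?m \<in> left_end n 0 ` set (t # ts)" using t(2) by auto
    then show ?thesis using Cons.prems(5) 3 by (metis disjoint_iff greaterThanLessThan_iff)
  qed
qed simp

text \<open>
  Words of phase 0 have intervals of length \<open>n\<^sup>-\<^sup>l\<close>, so the slopes are powers of \<open>n\<close>.
\<close>
lemma interpolant_in_F_group:
  assumes n: "n \<ge> 2" and ts: "covers n 0 ts 0 1" and ss: "covers n 0 ss 0 1"
    and ph: "list_all2 (\<lambda>t s. phase n 0 t = 0 \<and> phase n 0 s = 0) ts ss"
  shows "\<exists>f\<in>carrier (F_group n). list_all2 (interpolates n f) ts ss"
proof -
  have len: "length ts = length ss" using ph by (rule list_all2_lengthD)
  obtain g where g: "g 0 = 0" "g 1 = 1" "continuous_on {0..1} g" "strict_mono_on {0..1} g"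
    "list_all2 (interpolates n g) ts ss"
    using interpolant_exists[OF n ts ss len] by auto
  define f where "f = restrict g {0..1}"
  have fg: "f z = g z" if "z \<in> {0..1}" for z using that by (simp add: f_def)
  have in01: "z \<in> {0..1}" if "t \<in> set ts" "z \<in> {left_end n 0 t..left_end n 0 t + width n 0 t}" for t z
  proof -
    have "left_end n 0 t + width n 0 t \<le> 1" using right_end_le[of 0 n t] n by simp
    then show ?thesis using that(2) left_end_nonneg[of n 0 t] by auto
  qed
  have inter: "list_all2 (interpolates n f) ts ss"
    unfolding list_all2_conv_all_nth
  proof (intro conjI allI impI)
    fix i assume i: "i < length ts"
    have "interpolates n g (ts ! i) (ss ! i)" using g(5) i by (simp add: list_all2_conv_all_nth)
    moreover have "f z = g z" if "z \<in> {left_end n 0 (ts ! i)..left_end n 0 (ts ! i) + width n 0 (ts ! i)}" for z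
      using fg in01[OF nth_mem[OF i] that] by simp
    ultimately show "interpolates n f (ts ! i) (ss ! i)" unfolding interpolates_def by simp
  qed (rule len)
  have "f \<in> carrier (F_group n)"
    unfolding carrier_F_group
  proof (intro conjI)
    show "f \<in> extensional {0..1}" by (simp add: f_def)
    have cont: "continuous_on {0..1} f" using g(3) fg continuous_on_cong by metis
    show sm: "strict_mono_on {0..1} f" using g(4) fg by (auto simp: strict_mono_on_def)
    have im: "f ` {0..1} = {0..1}"
    proof (intro equalityI subsetI)
      fix z assume "z \<in> f ` {0..1}"
      then obtain a where a: "a \<in> {0..1}" "z = f a" by blast
      have "f 0 \<le> f a" using strict_mono_onD[OF sm, of 0 a] a(1) by (cases "a = 0") auto
      moreover have "f a \<le> f 1" using strict_mono_onD[OF sm, of a 1] a(1) by (cases "a = 1") auto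
      ultimately show "z \<in> {0..1}" using g fg a by simp
    next
      fix z :: real assume "z \<in> {0..1}"
      then show "z \<in> f ` {0..1}" using IVT'[of f 0 z 1] g(1,2) fg cont by auto
    qed
    have "inj_on f {0..1}" using sm by (rule strict_mono_on_imp_inj_on)
    then show "\<exists>h. homeomorphism {0..1} {0..1} f h"
      using homeomorphism_compact[OF _ cont im] compact_Icc by blast
    have "breaks_in n f (left_end n 0 ` set ts)"
      unfolding breaks_in_def
    proof (intro conjI allI impI)
      show "left_end n 0 ` set ts \<subseteq> n_adic n" using left_end_n_adic[OF n] by auto
      fix a b :: real assume ab: "0 \<le> a \<and> a < b \<and> b \<le> 1 \<and> left_end n 0 ` set ts \<inter> {a<..<b} = {}"
      then obtain t where t: "t \<in> set ts" "left_end n 0 t \<le> a" "b \<le> left_end n 0 t + width n 0 t"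
        using covers_locate[OF ts, of a b] by auto
      then obtain i where i: "i < length ts" "ts ! i = t" by (metis in_set_conv_nth)
      let ?s = "ss ! i"
      have "phase n 0 t = 0" "phase n 0 ?s = 0" using ph i by (auto simp: list_all2_conv_all_nth)
      then have w: "width n 0 ?s / width n 0 t = real n powi (int (level n 0 t) - int (level n 0 ?s))"
        using width_phase_0[OF n] n by (simp add: power_int_diff)
      have "interpolates n f t ?s" using inter i by (auto simp: list_all2_conv_all_nth)
      then have "\<forall>z\<in>{a..b}. f z = real n powi (int (level n 0 t) - int (level n 0 ?s)) * z
          + (left_end n 0 ?s - left_end n 0 t * real n powi (int (level n 0 t) - int (level n 0 ?s)))"
        using t(2,3) unfolding interpolates_def w by (auto simp: algebra_simps)
      then show "affine_on n f a b" unfolding affine_on_def by blast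
    qed simp
    then show "n_adic_piecewise_linear n f" by (auto simp: piecewise_iff_breaks)
  qed
  then show ?thesis using inter by blast
qed

lemma interpolates_word:
  assumes "n \<ge> 2" "interpolates n f t s" "phase n 0 t = 0" "phase n 0 s = 0"
  shows "f (left_end n 0 (t @ w)) = left_end n 0 (s @ w)"
proof -
  have wt: "width n 0 t = 1 / real n ^ level n 0 t" "width n 0 s = 1 / real n ^ level n 0 s"
    using width_phase_0 assms by simp_all
  have l: "left_end n 0 (t @ w) = left_end n 0 t + left_end n 0 w * width n 0 t"
    "left_end n 0 (s @ w) = left_end n 0 s + left_end n 0 w * width n 0 s"
    by (simp_all add: left_end_append assms wt)
  have pos: "width n 0 t > 0" using width_pos assms(1) by simp
  have "0 \<le> left_end n 0 w" "left_end n 0 w \<le> 1"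
    using left_end_nonneg left_end_less_1[OF assms(1)] by (auto simp: less_imp_le)
  then have "left_end n 0 (t @ w) \<in> {left_end n 0 t..left_end n 0 t + width n 0 t}"
    unfolding l using pos by (auto simp: mult_left_le_one_le)
  then have "f (left_end n 0 (t @ w)) = left_end n 0 s + (left_end n 0 (t @ w) - left_end n 0 t) * (width n 0 s / width n 0 t)"
    using assms(2) unfolding interpolates_def by blast
  also have "\<dots> = left_end n 0 (s @ w)" unfolding l using pos by simp
  finally show ?thesis .
qed

section \<open>Uniform subdivisions for elements of the group\<close>

lemma eventually_n_adic_multiple:
  assumes "n > 0" "x \<in> n_adic n"
  shows "\<forall>\<^sub>F M in sequentially. x * real n ^ M \<in> \<int>"
proof -
  obtain a k where x: "x = of_int a / real n ^ k" using assms(2) by (auto simp: n_adic_def)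
  have "x * real n ^ M \<in> \<int>" if "M \<ge> k" for M
  proof -
    have "x * real n ^ M = of_int a * real n ^ (M - k)"
      using that assms(1) by (simp add: x power_diff)
    also have "\<dots> = of_int (a * int n ^ (M - k))" by simp
    finally show ?thesis by (metis Ints_of_int)
  qed
  then show ?thesis unfolding eventually_sequentially by blast
qed

text \<open>
  If the mesh \<open>n\<^sup>-\<^sup>K\<close> is fine enough, the breaks are among the points of subdivision, and even the steepest
  piece maps each part onto an interval whose length divides its left end.
\<close>
lemma uniform_subdivision:
  assumes n: "n \<ge> 2" and f: "f \<in> carrier (F_group n)"
  shows "\<exists>K. \<forall>a<n ^ K. \<exists>l b. b < n ^ l \<and> f (real a / real n ^ K) = real b / real n ^ l \<and>
    (\<forall>x\<in>{real a / real n ^ K..real (Suc a) / real n ^ K}.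
      f x = real b / real n ^ l + (x - real a / real n ^ K) * (real n ^ K / real n ^ l))"
proof -
  obtain xs where xs: "subdivision n f xs"
    using f by (auto simp: carrier_F_group piecewise_iff_subdivision)
  have "\<forall>i. \<exists>(k :: int) c. Suc i < length xs \<longrightarrow> (\<forall>x\<in>{xs ! i..xs ! Suc i}. f x = real n powi k * x + c)"
    using xs unfolding subdivision_def by blast
  then obtain k :: "nat \<Rightarrow> int" and c where kc:
    "\<And>i x. Suc i < length xs \<Longrightarrow> x \<in> {xs ! i..xs ! Suc i} \<Longrightarrow> f x = real n powi k i * x + c i"
    by metis
  have x01: "xs ! i \<in> {0..1}" "xs ! i \<in> n_adic n" if "i < length xs" for i
  proof -
    show "xs ! i \<in> n_adic n" using xs that unfolding subdivision_def by (meson nth_mem subsetD)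
    have mono: "xs ! i \<le> xs ! j" if "i \<le> j" "j < length xs" for i j
      using that xs by (cases "i = j") (auto simp: subdivision_def sorted_wrt_nth_less less_imp_le)
    have "xs ! 0 = 0" "xs ! (length xs - 1) = 1"
      using xs by (auto simp: subdivision_def hd_conv_nth last_conv_nth)
    then show "xs ! i \<in> {0..1}" using mono[of 0 i] mono[of i "length xs - 1"] that by auto
  qed
  have "\<forall>\<^sub>F M in sequentially. \<forall>i\<in>{..<length xs}.
      xs ! i * real n ^ M \<in> \<int> \<and> f (xs ! i) * real n ^ M \<in> \<int> \<and> \<bar>k i\<bar> \<le> int M"
  proof (rule eventually_ball_finite)
    show "\<forall>i\<in>{..<length xs}. \<forall>\<^sub>F M in sequentially.
        xs ! i * real n ^ M \<in> \<int> \<and> f (xs ! i) * real n ^ M \<in> \<int> \<and> \<bar>k i\<bar> \<le> int M"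
    proof
      fix i assume "i \<in> {..<length xs}"
      then have i: "i < length xs" by simp
      have "\<forall>\<^sub>F M in sequentially. \<bar>k i\<bar> \<le> int M"
        unfolding eventually_sequentially by (intro exI[of _ "nat \<bar>k i\<bar>"]) auto
      moreover have "\<forall>\<^sub>F M in sequentially. xs ! i * real n ^ M \<in> \<int>"
        using eventually_n_adic_multiple x01(2)[OF i] n by simp
      moreover have "\<forall>\<^sub>F M in sequentially. f (xs ! i) * real n ^ M \<in> \<int>"
        using eventually_n_adic_multiple F_group_n_adic(1)[OF n f x01[OF i]] n by simp
      ultimately show "\<forall>\<^sub>F M in sequentially.
        xs ! i * real n ^ M \<in> \<int> \<and> f (xs ! i) * real n ^ M \<in> \<int> \<and> \<bar>k i\<bar> \<le> int M"
        by eventually_elim simp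
    qed
  qed simp
  then obtain M where M: "\<And>i. i < length xs \<Longrightarrow> xs ! i * real n ^ M \<in> \<int>"
    "\<And>i. i < length xs \<Longrightarrow> f (xs ! i) * real n ^ M \<in> \<int>" "\<And>i. i < length xs \<Longrightarrow> \<bar>k i\<bar> \<le> int M"
    unfolding eventually_sequentially by (meson lessThan_iff order_refl)
  \<comment> \<open>The image of a part in a piece with slope \<open>n\<^sup>k\<close> has length \<open>n\<^sup>k\<^sup>-\<^sup>K\<close>. As \<open>k\<close> is at most \<open>M\<close>, the
    exponent satisfies \<open>K - k \<ge> M\<close>, so that this length divides the images of the breaks.\<close>
  define K where "K = 2 * M"
  let ?N = "real n ^ K"
  have Npos: "?N > 0" using n by simp
  have int_up: "y * real n ^ L \<in> \<int>" if "y * real n ^ M \<in> \<int>" "L \<ge> M" for y L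
  proof -
    have "real n ^ L = real n ^ M * real n ^ (L - M)"
      using that(2) by (simp add: power_add[symmetric])
    then have "y * real n ^ L = (y * real n ^ M) * real n ^ (L - M)" by (simp only: mult.assoc)
    moreover have "real n ^ (L - M) \<in> \<int>" by (intro Ints_power Ints_of_nat)
    ultimately show ?thesis using Ints_mult[OF that(1)] by metis
  qed
  have "\<exists>l b. b < n ^ l \<and> f (real a / ?N) = real b / real n ^ l \<and>
    (\<forall>x\<in>{real a / ?N..real (Suc a) / ?N}.
      f x = real b / real n ^ l + (x - real a / ?N) * (?N / real n ^ l))" if a: "a < n ^ K" for a
  proof -
    let ?p = "real a / ?N" and ?q = "real (Suc a) / ?N"
    have pq: "0 \<le> ?p" "?p < ?q" using Npos by (simp_all add: divide_strict_right_mono)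
    have "real (Suc a) \<le> ?N" using a by (metis Suc_leI of_nat_le_iff of_nat_power)
    then have q1: "?q \<le> 1" using Npos by simp
    have "set xs \<inter> {?p<..<?q} = {}"
    proof (rule Int_emptyI)
      fix y assume y: "y \<in> set xs" "y \<in> {?p<..<?q}"
      then obtain i where "i < length xs" "y = xs ! i" by (metis in_set_conv_nth)
      then have "y * ?N \<in> \<int>" using int_up M(1) by (simp add: K_def)
      then obtain j where j: "y * ?N = of_int j" by (auto elim: Ints_cases)
      have "real a < y * ?N" "y * ?N < real (Suc a)"
        using y(2) Npos by (simp_all add: pos_divide_less_eq pos_less_divide_eq)
      then have "int a < j" "j < int a + 1" unfolding j by linarith+
      then show False by simp
    qed
    then obtain i where i: "Suc i < length xs" "xs ! i \<le> ?p" "?q \<le> xs ! Suc i"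
      using sorted_locate[of xs ?p ?q] xs pq q1 unfolding subdivision_def by auto
    define l where "l = nat (int K - k i)"
    have ki: "\<bar>k i\<bar> \<le> int M" using M(3) i by simp
    then have l: "int l = int K - k i" "l \<ge> M" by (auto simp: l_def K_def)
    have slope: "real n powi k i = ?N / real n ^ l"
    proof -
      have "k i = int K - int l" using l by simp
      then show ?thesis using n by (simp add: power_int_diff)
    qed
    have fx: "f x = f (xs ! i) + (?N / real n ^ l) * (x - xs ! i)" if "x \<in> {?p..?q}" for x
    proof -
      have "f x = real n powi k i * x + c i" "f (xs ! i) = real n powi k i * xs ! i + c i"
        using kc[OF i(1), of x] kc[OF i(1), of "xs ! i"] i that pq by auto
      moreover define d where "d = ?N / real n ^ l"
      ultimately show ?thesis unfolding slope d_def[symmetric] by (simp add: right_diff_distrib)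
    qed
    have lpos: "real n ^ l > 0" using n by simp
    have "f ?p * real n ^ l = f (xs ! i) * real n ^ l + (real a - xs ! i * ?N)"
    proof -
      have "(F + (P / Q) * (y / P - z)) * Q = F * Q + (y - z * P)" if "P > 0" "Q > 0" for F P Q y z :: real
        using that by (simp add: field_simps)
      from this[OF Npos lpos] show ?thesis using fx[of ?p] pq by simp
    qed
    moreover have "f (xs ! i) * real n ^ l \<in> \<int>" using int_up[OF M(2)] l i by simp
    moreover have "xs ! i * ?N \<in> \<int>" using int_up[OF M(1)] i by (simp add: K_def)
    ultimately have "f ?p * real n ^ l \<in> \<int>" by (simp add: Ints_add Ints_diff)
    then obtain j where j: "f ?p * real n ^ l = of_int j" by (auto elim: Ints_cases)
    have p01: "?p \<in> {0..1}" using pq q1 by auto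
    have "f ?p \<ge> 0" using F_group_range[OF f p01] by simp
    then have "of_int j \<ge> (0 :: real)" using j lpos by (metis mult_nonneg_nonneg less_imp_le)
    then have j0: "j \<ge> 0" by simp
    define b where "b = nat j"
    have b: "f ?p = real b / real n ^ l" using j j0 lpos by (simp add: b_def field_simps)
    have "f ?p < f 1"
      using strict_mono_onD[OF F_group_basic(3)[OF f], of ?p 1] p01 pq q1 by simp
    then have "real b < real (n ^ l)" using b lpos F_group_basic(5)[OF f] by simp
    then have "b < n ^ l" by (simp only: of_nat_less_iff)
    moreover have "\<forall>x\<in>{?p..?q}. f x = real b / real n ^ l + (x - ?p) * (?N / real n ^ l)"
    proof
      fix x assume x: "x \<in> {?p..?q}"
      have "F1 = F2 + (y - p) * d" if "F1 = F0 + d * (y - z)" "F2 = F0 + d * (p - z)" for F0 F1 F2 y p z d :: real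
        using that by (simp add: algebra_simps)
      from this[OF fx[OF x] fx[of ?p]] show "f x = real b / real n ^ l + (x - ?p) * (?N / real n ^ l)"
        unfolding b using pq by simp
    qed
    ultimately show ?thesis using b by blast
  qed
  then show ?thesis by blast
qed

section \<open>From piecewise linear maps to diagrams\<close>

text \<open>
  Vertices are positions between leaves, and the label of an inner node is \<open>k\<close>; so two trees that
  are decorated with different positive \<open>k\<close> share only their leaves.
\<close>
fun decorate :: "nat \<Rightarrow> nat \<Rightarrow> 'a tree \<Rightarrow> edge tree" where
  "decorate k i (Leaf x) = Leaf (Edge i 0 (Suc i))"
| "decorate k i (Node x l r) = Node (Edge i k (i + length (leaf_labels l) + length (leaf_labels r)))
     (decorate k i l) (decorate k (i + length (leaf_labels l)) r)"

lemma decorate_leaves: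
  "leaf_labels (decorate k i t) = map (\<lambda>j. Edge j 0 (Suc j)) [i..<i + length (leaf_labels t)]"
proof (induction k i t rule: decorate.induct)
  case (2 k i x l r)
  have "[i..<i + length (leaf_labels l) + length (leaf_labels r)] = [i..<i + length (leaf_labels l)]
      @ [i + length (leaf_labels l)..<i + length (leaf_labels l) + length (leaf_labels r)]"
    by (rule upt_add_eq_append) simp
  then show ?case using 2 by (simp add: add.assoc[symmetric])
qed simp

lemma length_leaves_pos: "length (leaf_labels t) > 0"
  by simp

lemma decorate_root: "source (root_label (decorate k i t)) = i"
  "target (root_label (decorate k i t)) = i + length (leaf_labels t)"
  by (induction k i t rule: decorate.induct) auto

lemma decorate_plane: "plane_tree (decorate k i t)"
  by (induction k i t rule: decorate.induct) (auto simp: triangle_def decorate_root)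

lemma decorate_addresses: "addresses (decorate k i t) = addresses t"
  by (induction k i t rule: decorate.induct) auto

lemma decorate_nodes: "e \<in> set (node_labels (decorate k i t)) \<Longrightarrow>
    i \<le> source e \<and> source e < target e \<and> target e \<le> i + length (leaf_labels t) \<and> label e = k"
proof (induction k i t rule: decorate.induct)
  case (2 k i x l r)
  then show ?case using length_leaves_pos[of l] length_leaves_pos[of r] by (fastforce simp del: length_greater_0_conv)
qed simp

lemma decorate_distinct: "distinct (node_labels (decorate k i t))"
proof (induction k i t rule: decorate.induct)
  case (2 k i x l r)
  let ?e = "Edge i k (i + length (leaf_labels l) + length (leaf_labels r))"
  have pos: "length (leaf_labels l) > 0" "length (leaf_labels r) > 0" by simp_all
  have "?e \<notin> set (node_labels (decorate k i l))"
    using decorate_nodes[of ?e k i l] pos by (auto simp del: length_greater_0_conv)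
  moreover have "?e \<notin> set (node_labels (decorate k (i + length (leaf_labels l)) r))"
    using decorate_nodes[of ?e k "i + length (leaf_labels l)" r] pos by (auto simp del: length_greater_0_conv)
  moreover have "set (node_labels (decorate k i l)) \<inter> set (node_labels (decorate k (i + length (leaf_labels l)) r)) = {}"
  proof (rule Int_emptyI)
    fix e assume "e \<in> set (node_labels (decorate k i l))" "e \<in> set (node_labels (decorate k (i + length (leaf_labels l)) r))"
    from decorate_nodes[OF this(1)] decorate_nodes[OF this(2)] show False by simp
  qed
  ultimately show ?case using 2 by simp
qed simp

lemma decorate_matching:
  assumes "length (leaf_labels t) = length (leaf_labels s)"
  shows "matching_pair (decorate 1 0 t) (decorate 2 0 s)"
  unfolding matching_forests_def
proof (intro conjI ballI)
  show "plane_tree (decorate 1 0 t)" by (rule decorate_plane)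
  show "plane_tree x" if "x \<in> set [decorate 2 0 s]" for x using that decorate_plane by auto
  show "concat (map leaf_labels [decorate 2 0 s]) = leaf_labels (decorate 1 0 t)"
    using assms by (simp add: decorate_leaves)
  have lab: "label e = 0" if "e \<in> set (leaf_labels (decorate k 0 t))" for e k
    using that by (auto simp: decorate_leaves)
  have "distinct (leaf_labels (decorate 1 0 t))"
    by (auto simp: decorate_leaves distinct_map inj_on_def)
  moreover have "set (node_labels (decorate 1 0 t)) \<inter> set (leaf_labels (decorate 1 0 t)) = {}"
    using decorate_nodes[of _ 1 0 t] lab[of _ 1] by fastforce
  moreover have "set (node_labels (decorate 2 0 s)) \<inter> set (leaf_labels (decorate 1 0 t)) = {}"
    using decorate_nodes[of _ 2 0 s] lab[of _ 1] by fastforce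
  moreover have "set (node_labels (decorate 1 0 t)) \<inter> set (node_labels (decorate 2 0 s)) = {}"
    using decorate_nodes[of _ 1 0 t] decorate_nodes[of _ 2 0 s] by fastforce
  ultimately show "distinct (node_labels (decorate 1 0 t) @ leaf_labels (decorate 1 0 t) @
      concat (map node_labels [decorate 2 0 s]))"
    using decorate_distinct[of 1 0 t] decorate_distinct[of 2 0 s] by (auto simp: Int_commute)
  have path: "i \<le> j \<Longrightarrow> is_path i (map (\<lambda>j. Edge j 0 (Suc j)) [i..<j]) j" for i j
    by (induction "j - i" arbitrary: i) (auto simp: upt_conv_Cons)
  have "simple_path 0 (leaf_labels (decorate 1 0 t)) (length (leaf_labels t))"
    unfolding simple_path_def
  proof (intro conjI)
    show "is_path 0 (leaf_labels (decorate 1 0 t)) (length (leaf_labels t))"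
      using path[of 0 "length (leaf_labels t)"] by (simp add: decorate_leaves)
    show "distinct (0 # map target (leaf_labels (decorate 1 0 t)))"
      by (auto simp: decorate_leaves o_def distinct_map)
  qed simp
  then show "\<exists>u v. simple_path u (leaf_labels (decorate 1 0 t)) v" by blast
qed

lemma covers_upt:
  assumes "\<And>i. i < N \<Longrightarrow> left_end n 0 (w i) = x i \<and> left_end n 0 (w i) + width n 0 (w i) = x (Suc i)"
  shows "covers n 0 (map w [0..<N]) (x 0) (x N)"
  using assms
proof (induction N)
  case (Suc N)
  have "covers n 0 (map w [0..<N]) (x 0) (x N)"
    by (rule Suc.IH, rule Suc.prems) simp
  then show ?case using Suc.prems[of N] by (auto simp: covers_append)
qed simp

text \<open>
  Code the parts of a uniform subdivision and their images by words of phase 0. Both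
  lists of words cover \<open>[0,1]\<close>, so they are the leaves of two trees.
\<close>
lemma diagram_of_F_group:
  assumes n: "n \<ge> 2" and f: "f \<in> carrier (F_group n)"
  shows "\<exists>D. F_shaped D \<and> transports D (left_end n 0) (f \<circ> left_end n 0)"
proof -
  obtain K where "\<forall>a<n ^ K. \<exists>l b. b < n ^ l \<and> f (real a / real n ^ K) = real b / real n ^ l \<and>
    (\<forall>x\<in>{real a / real n ^ K..real (Suc a) / real n ^ K}.
      f x = real b / real n ^ l + (x - real a / real n ^ K) * (real n ^ K / real n ^ l))"
    using uniform_subdivision[OF n f] by blast
  then obtain l b where lb: "\<And>a. a < n ^ K \<Longrightarrow> b a < n ^ l a"
    "\<And>a. a < n ^ K \<Longrightarrow> f (real a / real n ^ K) = real (b a) / real n ^ l a"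
    "\<And>a x. a < n ^ K \<Longrightarrow> x \<in> {real a / real n ^ K..real (Suc a) / real n ^ K} \<Longrightarrow>
      f x = real (b a) / real n ^ l a + (x - real a / real n ^ K) * (real n ^ K / real n ^ l a)"
    by metis
  let ?N = "n ^ K"
  have pos: "real n ^ k > 0" for k using n by simp
  have "\<exists>w. a < ?N \<longrightarrow> phase n 0 w = 0 \<and> level n 0 w = K \<and> left_end n 0 w = real a / real n ^ K" for a
    using standard_word[OF n, of a K] by blast
  then obtain u where u: "\<And>a. a < ?N \<Longrightarrow> phase n 0 (u a) = 0 \<and> level n 0 (u a) = K \<and> left_end n 0 (u a) = real a / real n ^ K"
    by metis
  have "\<exists>w. a < ?N \<longrightarrow> phase n 0 w = 0 \<and> level n 0 w = l a \<and> left_end n 0 w = real (b a) / real n ^ l a" for a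
    using standard_word[OF n lb(1), of a] by (cases "a < ?N") simp_all
  then obtain v where v: "\<And>a. a < ?N \<Longrightarrow> phase n 0 (v a) = 0 \<and> level n 0 (v a) = l a \<and> left_end n 0 (v a) = real (b a) / real n ^ l a"
    by metis
  have wu: "width n 0 (u a) = 1 / real n ^ K" and wv: "width n 0 (v a) = 1 / real n ^ l a" if "a < ?N" for a
    using width_phase_0[OF n] u[OF that] v[OF that] by simp_all
  have cu: "covers n 0 (map u [0..<?N]) (real 0 / real n ^ K) (real ?N / real n ^ K)"
    by (rule covers_upt[where x = "\<lambda>a. real a / real n ^ K"]) (simp add: u wu add_divide_distrib)
  have cv: "covers n 0 (map v [0..<?N]) (f (real 0 / real n ^ K)) (f (real ?N / real n ^ K))"
  proof (rule covers_upt[where x = "\<lambda>a. f (real a / real n ^ K)"])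
    fix a assume a: "a < ?N"
    have "f (real (Suc a) / real n ^ K) = real (b a) / real n ^ l a
        + (real (Suc a) / real n ^ K - real a / real n ^ K) * (real n ^ K / real n ^ l a)"
      by (rule lb(3)[OF a]) (use pos[of K] in \<open>simp add: divide_right_mono\<close>)
    also have "(real (Suc a) / real n ^ K - real a / real n ^ K) * (real n ^ K / real n ^ l a) = 1 / real n ^ l a"
    proof -
      have "real (Suc a) / real n ^ K - real a / real n ^ K = 1 / real n ^ K"
        by (simp add: diff_divide_distrib[symmetric])
      then show ?thesis using n by simp
    qed
    finally show "left_end n 0 (v a) = f (real a / real n ^ K) \<and>
        left_end n 0 (v a) + width n 0 (v a) = f (real (Suc a) / real n ^ K)"
      using v[OF a] wv[OF a] lb(2)[OF a] by simp
  qed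
  have one: "real ?N / real n ^ K = 1" using n by simp
  have "\<exists>t :: unit tree. addresses t = map u [0..<?N]"
    using tree_of_cover[of 0 n] cu n unfolding one by simp
  then obtain t :: "unit tree" where t: "addresses t = map u [0..<?N]" by blast
  have "\<exists>s :: unit tree. addresses s = map v [0..<?N]"
    using tree_of_cover[of 0 n] cv n F_group_basic(4,5)[OF f] unfolding one by simp
  then obtain s :: "unit tree" where s: "addresses s = map v [0..<?N]" by blast
  have len: "length (leaf_labels t) = ?N" "length (leaf_labels s) = ?N"
    using length_addresses[of t] length_addresses[of s] t s by simp_all
  define T S where "T = decorate 1 0 t" and "S = decorate 2 0 s"
  have M: "matching_pair T S" unfolding T_def S_def using decorate_matching len by metis
  let ?D = "pair_diagram T S"
  have F: "F_shaped ?D" using F_shaped_pair_diagram[OF M] .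
  obtain \<beta> where \<beta>: "transports ?D (left_end n 0) \<beta>"
    using transports_exists[OF F zero_tail_left_end] by blast
  have "\<beta> w = (f \<circ> left_end n 0) w" for w
  proof -
    obtain k x w' where x: "x \<in> set (addresses t)" "w @ replicate k False = x @ w'"
      using addresses_complete by blast
    then obtain a where a: "a < ?N" "x = u a" using t by auto
    have "\<beta> (addresses T ! a @ w') = left_end n 0 (addresses S ! a @ w')"
      by (rule transports_pair[OF M \<beta>]) (use a len in \<open>simp add: T_def decorate_leaves\<close>)
    then have "\<beta> (x @ w') = left_end n 0 (v a @ w')"
      using a by (simp add: T_def S_def decorate_addresses t s)
    also have "interpolates n f (u a) (v a)"
      unfolding interpolates_def
    proof
      fix z assume "z \<in> {left_end n 0 (u a)..left_end n 0 (u a) + width n 0 (u a)}"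
      then have "z \<in> {real a / real n ^ K..real (Suc a) / real n ^ K}"
        using u[OF a(1)] wu[OF a(1)] by (simp add: add_divide_distrib)
      then show "f z = left_end n 0 (v a) + (z - left_end n 0 (u a)) * (width n 0 (v a) / width n 0 (u a))"
        using lb(3)[OF a(1)] u[OF a(1)] v[OF a(1)] wu[OF a(1)] wv[OF a(1)] by simp
    qed
    then have "left_end n 0 (v a @ w') = f (left_end n 0 (u a @ w'))"
      using interpolates_word[OF n] u[OF a(1)] v[OF a(1)] by simp
    finally have "\<beta> (w @ replicate k False) = f (left_end n 0 (w @ replicate k False))"
      using x a by simp
    then show ?thesis
      using zero_tail_replicate[OF transports_zero_tail(2)[OF F \<beta>]] by simp
  qed
  then have "\<beta> = f \<circ> left_end n 0" by (rule ext)
  then show ?thesis using F \<beta> by blast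
qed

section \<open>From good diagrams to piecewise linear maps\<close>

text \<open>
  Right combs complete an incomplete code of a digit in all possible ways.
\<close>
fun comb :: "nat \<Rightarrow> unit tree" where
  "comb 0 = Leaf ()"
| "comb (Suc k) = Node () (Leaf ()) (comb k)"

lemma comb_phase: "p \<ge> 1 \<Longrightarrow> p + k + 1 = n \<Longrightarrow> k \<ge> 1 \<Longrightarrow> v \<in> set (addresses (comb k)) \<Longrightarrow> phase n p v = 0"
proof (induction k arbitrary: p v)
  case (Suc k)
  then consider "v = [False]" | v' where "v = True # v'" "v' \<in> set (addresses (comb k))" by auto
  then show ?case
  proof cases
    case 2
    show ?thesis
    proof (cases "k = 0")
      case True
      then show ?thesis using 2 Suc.prems by simp
    next
      case False
      then show ?thesis using 2 Suc.IH[of "Suc p" v'] Suc.prems by simp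
    qed
  qed simp
qed simp

definition completion :: "nat \<Rightarrow> bool list \<Rightarrow> unit tree" where
  "completion n w = (if phase n 0 w = 0 then Leaf () else comb (n - 1 - phase n 0 w))"

lemma completion_phase:
  assumes "n \<ge> 2" "v \<in> set (addresses (completion n w))" shows "phase n 0 (w @ v) = 0"
proof (cases "phase n 0 w = 0")
  case True
  then show ?thesis using assms by (simp add: completion_def)
next
  case False
  have "phase n 0 w + 2 \<le> n" using phase_bound[of 0 n w] assms(1) by simp
  then show ?thesis
    using comb_phase[of "phase n 0 w" "n - 1 - phase n 0 w" n v] assms False
    by (simp add: completion_def phase_append)
qed

lemma covers_concat:
  "covers n 0 (map h ps) x y \<Longrightarrow>
   (\<And>p. p \<in> set ps \<Longrightarrow> covers n 0 (g p) (left_end n 0 (h p)) (left_end n 0 (h p) + width n 0 (h p))) \<Longrightarrow>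
   covers n 0 (concat (map g ps)) x y"
proof (induction ps arbitrary: x)
  case (Cons p ps)
  then show ?case by (auto simp: covers_append)
qed simp

lemma list_all2_concat:
  "(\<And>p. p \<in> set ps \<Longrightarrow> list_all2 Q (g p) (h p)) \<Longrightarrow> list_all2 Q (concat (map g ps)) (concat (map h ps))"
  by (induction ps) (auto intro: list_all2_appendI)

text \<open>
  A width is the difference of two consecutive left ends, the last one being completed by 1.
\<close>
lemma widths_residue:
  assumes n: "n \<ge> 2"
  shows "covers n 0 ts x 1 \<Longrightarrow> covers n 0 ss y 1 \<Longrightarrow>
    list_all2 (\<lambda>t s. residue_eq n (left_end n 0 t) (left_end n 0 s)) ts ss \<Longrightarrow>
    list_all2 (\<lambda>t s. residue_eq n (width n 0 t) (width n 0 s)) ts ss"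
proof (induction ts arbitrary: ss x y)
  case (Cons t ts)
  then obtain s ss' where ss: "ss = s # ss'" by (cases ss) auto
  have t: "left_end n 0 t = x" "covers n 0 ts (x + width n 0 t) 1" using Cons.prems by auto
  have s: "left_end n 0 s = y" "covers n 0 ss' (y + width n 0 s) 1" using Cons.prems ss by auto
  have l: "list_all2 (\<lambda>t s. residue_eq n (left_end n 0 t) (left_end n 0 s)) ts ss'"
    using Cons.prems ss by simp
  have R: "residue_eq n (x + width n 0 t) (y + width n 0 s)"
  proof (cases ts)
    case Nil
    then show ?thesis using t s l by simp
  next
    case (Cons t' ts')
    then obtain s' ss'' where "ss' = s' # ss''" using l by (cases ss') auto
    then show ?thesis using t s l Cons by simp
  qed
  have R': "residue_eq n x y" using Cons.prems(3) ss t s by simp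
  have "residue_eq n (x + width n 0 t - x) (y + width n 0 s - y)"
    by (rule residue_eq_diff[OF _ R R']) (use n in simp)
  then have "residue_eq n (width n 0 t) (width n 0 s)" by simp
  then show ?case using Cons.IH[OF t(2) s(2) l] ss by simp
qed simp

text \<open>
  Extend both trees at corresponding leaves by the tree that completes the leaf of \<open>T\<close>. Then the leaves
  on the side of \<open>T\<close> have phase 0 and, by the residues of the widths, so have those on the side of
  \<open>S\<close>.
\<close>
lemma F_group_of_good_diagram:
  assumes n: "n \<ge> 2" and M: "matching_pair T S" and good: "good (n - 1) (pair_diagram T S)"
    and tr: "transports (pair_diagram T S) (left_end n 0) \<beta>"
  shows "\<exists>f\<in>carrier (F_group n). \<beta> = f \<circ> left_end n 0"
proof -
  have len: "length (addresses S) = length (addresses T)" using matching_pairD(3)[OF M] by simp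
  define ps where "ps = zip (addresses T) (addresses S)"
  define ts where "ts = concat (map (\<lambda>p. map (\<lambda>v. fst p @ v) (addresses (completion n (fst p)))) ps)"
  define ss where "ss = concat (map (\<lambda>p. map (\<lambda>v. snd p @ v) (addresses (completion n (fst p)))) ps)"
  have mp: "map fst ps = addresses T" "map snd ps = addresses S" using len by (simp_all add: ps_def)
  have ct: "covers n 0 ts 0 1" unfolding ts_def
    by (rule covers_concat[of n fst]) (use mp covers_all[OF n, of T] covers_addresses[OF n] in simp_all)
  have cs: "covers n 0 ss 0 1" unfolding ss_def
    by (rule covers_concat[of n snd]) (use mp covers_all[OF n, of S] covers_addresses[OF n] in simp_all)
  have pair: "ones (fst p) mod (n - 1) = ones (snd p) mod (n - 1)"
    "\<beta> (fst p @ w) = left_end n 0 (snd p @ w)" if p: "p \<in> set ps" for p w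
  proof -
    obtain i where i: "i < length (leaf_labels T)" "p = (addresses T ! i, addresses S ! i)"
      using p len by (auto simp: ps_def set_zip)
    show "ones (fst p) mod (n - 1) = ones (snd p) mod (n - 1)"
      using good i good_pair_diagram[OF M] by simp
    show "\<beta> (fst p @ w) = left_end n 0 (snd p @ w)" using transports_pair[OF M tr i(1)] i(2) by simp
  qed
  have all: "list_all2 (\<lambda>t s. phase n 0 t = 0 \<and> residue_eq n (left_end n 0 t) (left_end n 0 s) \<and>
      (\<forall>w. \<beta> (t @ w) = left_end n 0 (s @ w))) ts ss"
    unfolding ts_def ss_def
  proof (rule list_all2_concat)
    fix p assume p: "p \<in> set ps"
    have "phase n 0 (fst p @ v) = 0 \<and> residue_eq n (left_end n 0 (fst p @ v)) (left_end n 0 (snd p @ v)) \<and>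
        (\<forall>w. \<beta> ((fst p @ v) @ w) = left_end n 0 ((snd p @ v) @ w))"
      if v: "v \<in> set (addresses (completion n (fst p)))" for v
    proof (intro conjI allI)
      show "phase n 0 (fst p @ v) = 0" using completion_phase[OF n v] .
      have "ones (fst p @ v) mod (n - 1) = ones (snd p @ v) mod (n - 1)"
        using pair(1)[OF p] by (simp, metis mod_add_left_eq)
      then show "residue_eq n (left_end n 0 (fst p @ v)) (left_end n 0 (snd p @ v))"
        by (rule ones_residue_eq[OF n])
      show "\<beta> ((fst p @ v) @ w) = left_end n 0 ((snd p @ v) @ w)" for w
        using pair(2)[OF p, of "v @ w"] by simp
    qed
    then show "list_all2 (\<lambda>t s. phase n 0 t = 0 \<and> residue_eq n (left_end n 0 t) (left_end n 0 s) \<and>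
      (\<forall>w. \<beta> (t @ w) = left_end n 0 (s @ w)))
      (map (\<lambda>v. fst p @ v) (addresses (completion n (fst p)))) (map (\<lambda>v. snd p @ v) (addresses (completion n (fst p))))"
      by (auto simp: list.rel_map intro!: list.rel_refl_strong)
  qed
  have "list_all2 (\<lambda>t s. residue_eq n (width n 0 t) (width n 0 s)) ts ss"
    by (rule widths_residue[OF n ct cs]) (rule list_all2_mono[OF all], simp)
  then have ph: "list_all2 (\<lambda>t s. phase n 0 t = 0 \<and> phase n 0 s = 0) ts ss"
    using all width_residue_phase[OF n] by (auto simp: list_all2_conv_all_nth)
  obtain f where f: "f \<in> carrier (F_group n)" "list_all2 (interpolates n f) ts ss"
    using interpolant_in_F_group[OF n ct cs ph] by blast
  have F: "F_shaped (pair_diagram T S)" using F_shaped_pair_diagram[OF M] .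
  have "\<beta> u = (f \<circ> left_end n 0) u" for u
  proof -
    obtain k a w where a: "a \<in> set (addresses T)" "u @ replicate k False = a @ w"
      using addresses_complete by blast
    obtain p where p: "p \<in> set ps" "fst p = a" using a(1) mp(1) by (metis image_iff list.set_map)
    obtain k' v w' where v: "v \<in> set (addresses (completion n a))" "w @ replicate k' False = v @ w'"
      using addresses_complete by blast
    have "a @ v \<in> set ts" using p v(1) by (auto simp: ts_def)
    then obtain i where i: "i < length ts" "ts ! i = a @ v" by (metis in_set_conv_nth)
    let ?s = "ss ! i"
    have "\<beta> ((a @ v) @ w') = left_end n 0 (?s @ w')" "interpolates n f (a @ v) ?s"
      "phase n 0 (a @ v) = 0" "phase n 0 ?s = 0"
      using all f(2) ph i by (auto simp: list_all2_conv_all_nth)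
    then have "\<beta> ((a @ v) @ w') = f (left_end n 0 ((a @ v) @ w'))"
      using interpolates_word[OF n] by metis
    moreover have "(a @ v) @ w' = u @ replicate (k + k') False"
      using a(2) v(2) by (metis append.assoc replicate_add)
    ultimately have "\<beta> (u @ replicate (k + k') False) = f (left_end n 0 (u @ replicate (k + k') False))"
      by simp
    then show ?thesis using zero_tail_replicate[OF transports_zero_tail(2)[OF F tr]] by simp
  qed
  then have "\<beta> = f \<circ> left_end n 0" by (rule ext)
  then show ?thesis using f(1) by blast
qed

lemma good_of_F_group:
  assumes n: "n \<ge> 2" and M: "matching_pair T S" and f: "f \<in> carrier (F_group n)"
    and tr: "transports (pair_diagram T S) (left_end n 0) (f \<circ> left_end n 0)"
  shows "good (n - 1) (pair_diagram T S)"
  unfolding good_pair_diagram[OF M]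
proof (intro allI impI)
  fix i assume i: "i < length (leaf_labels T)"
  have "f (left_end n 0 (addresses T ! i)) = left_end n 0 (addresses S ! i)"
    using transports_pair[OF M tr i, of "[]"] by simp
  moreover have "left_end n 0 (addresses T ! i) \<in> {0..1}"
    using left_end_nonneg left_end_less_1[OF n] by (auto simp: less_imp_le)
  ultimately have "residue_eq n (left_end n 0 (addresses S ! i)) (left_end n 0 (addresses T ! i))"
    using F_group_n_adic(2)[OF n f _ left_end_n_adic[OF n]] by metis
  then show "ones (addresses T ! i) mod (n - 1) = ones (addresses S ! i) mod (n - 1)"
    using residue_eq_ones[OF n] by metis
qed

section \<open>The product of diagrams\<close>

lemma separating_left_end: "n \<ge> 2 \<Longrightarrow> separating (left_end n 0)"
  unfolding separating_def using left_end_inj[of 0 n] by auto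

lemma class_of:
  assumes "X \<in> A // isotopy" "A \<subseteq> reduced_F_diagrams"
  obtains D where "D \<in> A" "D \<in> X" "X = isotopy `` {D}"
proof -
  obtain D where D: "D \<in> A" "X = isotopy `` {D}" using assms(1) by (auto elim: quotientE)
  have "is_diagram D" using D(1) assms(2) by (auto simp: reduced_F_diagrams_def)
  then have "D \<in> X" using D(2) isotopic_refl by (simp add: isotopy_def)
  then show ?thesis using that D by blast
qed

lemma class_members:
  assumes "X \<in> reduced_F_diagrams // isotopy" "D \<in> X" "D' \<in> X"
  shows "F_shaped D" "isotopic D D'" "transports D \<alpha> \<beta> \<longleftrightarrow> transports D' \<alpha> \<beta>"
proof -
  obtain D0 where D0: "D0 \<in> reduced_F_diagrams" "X = isotopy `` {D0}" using class_of[OF assms(1)] by blast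
  have i: "is_diagram E \<and> isotopic D0 E \<and> F_shaped E" if "E \<in> X" for E
    using that D0 isotopic_length[of D0 E] by (auto simp: isotopy_def F_shaped_def reduced_F_diagrams_def)
  show F: "F_shaped D" using i assms(2) by blast
  have F': "F_shaped D'" using i assms(3) by blast
  have s: "layered D0" using D0(1) by (simp add: reduced_F_diagrams_def is_diagram_iff_layered)
  show iso: "isotopic D D'"
    using isotopic_trans[OF isotopic_sym[OF _ s]] i assms(2,3) by blast
  show "transports D \<alpha> \<beta> \<longleftrightarrow> transports D' \<alpha> \<beta>"
    by (rule transports_iffI[OF F F']) (rule transports_isotopic[OF F iso])
qed

lemma class_eqI:
  assumes "isotopic D D'" "is_diagram D" "is_diagram D'"
  shows "isotopy `` {D} = isotopy `` {D'}"
  using equiv_class_eq[OF equiv_isotopy] assms by (auto simp: isotopy_def)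

lemma classes_eqI:
  assumes X: "X \<in> reduced_F_diagrams // isotopy" and Y: "Y \<in> reduced_F_diagrams // isotopy"
    and D: "D \<in> X" "transports D \<alpha> \<beta>" and E: "E \<in> Y" "transports E \<alpha> \<beta>" and sep: "separating \<alpha>"
  shows "X = Y"
proof -
  obtain D0 where D0: "D0 \<in> reduced_F_diagrams" "D0 \<in> X" "X = isotopy `` {D0}" using class_of[OF X] by blast
  obtain E0 where E0: "E0 \<in> reduced_F_diagrams" "E0 \<in> Y" "Y = isotopy `` {E0}" using class_of[OF Y] by blast
  have "transports D0 \<alpha> \<beta>" "transports E0 \<alpha> \<beta>"
    using class_members(3)[OF X D(1) D0(2)] class_members(3)[OF Y E(1) E0(2)] D(2) E(2) by blast+
  then have "isotopic D0 E0" using reduced_transports_isotopic[OF D0(1) E0(1) sep] by blast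
  then show ?thesis using class_eqI D0 E0 by (auto simp: reduced_F_diagrams_def)
qed

text \<open>
  The top edge of the second diagram is renamed to the bottom edge of the first; all other vertices and
  labels are shifted beyond those of the first.
\<close>
lemma composable_representative:
  assumes D1: "F_shaped D1" and D2: "F_shaped D2"
  shows "\<exists>D2'. isotopic D2 D2' \<and> is_diagram D2' \<and> composable D1 D2'"
proof -
  note F1 = F_shaped_paths[OF D1] and F2 = F_shaped_paths[OF D2]
  define e1 e2 where "e1 = hd (bottom_path D1)" and "e2 = hd (top_path D2)"
  have bt: "bottom_path D1 = [e1]" "top_path D2 = [e2]" using F1(2) F2(1) by (simp_all add: e1_def e2_def)
  have e: "e1 \<in> edges D1" "e2 \<in> edges D2" using F1(5) F2(4) by (simp_all add: e1_def e2_def)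
  have ne1: "source e1 \<noteq> target e1" using layered_simple[OF F1(3)] bt by (auto simp: simple_path_def)
  have ne2: "source e2 \<noteq> target e2" using layered_simple[OF F2(3)] bt by (auto simp: simple_path_def)
  have fin: "finite (edges D1)" using layered_edges[OF F1(3)] by simp
  have "finite (vertices D1)" using fin by (simp add: vertices_def)
  then obtain N where N: "\<And>v. v \<in> vertices D1 \<Longrightarrow> v < N" using finite_nat_set_iff_bounded by auto
  have "finite (label ` edges D1)" using fin by simp
  then obtain L where L: "\<And>x. x \<in> edges D1 \<Longrightarrow> label x < L" using finite_nat_set_iff_bounded by auto
  define f where "f = (\<lambda>v. if v = source e2 then source e1 else if v = target e2 then target e1 else v + N)"
  define g where "g = (\<lambda>x. if x = e2 then e1 else Edge (f (source x)) (label x + L) (f (target x)))"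
  have v1: "source e1 \<in> vertices D1" "target e1 \<in> vertices D1" using e by (auto simp: vertices_def)
  then have below: "source e1 < N" "target e1 < N" using N by auto
  have injf: "inj f" using ne1 ne2 below by (auto simp: inj_def f_def)
  have resp: "respects_ends f g (edges D2)" using ne2 by (auto simp: respects_ends_def g_def f_def)
  have lab: "label (g x) \<ge> L" if "x \<noteq> e2" for x using that by (simp add: g_def)
  have injg: "inj_on g (edges D2)"
  proof (rule inj_onI)
    fix x y assume eq: "g x = g y"
    have lab1: "label e1 < L" using L e by simp
    show "x = y"
    proof (cases "x = e2 \<or> y = e2")
      case True
      then show ?thesis using eq lab1 lab[of x] lab[of y] by (metis g_def not_le)
    next
      case False
      then have "f (source x) = f (source y)" "label x = label y" "f (target x) = f (target y)"
        using eq by (auto simp: g_def)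
      then show ?thesis using injf by (metis edge.expand injD)
    qed
  qed
  let ?D = "map_diagram g D2"
  have iso: "isotopic D2 ?D" unfolding isotopic_def
    by (intro exI[of _ f] exI[of _ g] conjI) (use resp injg injf in \<open>auto intro: inj_on_subset\<close>)
  have "composable D1 ?D"
    unfolding composable_def
  proof (intro conjI)
    show "bottom_path D1 = top_path ?D" by (simp add: bt g_def)
    have top: "top_path ?D = [e1]" by (simp add: bt g_def)
    have V: "vertices ?D = f ` vertices D2" by (rule vertices_map[OF resp])
    have v2: "source e2 \<in> vertices D2" "target e2 \<in> vertices D2" using e by (auto simp: vertices_def)
    have shared: "v = source e2 \<or> v = target e2" if "f v \<in> vertices D1" for v
      using N[OF that] by (auto simp: f_def split: if_splits)
    have fe: "f (source e2) = source e1" "f (target e2) = target e1" using ne2 by (auto simp: f_def)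
    have pv: "path_vertices (top_path ?D) = {source e1, target e1}"
      unfolding top by (auto simp: path_vertices_def)
    show "vertices D1 \<inter> vertices ?D = path_vertices (top_path ?D)"
      unfolding pv
    proof (intro equalityI subsetI)
      fix x assume "x \<in> vertices D1 \<inter> vertices ?D"
      then obtain v where "x = f v" "f v \<in> vertices D1" unfolding V by auto
      then show "x \<in> {source e1, target e1}" using shared[of v] fe by auto
    next
      fix x assume "x \<in> {source e1, target e1}"
      then show "x \<in> vertices D1 \<inter> vertices ?D" unfolding V using v1 v2 fe by (metis IntI imageI insertE singletonD)
    qed
    have "g x \<in> edges D1 \<Longrightarrow> x = e2" for x using L[of "g x"] lab[of x] by fastforce
    moreover have "g e2 = e1" by (simp add: g_def)
    ultimately show "edges D1 \<inter> edges ?D = set (top_path ?D)"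
      unfolding top using e by auto
  qed
  moreover have "is_diagram ?D" using isotopic_layered[OF iso F2(3)] is_diagram_iff_layered by blast
  ultimately show ?thesis using iso by blast
qed

lemma F_shaped_compose:
  assumes "F_shaped D1" "F_shaped D2" "composable D1 D2" shows "F_shaped (compose_diagram D1 D2)"
  using assms is_diagram.compose[of D1 D2] unfolding F_shaped_def by (auto simp: compose_diagram_def)

text \<open>
  Composites of all representatives have the same transport, so their reduced forms are isotopic; this
  makes the description of the product in the definition unique.
\<close>
lemma product_transports:
  fixes \<alpha> \<gamma> :: "bool list \<Rightarrow> real"
  assumes X: "X \<in> reduced_F_diagrams // isotopy" and Y: "Y \<in> reduced_F_diagrams // isotopy"
    and D1: "D1 \<in> X" "transports D1 \<beta> \<gamma>" and D2: "D2 \<in> Y" "transports D2 \<alpha> \<beta>"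
  shows "\<exists>Z. F_mult X Y = Z \<and> Z \<in> reduced_F_diagrams // isotopy \<and> (\<exists>D\<in>Z. transports D \<alpha> \<gamma>)"
proof -
  let ?P = "\<lambda>Z. Z \<in> reduced_F_diagrams // isotopy \<and>
    (\<exists>D1\<in>X. \<exists>D2\<in>Y. \<exists>D\<in>Z. composable D1 D2 \<and> dipole_equivalent (compose_diagram D1 D2) D)"
  have composite: "transports D a c"
    if "E1 \<in> X" "E2 \<in> Y" "composable E1 E2" "dipole_equivalent (compose_diagram E1 E2) D"
      "transports D2 a b" "transports D1 b c" for E1 E2 D and a b c :: "bool list \<Rightarrow> real"
  proof -
    have F: "F_shaped E1" "F_shaped E2" using class_members(1) X Y that by blast+
    have "transports E2 a b" "transports E1 b c"
      using class_members(3)[OF Y D2(1) that(2)] class_members(3)[OF X D1(1) that(1)] that by blast+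
    then have "transports (compose_diagram E1 E2) a c" using transports_compose[OF F that(3)] by blast
    then show ?thesis
      using transports_dipole_equivalent[OF F_shaped_compose[OF F that(3)] that(4)] by blast
  qed
  have F1: "F_shaped D1" and F2: "F_shaped D2" using class_members(1) X Y D1 D2 by blast+
  obtain D2' where D2': "isotopic D2 D2'" "is_diagram D2'" "composable D1 D2'"
    using composable_representative[OF F1 F2] by blast
  have D2'Y: "D2' \<in> Y"
  proof -
    obtain D0 where D0: "D0 \<in> Y" "Y = isotopy `` {D0}" "D0 \<in> reduced_F_diagrams" using class_of[OF Y] by blast
    have "isotopic D0 D2'" using isotopic_trans[OF class_members(2)[OF Y D0(1) D2(1)] D2'(1)] .
    then show ?thesis using D0 D2'(2) by (auto simp: isotopy_def reduced_F_diagrams_def)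
  qed
  have F2': "F_shaped D2'" using class_members(1)[OF Y D2'Y D2'Y] .
  note FC = F_shaped_compose[OF F1 F2' D2'(3)]
  obtain D where D: "is_diagram D" "reduced D" "dipole_equivalent (compose_diagram D1 D2') D"
    "length (top_path D) = 1" "length (bottom_path D) = 1"
    using reduces_to[of "compose_diagram D1 D2'"] FC unfolding F_shaped_def by auto
  let ?Z = "isotopy `` {D}"
  have DR: "D \<in> reduced_F_diagrams" using D by (simp add: reduced_F_diagrams_def)
  have DZ: "D \<in> ?Z" using D(1) isotopic_refl by (simp add: isotopy_def)
  have PZ: "?P ?Z" using DR DZ D1(1) D2'Y D2'(3) D(3) by (auto intro!: quotientI)
  have uniq: "Z = ?Z" if Z: "?P Z" for Z
  proof -
    obtain E1 E2 E where E: "E1 \<in> X" "E2 \<in> Y" "E \<in> Z" "composable E1 E2"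
      "dipole_equivalent (compose_diagram E1 E2) E" using Z by blast
    \<comment> \<open>The base 2 is arbitrary: any function that separates words would distinguish reduced diagrams.\<close>
    obtain b where b: "transports D2 (left_end 2 0) b"
      using transports_exists[OF F2 zero_tail_left_end] by blast
    obtain c where c: "transports D1 b c"
      using transports_exists[OF F1 transports_zero_tail(2)[OF F2 b]] by blast
    have "transports E (left_end 2 0) c" "transports D (left_end 2 0) c"
      using composite[OF E(1,2,4,5) b c] composite[OF D1(1) D2'Y D2'(3) D(3) b c] .
    then show ?thesis
      using classes_eqI[OF _ _ E(3) _ DZ _ separating_left_end[of 2]] Z PZ by blast
  qed
  have "F_mult X Y = ?Z" unfolding F_mult_def using PZ uniq by (rule the_equality)
  then show ?thesis using PZ DZ composite[OF D1(1) D2'Y D2'(3) D(3) D2(2) D1(2)] by blast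
qed

section \<open>The isomorphism\<close>

text \<open>
  The class \<open>X\<close>, regarded as a homeomorphism in the coordinates given by \<open>left_end n 0\<close>, is \<open>f\<close>.
\<close>
definition represents :: "nat \<Rightarrow> diagram set \<Rightarrow> (real \<Rightarrow> real) \<Rightarrow> bool" where
  "represents n X f \<longleftrightarrow> f \<in> carrier (F_group n) \<and>
     (\<exists>D\<in>X. transports D (left_end n 0) (f \<circ> left_end n 0))"

lemma jones_subset: "{D \<in> reduced_F_diagrams. good m D} // isotopy \<subseteq> reduced_F_diagrams // isotopy"
  by (auto simp: quotient_def)

lemma represents_exists:
  assumes n: "n \<ge> 2" and X: "X \<in> carrier (jones_subgroup (n - 1))"
  shows "\<exists>f. represents n X f"
proof -
  have "X \<in> {D \<in> reduced_F_diagrams. good (n - 1) D} // isotopy" using X by (simp add: jones_subgroup_def)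
  then obtain D where D: "D \<in> reduced_F_diagrams" "good (n - 1) D" "D \<in> X"
    by (rule class_of) auto
  obtain T S where TS: "matching_pair T S" "D = pair_diagram T S" using reduced_pair_diagram[OF D(1)] .
  obtain \<beta> where "transports D (left_end n 0) \<beta>"
    using transports_exists[OF F_shaped_pair_diagram[OF TS(1)] zero_tail_left_end] TS(2) by blast
  then show ?thesis
    using F_group_of_good_diagram[OF n TS(1)] D TS(2) unfolding represents_def by blast
qed

lemma represented:
  assumes n: "n \<ge> 2" and f: "f \<in> carrier (F_group n)"
  shows "\<exists>X\<in>carrier (jones_subgroup (n - 1)). represents n X f"
proof -
  obtain D0 where D0: "F_shaped D0" "transports D0 (left_end n 0) (f \<circ> left_end n 0)"
    using diagram_of_F_group[OF n f] by blast
  obtain D where D: "is_diagram D" "reduced D" "dipole_equivalent D0 D"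
    "length (top_path D) = 1" "length (bottom_path D) = 1"
    using reduces_to[of D0] D0(1) unfolding F_shaped_def by auto
  have tr: "transports D (left_end n 0) (f \<circ> left_end n 0)"
    using transports_dipole_equivalent[OF D0(1) D(3)] D0(2) by blast
  have DR: "D \<in> reduced_F_diagrams" using D by (simp add: reduced_F_diagrams_def)
  obtain T S where TS: "matching_pair T S" "D = pair_diagram T S" using reduced_pair_diagram[OF DR] .
  have "good (n - 1) D" using good_of_F_group[OF n TS(1) f] tr TS(2) by simp
  then have "isotopy `` {D} \<in> carrier (jones_subgroup (n - 1))"
    using DR by (auto simp: jones_subgroup_def intro!: quotientI)
  moreover have "D \<in> isotopy `` {D}" using D(1) isotopic_refl by (simp add: isotopy_def)
  ultimately show ?thesis using tr f unfolding represents_def by blast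
qed

lemma represents_inj:
  assumes "n \<ge> 2" "X \<in> reduced_F_diagrams // isotopy" "Y \<in> reduced_F_diagrams // isotopy"
    "represents n X f" "represents n Y f"
  shows "X = Y"
  using assms classes_eqI[OF assms(2,3)] separating_left_end[OF assms(1)] unfolding represents_def by blast

lemma represents_unique:
  assumes n: "n \<ge> 2" and X: "X \<in> reduced_F_diagrams // isotopy" and f: "represents n X f" and g: "represents n X g"
  shows "f = g"
proof (rule F_group_eqI[OF n])
  show "f \<in> carrier (F_group n)" "g \<in> carrier (F_group n)" using f g by (auto simp: represents_def)
  obtain D E where D: "D \<in> X" "transports D (left_end n 0) (f \<circ> left_end n 0)"
    and E: "E \<in> X" "transports E (left_end n 0) (g \<circ> left_end n 0)"
    using f g unfolding represents_def by blast
  have "transports D (left_end n 0) (g \<circ> left_end n 0)" using class_members(3)[OF X D(1) E(1)] E(2) by blast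
  then have "f \<circ> left_end n 0 = g \<circ> left_end n 0"
    using transports_unique[OF class_members(1)[OF X D(1) D(1)] D(2)] by blast
  then show "f (left_end n 0 w) = g (left_end n 0 w)" for w by (metis comp_apply)
qed

text \<open>
  The second factor is transported first, from the bottom; then naturality of transport applies
  \<open>g\<close> to the values of the first factor. The result \<open>g \<circ> f\<close> is the product in \<open>F\<^sub>n\<close>,
  which composes from left to right.
\<close>
lemma represents_mult:
  assumes n: "n \<ge> 2" and X: "X \<in> reduced_F_diagrams // isotopy" and Y: "Y \<in> reduced_F_diagrams // isotopy"
    and f: "represents n X f" and g: "represents n Y g"
  shows "F_mult X Y \<in> reduced_F_diagrams // isotopy \<and> represents n (F_mult X Y) (f \<otimes>\<^bsub>F_group n\<^esub> g)"
proof -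
  obtain D where D: "D \<in> X" "transports D (left_end n 0) (f \<circ> left_end n 0)" and fc: "f \<in> carrier (F_group n)"
    using f unfolding represents_def by blast
  obtain E where E: "E \<in> Y" "transports E (left_end n 0) (g \<circ> left_end n 0)" and gc: "g \<in> carrier (F_group n)"
    using g unfolding represents_def by blast
  have "transports D (g \<circ> left_end n 0) (g \<circ> (f \<circ> left_end n 0))" using transports_natural[OF D(2)] .
  from product_transports[OF X Y D(1) this E]
  obtain Z where Z: "F_mult X Y = Z" "Z \<in> reduced_F_diagrams // isotopy"
    "\<exists>D\<in>Z. transports D (left_end n 0) (g \<circ> (f \<circ> left_end n 0))" by blast
  have "left_end n 0 w \<in> {0..1}" for w using left_end_nonneg left_end_less_1[OF n] by (auto simp: less_imp_le)
  then have "g \<circ> (f \<circ> left_end n 0) = (f \<otimes>\<^bsub>F_group n\<^esub> g) \<circ> left_end n 0"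
    by (auto simp: F_group_def compose_def fun_eq_iff)
  moreover have "f \<otimes>\<^bsub>F_group n\<^esub> g \<in> carrier (F_group n)"
    using group_F_group[OF n] fc gc by (simp add: group.is_monoid monoid.m_closed)
  ultimately show ?thesis using Z unfolding represents_def by auto
qed

lemma represents_one:
  assumes n: "n \<ge> 2"
  shows "\<one>\<^bsub>jones_subgroup (n - 1)\<^esub> \<in> carrier (jones_subgroup (n - 1)) \<and>
    represents n \<one>\<^bsub>jones_subgroup (n - 1)\<^esub> \<one>\<^bsub>F_group n\<^esub>"
proof -
  let ?E = "edge_diagram (Edge 0 0 1)"
  have d: "is_diagram ?E" by (rule is_diagram.unit) simp
  have R: "?E \<in> reduced_F_diagrams"
    using d by (simp add: reduced_F_diagrams_def edge_diagram_def reduced_def dipole_def)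
  have "inner_vertices ?E = {}"
    unfolding inner_vertices_def using vertices_edge_diagram[of "Edge 0 0 1"] by simp
  then have "good (n - 1) ?E" by (simp add: good_def)
  then have 1: "isotopy `` {?E} \<in> carrier (jones_subgroup (n - 1))"
    using R by (auto simp: jones_subgroup_def intro!: quotientI)
  have "transports ?E (left_end n 0) (left_end n 0)"
    unfolding transports_def develops_def
    by (intro exI[of _ "\<lambda>_. left_end n 0"]) (auto simp: zero_tail_left_end edge_diagram_def)
  moreover have "left_end n 0 w \<in> {0..1}" for w
    using left_end_nonneg left_end_less_1[OF n] by (auto simp: less_imp_le)
  then have "\<one>\<^bsub>F_group n\<^esub> \<circ> left_end n 0 = left_end n 0"
    by (auto simp: F_group_def fun_eq_iff)
  moreover have "?E \<in> isotopy `` {?E}" using d isotopic_refl by (simp add: isotopy_def)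
  moreover have "\<one>\<^bsub>F_group n\<^esub> \<in> carrier (F_group n)"
    using group_F_group[OF n] by (simp add: group.is_monoid)
  ultimately have "represents n (isotopy `` {?E}) \<one>\<^bsub>F_group n\<^esub>"
    unfolding represents_def by metis
  moreover have "\<one>\<^bsub>jones_subgroup (n - 1)\<^esub> = isotopy `` {?E}"
    by (simp add: jones_subgroup_def thompson_F_def)
  ultimately show ?thesis using 1 by simp
qed

text \<open>
  The identities of a group can be checked after applying an injective map to a group.
\<close>
lemma group_transfer:
  fixes G :: "('a, 'x) monoid_scheme" and H :: "('b, 'y) monoid_scheme"
  assumes H: "group H" and bij: "bij_betw \<phi> (carrier G) (carrier H)"
    and closed: "\<And>x y. x \<in> carrier G \<Longrightarrow> y \<in> carrier G \<Longrightarrow> x \<otimes>\<^bsub>G\<^esub> y \<in> carrier G"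
    and hom: "\<And>x y. x \<in> carrier G \<Longrightarrow> y \<in> carrier G \<Longrightarrow> \<phi> (x \<otimes>\<^bsub>G\<^esub> y) = \<phi> x \<otimes>\<^bsub>H\<^esub> \<phi> y"
    and one: "\<one>\<^bsub>G\<^esub> \<in> carrier G" "\<phi> \<one>\<^bsub>G\<^esub> = \<one>\<^bsub>H\<^esub>"
  shows "group G \<and> G \<cong> H"
proof -
  interpret H: group H by (rule H)
  have img: "\<phi> x \<in> carrier H" if "x \<in> carrier G" for x using bij that by (auto simp: bij_betw_def)
  have inj: "x = y" if "x \<in> carrier G" "y \<in> carrier G" "\<phi> x = \<phi> y" for x y
    using bij that by (auto simp: bij_betw_def inj_on_def)
  have "group G"
  proof (rule groupI)
    fix x y z assume "x \<in> carrier G" "y \<in> carrier G" "z \<in> carrier G"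
    then show "x \<otimes>\<^bsub>G\<^esub> y \<otimes>\<^bsub>G\<^esub> z = x \<otimes>\<^bsub>G\<^esub> (y \<otimes>\<^bsub>G\<^esub> z)"
      by (intro inj) (simp_all add: closed hom img H.m_assoc)
  next
    fix x assume x: "x \<in> carrier G"
    then show "\<one>\<^bsub>G\<^esub> \<otimes>\<^bsub>G\<^esub> x = x" by (intro inj) (simp_all add: closed hom img one)
    obtain y where y: "y \<in> carrier G" "\<phi> y = inv\<^bsub>H\<^esub> \<phi> x"
      using bij img[OF x] H.inv_closed by (metis bij_betw_def image_iff)
    have "y \<otimes>\<^bsub>G\<^esub> x = \<one>\<^bsub>G\<^esub>"
      by (rule inj) (simp_all add: x y closed hom one img)
    then show "\<exists>y\<in>carrier G. y \<otimes>\<^bsub>G\<^esub> x = \<one>\<^bsub>G\<^esub>" using y(1) by blast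
  qed (auto intro: closed one)
  moreover have "\<phi> \<in> iso G H" using bij hom img by (auto simp: iso_def hom_def)
  ultimately show ?thesis by (auto simp: is_iso_def)
qed

theorem lemma5p10:
  fixes n :: nat
  assumes "n \<ge> 2"
  shows "group (jones_subgroup (n - 1)) \<and> group (F_group n) \<and> jones_subgroup (n - 1) \<cong> F_group n"
proof -
  let ?J = "jones_subgroup (n - 1)" and ?F = "F_group n"
  define \<phi> where "\<phi> X = (THE f. represents n X f)" for X
  have sub: "X \<in> reduced_F_diagrams // isotopy" if "X \<in> carrier ?J" for X
    using that jones_subset by (auto simp: jones_subgroup_def)
  have eq: "\<phi> X = f" if "X \<in> carrier ?J" "represents n X f" for X f
    unfolding \<phi>_def using represents_unique[OF assms sub[OF that(1)]] that(2) by blast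
  have rep: "represents n X (\<phi> X)" if "X \<in> carrier ?J" for X
    using represents_exists[OF assms that] eq[OF that] by metis
  have mult: "X \<otimes>\<^bsub>?J\<^esub> Y = F_mult X Y" for X Y
    by (simp add: jones_subgroup_def thompson_F_def)
  have prod: "X \<otimes>\<^bsub>?J\<^esub> Y \<in> carrier ?J \<and> represents n (X \<otimes>\<^bsub>?J\<^esub> Y) (\<phi> X \<otimes>\<^bsub>?F\<^esub> \<phi> Y)"
    if X: "X \<in> carrier ?J" and Y: "Y \<in> carrier ?J" for X Y
  proof -
    have P: "F_mult X Y \<in> reduced_F_diagrams // isotopy" "represents n (F_mult X Y) (\<phi> X \<otimes>\<^bsub>?F\<^esub> \<phi> Y)"
      using represents_mult[OF assms sub[OF X] sub[OF Y] rep[OF X] rep[OF Y]] by auto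
    then have "\<phi> X \<otimes>\<^bsub>?F\<^esub> \<phi> Y \<in> carrier ?F" by (simp add: represents_def)
    \<comment> \<open>Closure under products comes from \<open>F\<^sub>n\<close>: the product of the images is represented by a good class,
      and by injectivity this is the product of the classes.\<close>
    then obtain Z where Z: "Z \<in> carrier ?J" "represents n Z (\<phi> X \<otimes>\<^bsub>?F\<^esub> \<phi> Y)"
      using represented[OF assms] by blast
    then have "F_mult X Y = Z" using represents_inj[OF assms P(1) sub[OF Z(1)] P(2)] by blast
    then show ?thesis using Z unfolding mult by simp
  qed
  have bij: "bij_betw \<phi> (carrier ?J) (carrier ?F)"
    unfolding bij_betw_def
  proof (intro conjI equalityI subsetI)
    show "inj_on \<phi> (carrier ?J)"
      using represents_inj[OF assms sub sub] rep by (metis inj_onI)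
    fix f assume "f \<in> \<phi> ` carrier ?J"
    then show "f \<in> carrier ?F" using rep by (auto simp: represents_def)
  next
    fix f assume "f \<in> carrier ?F"
    then obtain X where "X \<in> carrier ?J" "represents n X f" using represented[OF assms] by blast
    then show "f \<in> \<phi> ` carrier ?J" using eq by blast
  qed
  have "group ?J \<and> ?J \<cong> ?F"
    by (rule group_transfer[OF group_F_group[OF assms] bij])
      (use prod eq represents_one[OF assms] in auto)
  then show ?thesis using group_F_group[OF assms] by blast
qed

end
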